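(* Let $(M,d)$ be a complete metric space with base point $0$ and let $\phi\in\mathrm{Lip}_0(M)^*$. Then the following are equivalent: (i) $\phi$ has an optimal representation $\mu\in\mathcal{M}_{\mathrm{op}}(\beta\widetilde{M})$ concentrated on $\mathsf{R}^+$ satisfying $$\int_{\mathsf{R}^+}\frac{\bar{d}(\mathfrak{p}_1(\zeta),0)}{d(\zeta)}\,d\mu(\zeta)<\infty;$$ (ii) $\phi$ is majorisable and avoids $0$ and infinity. If these hold, then $\mu$ in (i) can be chosen to satisfy $(\mathfrak{p}_1)_\sharp\mu|_{M^{\mathcal{R}}\setminus\{0\}}\perp(\mathfrak{p}_2)_\sharp\mu|_{M^{\mathcal{R}}\setminus\{0\}}$.
   Context: Basic spaces. $(M,d)$ is a complete metric space with base point $0\in M$. $\mathrm{Lip}_0(M)$ is the Banach space of real-valued Lipschitz functions $f$ on $M$ with $f(0)=0$, normed by the optimal Lipschitz constant $\|f\|_L$. $\widetilde{M}=\{(x,y)\in M\times M: x\neq y\}$ and $\beta\widetilde{M}$ is its Stone-Čech compactification. For a Hausdorff space $X$, $\mathcal{M}(X)$ is the Banach space (total variation norm) of signed Radon measures on $X$ (Borel, countably additive, regular, tight, finite). A measure is "concentrated on $C$" if $C$ is measurable for it and the complement of $C$ is null. $\Phi:\mathrm{Lip}_0(M)\to C(\beta\widetilde{M})$ is given by $(\Phi f)(x,y)=\frac{f(x)-f(y)}{d(x,y)}$ on $\widetilde{M}$, extended continuously to $\beta\widetilde{M}$; $\Phi^*:\mathcal{M}(\beta\widetilde{M})\to\mathrm{Lip}_0(M)^*$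 is its adjoint. $\mathcal{M}_{\mathrm{op}}(\beta\widetilde{M})=\{\mu\in\mathcal{M}(\beta\widetilde{M}):\mu\geq 0,\ \|\mu\|=\|\Phi^*\mu\|\}$. An optimal representation of $\phi$ is a $\mu\in\mathcal{M}_{\mathrm{op}}(\beta\widetilde{M})$ with $\Phi^*\mu=\phi$. Compactifications. $M^{\mathcal{U}}$ is the uniform (Samuel) compactification of $M$: the unique compactification to which every bounded uniformly continuous $f:M\to\mathbb{R}$ extends continuously and in which the closures of $A,B\subset M$ are disjoint iff $d(A,B)>0$. Every Lipschitz $f:M\to\mathbb{R}$ extends uniquely and continuously to $f^{\mathcal{U}}:M^{\mathcal{U}}\to[-\infty,\infty]$. With $\rho(x)=d(x,0)$, let $M^{\mathcal{R}}=\{\xi\in M^{\mathcal{U}}:\rho^{\mathcal{U}}(\xi)<\infty\}$, with the subspace topology, and $f^{\mathcal{R}}=f^{\mathcal{U}}|_{M^{\mathcal{R}}}$ (real-valued). For $\xi\in M^{\mathcal{R}}$, $\delta(\xi)\in\mathrm{Lip}_0(M)^*$ is $\langle f,\delta(\xi)\rangle=f^{\mathcal{R}}(\xi)$, and $\bar{d}(\xi,\eta)=\|\delta(\xi)-\delta(\eta)\|_{\mathrm{Lip}_0(M)^*}$, a metric on $M^{\mathcal{R}}$ extending $d$. Coordinates. $\mathfrak{p}_i:\beta\widetilde{M}\to M^{\mathcal{U}}$ ($i=1,2$) is the continuous extension of the $i$-th coordinate projection on $\widetilde{M}$. $\mathsf{R}^+=\{\zeta\in\beta\widetilde{M}:\mathfrak{p}_1(\zeta),\mathfrak{p}_2(\zeta)\in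 M^{\mathcal{R}},\ \mathfrak{p}_1(\zeta)\neq\mathfrak{p}_2(\zeta)\}$. The symbol $d$ also denotes the continuous extension of $d:\widetilde{M}\to\mathbb{R}$ to $\beta\widetilde{M}\to[0,\infty]$ (it is finite and positive on $\mathsf{R}^+$). For $\mu$ concentrated on $\mathsf{R}^+$, the pushforwards $(\mathfrak{p}_i)_\sharp\mu$ are regarded as measures on $M^{\mathcal{R}}$. Functionals. $\phi\in\mathrm{Lip}_0(M)^*$ is positive if $\langle f,\phi\rangle\geq 0$ for all $f\in\mathrm{Lip}_0(M)$ with $f\geq 0$ pointwise, and majorisable if it is the difference of two positive functionals in $\mathrm{Lip}_0(M)^*$. For $n\in\mathbb{Z}$ let $h_n:M\to\mathbb{R}$ be $h_n(x)=1$ if $\rho(x)\leq 2^n$, $h_n(x)=2-2^{-n}\rho(x)$ if $2^n\leq\rho(x)\leq 2^{n+1}$, $h_n(x)=0$ if $\rho(x)\geq 2^{n+1}$; the maps $W_{h_n}(f)=f\cdot h_n$ and $W_{1-h_n}(f)=f\cdot(1-h_n)$ are bounded operators on $\mathrm{Lip}_0(M)$. $\phi$ avoids infinity if $\lim_{n\to+\infty}W_{h_n}^*(\phi)=\phi$ in norm, and $\phi$ avoids $0$ if $\lim_{n\to+\infty}W_{1-h_{-n}}^*(\phi)=\phi$ in norm. *)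

theory Defs
  imports "HOL-Analysis.Analysis"
begin

section \<open>Lipschitz functions vanishing at the base point\<close>

text \<open>
  The metric space \<open>M\<close> is the whole type \<open>'a\<close>, and its base point is \<open>0 :: 'a\<close>.  The class
  \<^class>\<open>zero\<close> carries no axioms, so \<open>0\<close> is an arbitrary point and no algebraic structure on
  \<open>'a\<close> is implied.
\<close>

typedef (overloaded) ('a::"{metric_space, zero}") lip0 =
  "{f :: 'a \<Rightarrow> real. f 0 = 0 \<and> (\<exists>L. L-lipschitz_on UNIV f)}"
  morphisms lip_apply Abs_lip0
  by (rule exI[of _ "\<lambda>_. 0"]) (auto intro: lipschitz_on_constant)

setup_lifting type_definition_lip0

definition lip_const :: "('a::metric_space \<Rightarrow> real) \<Rightarrow> real"
  where "lip_const f = Inf {L. L-lipschitz_on UNIV f}"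

lemma lip_const_lipschitz:
  assumes "L-lipschitz_on UNIV f"
  shows "(lip_const f)-lipschitz_on UNIV f"
proof -
  let ?S = "{L. L-lipschitz_on UNIV f}"
  have ne: "?S \<noteq> {}" using assms by auto
  have nn: "0 \<le> lip_const f"
    unfolding lip_const_def using ne by (intro cInf_greatest) (auto dest: lipschitz_on_nonneg)
  have "dist (f x) (f y) \<le> lip_const f * dist x y" for x y
  proof (cases "x = y")
    case False
    then have "dist (f x) (f y) / dist x y \<le> lip_const f"
      unfolding lip_const_def using ne
      by (intro cInf_greatest) (auto simp: divide_le_eq dest: lipschitz_onD)
    then show ?thesis using False by (simp add: divide_le_eq)
  qed simp
  then show ?thesis using nn by (auto intro: lipschitz_onI)
qed

lemma lip_const_le: "L-lipschitz_on UNIV f \<Longrightarrow> lip_const f \<le> L"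
  unfolding lip_const_def
  by (rule cInf_lower) (auto intro: bdd_belowI[of _ 0] dest: lipschitz_on_nonneg)

lemma lip_const_nonneg: "L-lipschitz_on UNIV f \<Longrightarrow> 0 \<le> lip_const f"
  using lip_const_lipschitz lipschitz_on_nonneg by blast

lemma lip_const_add_le:
  assumes "K-lipschitz_on UNIV f" "L-lipschitz_on UNIV g"
  shows "lip_const (\<lambda>x. f x + g x) \<le> lip_const f + lip_const g"
  by (intro lip_const_le lipschitz_on_add lip_const_lipschitz[OF assms(1)]
      lip_const_lipschitz[OF assms(2)])

lemma lip_const_scale_le:
  assumes "L-lipschitz_on UNIV f"
  shows "lip_const (\<lambda>x. c * f x) \<le> \<bar>c\<bar> * lip_const f"
  by (intro lip_const_le lipschitz_on_cmult_real lip_const_lipschitz[OF assms])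

lemma lip_const_scale:
  assumes "L-lipschitz_on UNIV f"
  shows "lip_const (\<lambda>x. c * f x) = \<bar>c\<bar> * lip_const f"
proof (cases "c = 0")
  case True
  have "0-lipschitz_on UNIV (\<lambda>x::'a. 0 :: real)" by (rule lipschitz_on_constant)
  with True show ?thesis using lip_const_le lip_const_nonneg by fastforce
next
  case False
  have "lip_const (\<lambda>x. inverse c * (c * f x)) \<le> \<bar>inverse c\<bar> * lip_const (\<lambda>x. c * f x)"
    by (rule lip_const_scale_le) (rule lipschitz_on_cmult_real[OF assms])
  with False have "\<bar>c\<bar> * lip_const f \<le> lip_const (\<lambda>x. c * f x)"
    by (simp add: field_simps)
  with lip_const_scale_le[OF assms, of c] show ?thesis by simp
qed

instantiation lip0 :: ("{metric_space, zero}") real_normed_vector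
begin

lift_definition zero_lip0 :: "'a lip0" is "\<lambda>_. 0"
  by (auto intro: lipschitz_on_constant)

lift_definition plus_lip0 :: "'a lip0 \<Rightarrow> 'a lip0 \<Rightarrow> 'a lip0" is "\<lambda>f g x. f x + g x"
  by (auto intro: lipschitz_on_add)

lift_definition minus_lip0 :: "'a lip0 \<Rightarrow> 'a lip0 \<Rightarrow> 'a lip0" is "\<lambda>f g x. f x - g x"
  by (auto intro: lipschitz_on_diff)

lift_definition uminus_lip0 :: "'a lip0 \<Rightarrow> 'a lip0" is "\<lambda>f x. - f x"
  by (auto intro: lipschitz_on_minus)

lift_definition scaleR_lip0 :: "real \<Rightarrow> 'a lip0 \<Rightarrow> 'a lip0" is "\<lambda>c f x. c * f x"
  by (auto intro: lipschitz_on_cmult_real)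

lift_definition norm_lip0 :: "'a lip0 \<Rightarrow> real" is lip_const .

definition sgn_lip0 :: "'a lip0 \<Rightarrow> 'a lip0" where "sgn_lip0 f = scaleR (inverse (norm f)) f"

definition dist_lip0 :: "'a lip0 \<Rightarrow> 'a lip0 \<Rightarrow> real" where "dist_lip0 f g = norm (f - g)"

definition uniformity_lip0 :: "('a lip0 \<times> 'a lip0) filter"
  where "uniformity_lip0 = (INF e\<in>{0<..}. principal {(f, g). dist f g < e})"

definition open_lip0 :: "'a lip0 set \<Rightarrow> bool"
  where "open_lip0 U \<longleftrightarrow> (\<forall>f\<in>U. eventually (\<lambda>(f', g). f' = f \<longrightarrow> g \<in> U) uniformity)"

instance
proof
  fix f g h :: "'a lip0" and a b :: real
  show "f + g + h = f + (g + h)" by transfer (simp add: add.assoc)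
  show "f + g = g + f" by transfer (simp add: add.commute)
  show "0 + f = f" by transfer simp
  show "- f + f = 0" by transfer simp
  show "f - g = f + - g" by transfer simp
  show "a *\<^sub>R (f + g) = a *\<^sub>R f + a *\<^sub>R g" by transfer (simp add: distrib_left)
  show "(a + b) *\<^sub>R f = a *\<^sub>R f + b *\<^sub>R f" by transfer (simp add: distrib_right)
  show "a *\<^sub>R b *\<^sub>R f = (a * b) *\<^sub>R f" by transfer (simp add: mult.assoc)
  show "1 *\<^sub>R f = f" by transfer simp
  show "norm (f + g) \<le> norm f + norm g" by transfer (auto intro: lip_const_add_le)
  show "norm (a *\<^sub>R f) = \<bar>a\<bar> * norm f" by transfer (auto intro: lip_const_scale)
  show "norm f = 0 \<longleftrightarrow> f = 0"
  proof transfer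
    fix f :: "'a \<Rightarrow> real"
    assume f: "f 0 = 0 \<and> (\<exists>L. L-lipschitz_on UNIV f)"
    show "lip_const f = 0 \<longleftrightarrow> f = (\<lambda>_. 0)"
    proof
      assume "lip_const f = 0"
      with f have "0-lipschitz_on UNIV f" using lip_const_lipschitz by metis
      then have "dist (f x) (f 0) \<le> 0 * dist x 0" for x by (rule lipschitz_onD) auto
      with f show "f = (\<lambda>_. 0)" by (auto simp: fun_eq_iff)
    next
      assume "f = (\<lambda>_. 0)"
      moreover have "0-lipschitz_on UNIV (\<lambda>x::'a. 0 :: real)" by (rule lipschitz_on_constant)
      ultimately show "lip_const f = 0" using lip_const_le lip_const_nonneg by (metis order_antisym)
    qed
  qed
qed (rule sgn_lip0_def dist_lip0_def uniformity_lip0_def open_lip0_def)+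

end


section \<open>Compactifications\<close>

text \<open>
  For a family \<open>F\<close> of bounded real functions on \<open>X\<close>, the compactification of \<open>X\<close> generated by \<open>F\<close>
  is the closure of the image of \<open>X\<close> under the evaluation map into the product of copies of the
  line indexed by \<open>F\<close>.
\<close>

definition compact_embed :: "('p \<Rightarrow> real) set \<Rightarrow> 'p \<Rightarrow> ('p \<Rightarrow> real) \<Rightarrow> real"
  where "compact_embed F x = (\<lambda>f\<in>F. f x)"

definition compactification :: "'p set \<Rightarrow> ('p \<Rightarrow> real) set \<Rightarrow> (('p \<Rightarrow> real) \<Rightarrow> real) topology"
  where "compactification X F =
    subtopology (powertop_real F) (powertop_real F closure_of (compact_embed F ` X))"

text \<open>
  The continuous extension of \<open>g : X \<rightarrow> Y\<close>.  By density of \<open>X\<close>, it is determined on the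
  compactification as soon as it exists and \<open>Y\<close> is Hausdorff.
\<close>

definition cont_extension ::
    "'p set \<Rightarrow> ('p \<Rightarrow> real) set \<Rightarrow> 'q topology \<Rightarrow> ('p \<Rightarrow> 'q) \<Rightarrow> (('p \<Rightarrow> real) \<Rightarrow> real) \<Rightarrow> 'q"
  where "cont_extension X F Y g =
    (SOME h. continuous_map (compactification X F) Y h \<and> (\<forall>x\<in>X. h (compact_embed F x) = g x))"

definition Mtilde :: "('a \<times> 'a) set"
  where "Mtilde = {(x, y). x \<noteq> y}"

text \<open>
  Only the values on \<^const>\<open>Mtilde\<close> matter: functions that agree there give equal coordinates, so
  this yields the Stone-Cech compactification of the subspace \<^const>\<open>Mtilde\<close>.
\<close>

definition bdd_cont :: "('a::metric_space \<times> 'a \<Rightarrow> real) set"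
  where "bdd_cont = {f. continuous_on Mtilde f \<and> bounded (f ` Mtilde)}"

definition bdd_unif_cont :: "('a::metric_space \<Rightarrow> real) set"
  where "bdd_unif_cont = {f. uniformly_continuous_on UNIV f \<and> bounded (range f)}"

type_synonym 'p cpt = "('p \<Rightarrow> real) \<Rightarrow> real"

definition betaM :: "('a::metric_space \<times> 'a) cpt topology"
  where "betaM = compactification Mtilde bdd_cont"

definition MU :: "('a::metric_space) cpt topology"
  where "MU = compactification UNIV bdd_unif_cont"

abbreviation iotaU :: "'a::metric_space \<Rightarrow> 'a cpt"
  where "iotaU \<equiv> compact_embed bdd_unif_cont"

definition extU :: "('a::metric_space \<Rightarrow> real) \<Rightarrow> 'a cpt \<Rightarrow> ereal"
  where "extU f = cont_extension UNIV bdd_unif_cont euclidean (\<lambda>x. ereal (f x))"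

definition MR_set :: "('a::{metric_space, zero}) cpt set"
  where "MR_set = {\<xi> \<in> topspace MU. extU (\<lambda>x::'a. dist x 0) \<xi> < \<infinity>}"

definition MR :: "('a::{metric_space, zero}) cpt topology"
  where "MR = subtopology MU MR_set"

definition extR :: "('a::metric_space \<Rightarrow> real) \<Rightarrow> 'a cpt \<Rightarrow> real"
  where "extR f \<xi> = real_of_ereal (extU f \<xi>)"

text \<open>
  \<^const>\<open>Blinfun\<close> reads a bounded linear map as an element of the space of bounded linear
  maps.  Below it is meaningful for \<open>\<xi>\<close> in \<^const>\<open>MR_set\<close> (\<open>delta\<close>), for finite Borel measures
  (\<open>de_Leeuw_adj\<close>), and for the weights \<open>h\<^sub>n\<close> and \<open>1 - h\<^sub>n\<close> (\<open>weight_op\<close>).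
\<close>

definition delta :: "('a::{metric_space, zero}) cpt \<Rightarrow> 'a lip0 \<Rightarrow>\<^sub>L real"
  where "delta \<xi> = Blinfun (\<lambda>f. extR (lip_apply f) \<xi>)"

definition dbar :: "('a::{metric_space, zero}) cpt \<Rightarrow> 'a cpt \<Rightarrow> real"
  where "dbar \<xi> \<eta> = norm (delta \<xi> - delta \<eta>)"

definition coord1 :: "('a::metric_space \<times> 'a) cpt \<Rightarrow> 'a cpt"
  where "coord1 = cont_extension Mtilde bdd_cont MU (\<lambda>z. iotaU (fst z))"

definition coord2 :: "('a::metric_space \<times> 'a) cpt \<Rightarrow> 'a cpt"
  where "coord2 = cont_extension Mtilde bdd_cont MU (\<lambda>z. iotaU (snd z))"

definition dist_ext :: "('a::metric_space \<times> 'a) cpt \<Rightarrow> ennreal"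
  where "dist_ext = cont_extension Mtilde bdd_cont euclidean (\<lambda>(x, y). ennreal (dist x y))"

definition Rplus :: "('a::{metric_space, zero} \<times> 'a) cpt set"
  where "Rplus = {\<zeta> \<in> topspace betaM.
    coord1 \<zeta> \<in> MR_set \<and> coord2 \<zeta> \<in> MR_set \<and> coord1 \<zeta> \<noteq> coord2 \<zeta>}"


section \<open>Measures\<close>

definition borel_of_top :: "'p topology \<Rightarrow> 'p measure"
  where "borel_of_top X = sigma (topspace X) {U. openin X U}"

text \<open>Positive elements of the space of signed Radon measures: finite Borel measures that are
  regular and tight.\<close>

definition pos_radon :: "'p topology \<Rightarrow> 'p measure \<Rightarrow> bool"
  where "pos_radon X \<mu> \<longleftrightarrow>
    space \<mu> = topspace X \<and> sets \<mu> = sets (borel_of_top X) \<and> finite_measure \<mu> \<and>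
    (\<forall>A\<in>sets \<mu>.
      emeasure \<mu> A = (INF U\<in>{U. openin X U \<and> A \<subseteq> U}. emeasure \<mu> U) \<and>
      emeasure \<mu> A = (SUP C\<in>{C. closedin X C \<and> C \<subseteq> A}. emeasure \<mu> C)) \<and>
    emeasure \<mu> (space \<mu>) = (SUP K\<in>{K. compactin X K}. emeasure \<mu> K)"

definition concentrated_on :: "'p measure \<Rightarrow> 'p set \<Rightarrow> bool"
  where "concentrated_on \<mu> C \<longleftrightarrow>
    C \<in> sets (completion \<mu>) \<and> emeasure (completion \<mu>) (space \<mu> - C) = 0"

definition mutually_singular :: "'p measure \<Rightarrow> 'p measure \<Rightarrow> bool"
  where "mutually_singular \<mu> \<nu> \<longleftrightarrow> sets \<mu> = sets \<nu> \<and>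
    (\<exists>A\<in>sets \<mu>. emeasure \<mu> A = 0 \<and> emeasure \<nu> (space \<nu> - A) = 0)"

definition de_Leeuw :: "('a::{metric_space, zero}) lip0 \<Rightarrow> ('a \<times> 'a) cpt \<Rightarrow> real"
  where "de_Leeuw f = cont_extension Mtilde bdd_cont euclideanreal
    (\<lambda>(x, y). (lip_apply f x - lip_apply f y) / dist x y)"

definition de_Leeuw_adj :: "('a::{metric_space, zero} \<times> 'a) cpt measure \<Rightarrow> 'a lip0 \<Rightarrow>\<^sub>L real"
  where "de_Leeuw_adj \<mu> = Blinfun (\<lambda>f. \<integral>\<zeta>. de_Leeuw f \<zeta> \<partial>\<mu>)"

text \<open>The total variation norm of a positive measure is its total mass.\<close>

definition M_op :: "('a::{metric_space, zero} \<times> 'a) cpt measure set"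
  where "M_op = {\<mu>. pos_radon betaM \<mu> \<and> measure \<mu> (space \<mu>) = norm (de_Leeuw_adj \<mu>)}"

definition optimal_representation ::
    "('a::{metric_space, zero} \<times> 'a) cpt measure \<Rightarrow> ('a lip0 \<Rightarrow>\<^sub>L real) \<Rightarrow> bool"
  where "optimal_representation \<mu> \<phi> \<longleftrightarrow> \<mu> \<in> M_op \<and> de_Leeuw_adj \<mu> = \<phi>"

text \<open>
  For \<open>\<mu>\<close> concentrated on \<^const>\<open>Rplus\<close> and \<open>p\<close> one of the two coordinate maps: the pushforward
  of \<open>\<mu>\<close> under \<open>p\<close>, as a measure on \<^const>\<open>MR\<close>, restricted to the complement of the base point.
\<close>

definition pushforward_off_base ::
    "(('a::{metric_space, zero} \<times> 'a) cpt \<Rightarrow> 'a cpt) \<Rightarrow> ('a \<times> 'a) cpt measure \<Rightarrow> 'a cpt measure"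
  where "pushforward_off_base p \<mu> =
    restrict_space (distr (restrict_space \<mu> Rplus) (borel_of_top MR) p) (MR_set - {iotaU 0})"


section \<open>Functionals\<close>

definition positive_functional :: "('a::{metric_space, zero} lip0 \<Rightarrow>\<^sub>L real) \<Rightarrow> bool"
  where "positive_functional \<phi> \<longleftrightarrow>
    (\<forall>f. (\<forall>x. 0 \<le> lip_apply f x) \<longrightarrow> 0 \<le> blinfun_apply \<phi> f)"

definition majorisable :: "('a::{metric_space, zero} lip0 \<Rightarrow>\<^sub>L real) \<Rightarrow> bool"
  where "majorisable \<phi> \<longleftrightarrow>
    (\<exists>\<phi>1 \<phi>2. positive_functional \<phi>1 \<and> positive_functional \<phi>2 \<and> \<phi> = \<phi>1 - \<phi>2)"

definition cutoff :: "int \<Rightarrow> 'a::{metric_space, zero} \<Rightarrow> real"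
  where "cutoff n x =
    (if dist x 0 \<le> 2 powi n then 1
     else if dist x 0 \<le> 2 powi (n + 1) then 2 - 2 powi (- n) * dist x 0
     else 0)"

definition weight_op :: "('a::{metric_space, zero} \<Rightarrow> real) \<Rightarrow> 'a lip0 \<Rightarrow>\<^sub>L 'a lip0"
  where "weight_op h = Blinfun (\<lambda>f. Abs_lip0 (\<lambda>x. lip_apply f x * h x))"

definition weight_op_adj ::
    "('a::{metric_space, zero} \<Rightarrow> real) \<Rightarrow> ('a lip0 \<Rightarrow>\<^sub>L real) \<Rightarrow> ('a lip0 \<Rightarrow>\<^sub>L real)"
  where "weight_op_adj h \<phi> = \<phi> o\<^sub>L weight_op h"

definition avoids_infinity :: "('a::{metric_space, zero} lip0 \<Rightarrow>\<^sub>L real) \<Rightarrow> bool"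
  where "avoids_infinity \<phi> \<longleftrightarrow> ((\<lambda>n. weight_op_adj (cutoff n) \<phi>) \<longlongrightarrow> \<phi>) at_top"

definition avoids_zero :: "('a::{metric_space, zero} lip0 \<Rightarrow>\<^sub>L real) \<Rightarrow> bool"
  where "avoids_zero \<phi> \<longleftrightarrow>
    ((\<lambda>n. weight_op_adj (\<lambda>x. 1 - cutoff (- n) x) \<phi>) \<longlongrightarrow> \<phi>) at_top"

definition admissible_representation ::
    "('a::{metric_space, zero} \<times> 'a) cpt measure \<Rightarrow> ('a lip0 \<Rightarrow>\<^sub>L real) \<Rightarrow> bool"
  where "admissible_representation \<mu> \<phi> \<longleftrightarrow>
    optimal_representation \<mu> \<phi> \<and> concentrated_on \<mu> Rplus \<and>
    (\<integral>\<^sup>+\<zeta>\<in>Rplus. (ennreal (dbar (coord1 \<zeta>) (iotaU 0)) / dist_ext \<zeta>) \<partial>\<mu>) < \<infinity>"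

end

theory Submission
  imports Defs
begin

text \<open>
  Write \<open>\<rho>\<close> for the distance to the base point.  On \<open>R\<^sup>+\<close> the de Leeuw transform of \<open>f\<close> is the quotient
  \<open>(f(p\<^sub>1) - f(p\<^sub>2)) / d\<close>.  Integrability of \<open>\<rho>(p\<^sub>1) / d\<close>, and hence of \<open>\<rho>(p\<^sub>2) / d \<le> \<rho>(p\<^sub>1) / d + 1\<close>, splits
  the integral into two positive functionals, and dominated convergence gives the two limits.

  Conversely, let \<open>\<phi> = P - N\<close> be the Jordan decomposition.  The rule
  \<open>c + (f(x) - g(y)) / d(x, y) \<mapsto> c \<parallel>\<phi>\<parallel> + P f - N g\<close> defines a positive functional: if the left-hand side
  is nonnegative, then a \<open>c\<close>-Lipschitz function fits between \<open>g\<close> and \<open>f\<close> (Kantorovich duality), once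
  \<open>g \<le> f\<close> has been enforced on the diagonal by means of \<open>P \<and> N = 0\<close>.  Extend it by Hahn-Banach to the bounded
  continuous functions and represent it by a Radon measure \<open>\<mu>\<close>.  Then \<open>\<mu>\<close> has mass \<open>\<parallel>\<phi>\<parallel>\<close> and represents
  \<open>\<phi>\<close>.  Choose \<open>0 \<le> g\<^sub>k \<le> \<rho>\<close> with \<open>P (\<rho> - g\<^sub>k) + N g\<^sub>k \<le> 2\<^sup>-\<^sup>k\<close>.  Since \<open>f(x) / (\<rho>(x) + \<rho>(y)) \<le> f(x) / d(x, y)\<close>
  for \<open>f \<ge> 0\<close>, almost everywhere \<open>g\<^sub>k(p\<^sub>1) \<rightarrow> \<rho>(p\<^sub>1)\<close> and \<open>g\<^sub>k(p\<^sub>2) \<rightarrow> 0\<close>.  This excludes \<open>p\<^sub>1 = p\<^sub>2 \<noteq> 0\<close> and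
  makes the marginals singular; the points with \<open>p\<^sub>1 = p\<^sub>2 = 0\<close> or some \<open>\<rho>(p\<^sub>i) = \<infinity>\<close> are null because \<open>P\<close>
  and \<open>N\<close> inherit from \<open>\<phi>\<close> that they avoid \<open>0\<close> and infinity.
\<close>

section \<open>The Hahn-Banach theorem for sublinear functionals\<close>

text \<open>The functions \<open>f\<close> and \<open>g\<close> of the rule are kept independent
  because \<open>f = g\<close> would only make the measure represent \<phi>, whereas
  \<open>g = 0\<close> or \<open>f = 0\<close> bounds what it does to one coordinate alone. The
  properties of \<open>\<mu>\<close> are obtained by choosing \<open>c\<close>, \<open>f\<close>,
  \<open>g\<close>: constants give the mass, \<open>f = g\<close> the representation,
  \<open>f = rho\<close> and \<open>g = 0\<close> the finite moment, and a splitting of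
  \<open>rho\<close> between \<open>P\<close> and \<open>N\<close> the singularity. The price is
  that the rule must respect the order although the diagonal is missing from the space of pairs, so
  that nothing compares \<open>f\<close> with \<open>g\<close> at an isolated point. Instead of
  extending a functional from a subspace, one takes any linear functional below the cost of the
  cheapest majorant; positivity and the prescribed values both follow from this domination. The
  quotient \<open>f(x) / d(x, y)\<close> is in general unbounded and hence not itself a test
  function: in the construction it is replaced by bounded continuous minorants, obtained by
  truncation or by enlarging the denominator.\<close>

definition sublinear_on :: "('b \<Rightarrow> real) set \<Rightarrow> (('b \<Rightarrow> real) \<Rightarrow> real) \<Rightarrow> bool"
  where "sublinear_on E q \<longleftrightarrow>
    (\<forall>u\<in>E. \<forall>v\<in>E. q (\<lambda>x. u x + v x) \<le> q u + q v) \<and>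
    (\<forall>u\<in>E. \<forall>c>0. q (\<lambda>x. c * u x) = c * q u)"

definition fun_subspace :: "('b \<Rightarrow> real) set \<Rightarrow> bool"
  where "fun_subspace E \<longleftrightarrow>
    (\<lambda>_. 0) \<in> E \<and> (\<forall>u\<in>E. \<forall>v\<in>E. (\<lambda>x. u x + v x) \<in> E) \<and> (\<forall>u\<in>E. \<forall>c. (\<lambda>x. c * u x) \<in> E)"

lemma fun_subspaceD:
  assumes "fun_subspace E"
  shows "(\<lambda>_. 0) \<in> E" "\<And>u v. u \<in> E \<Longrightarrow> v \<in> E \<Longrightarrow> (\<lambda>x. u x + v x) \<in> E"
    "\<And>u c. u \<in> E \<Longrightarrow> (\<lambda>x. c * u x) \<in> E"
  using assms by (auto simp: fun_subspace_def)

lemma sublinear_onD: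
  assumes "sublinear_on E q"
  shows "\<And>u v. u \<in> E \<Longrightarrow> v \<in> E \<Longrightarrow> q (\<lambda>x. u x + v x) \<le> q u + q v"
    "\<And>u c. u \<in> E \<Longrightarrow> 0 < c \<Longrightarrow> q (\<lambda>x. c * u x) = c * q u"
  using assms by (auto simp: sublinear_on_def)

lemma sublinear_on_zero:
  assumes "fun_subspace E" "sublinear_on E q"
  shows "q (\<lambda>_. 0) = 0"
  using sublinear_onD(2)[OF assms(2) fun_subspaceD(1)[OF assms(1)], of 2] by simp

text \<open>Subadditivity at \<open>u\<close> and \<open>- u\<close>, together with
  \<open>q 0 = 0\<close>. It bounds a chain of functionals from below, so that pointwise infima
  exist.\<close>

lemma sublinear_on_lower:
  assumes "fun_subspace E" "sublinear_on E q" "u \<in> E"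
  shows "- q (\<lambda>x. - 1 * u x) \<le> q u"
  using sublinear_onD(1)[OF assms(2,3) fun_subspaceD(3)[OF assms(1,3), of "-1"]]
    sublinear_on_zero[OF assms(1,2)] by simp

text \<open>Applying the one-sided estimate with the factor \<open>1 / c\<close> at
  \<open>c * u\<close> yields the reverse inequality.\<close>

lemma sublinear_onI_scale_le:
  assumes "fun_subspace E"
    and "\<And>u v. u \<in> E \<Longrightarrow> v \<in> E \<Longrightarrow> q (\<lambda>x. u x + v x) \<le> q u + q v"
    and le: "\<And>u c. u \<in> E \<Longrightarrow> 0 < c \<Longrightarrow> q (\<lambda>x. c * u x) \<le> c * q u"
  shows "sublinear_on E q"
proof -
  have "q (\<lambda>x. c * u x) = c * q u" if u: "u \<in> E" and c: "0 < c" for u c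
  proof (rule antisym[OF le[OF u c]])
    have "q u \<le> inverse c * q (\<lambda>x. c * u x)"
      using le[OF fun_subspaceD(3)[OF assms(1) u, of c], of "inverse c"] c
      by (simp add: mult.assoc[symmetric])
    then show "c * q u \<le> q (\<lambda>x. c * u x)" using c by (simp add: field_simps)
  qed
  then show ?thesis using assms(2) by (auto simp: sublinear_on_def)
qed

text \<open>By minimality, \<open>q\<close> coincides with its infimal modification \<open>s\<close> in the direction \<open>y\<close>.\<close>

lemma minimal_sublinear_additive:
  assumes E: "fun_subspace E" and q: "sublinear_on E q"
    and min: "\<And>s. sublinear_on E s \<Longrightarrow> (\<forall>u\<in>E. s u \<le> q u) \<Longrightarrow> (\<forall>u\<in>E. s u = q u)"
    and u: "u \<in> E" and y: "y \<in> E"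
  shows "q (\<lambda>x. u x + y x) = q u + q y"
proof -
  let ?T = "\<lambda>u. (\<lambda>t. q (\<lambda>x. u x + t * y x) - t * q y) ` {0<..}"
  define s where "s u = Inf (?T u)" for u
  note Es = fun_subspaceD[OF E] and qs = sublinear_onD[OF q]
  \<comment> \<open>Subadditivity for \<open>t * y = (u + t * y) + (- u)\<close> gives a lower bound
    independent of \<open>t\<close>, so the infimum \<open>s u\<close> is finite.\<close>
  have low: "- q (\<lambda>x. - 1 * u x) \<le> q (\<lambda>x. u x + t * y x) - t * q y" if "u \<in> E" "0 < t" for u t
  proof -
    have "q (\<lambda>x. t * y x) = q (\<lambda>x. (u x + t * y x) + (- 1 * u x))" by simp
    also have "\<dots> \<le> q (\<lambda>x. u x + t * y x) + q (\<lambda>x. - 1 * u x)"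
      using that y by (intro qs(1) Es(2,3))
    finally show ?thesis using qs(2)[OF y that(2)] by simp
  qed
  have bdd: "bdd_below (?T u)" if "u \<in> E" for u
    using low[OF that] by (intro bdd_belowI2) auto
  have sle: "s u \<le> q (\<lambda>x. u x + t * y x) - t * q y" if "u \<in> E" "0 < t" for u t
    unfolding s_def using that by (intro cINF_lower bdd) auto
  have sge: "z \<le> s u" if "\<And>t. 0 < t \<Longrightarrow> z \<le> q (\<lambda>x. u x + t * y x) - t * q y" for z u
    unfolding s_def using that by (intro cINF_greatest) auto
  have add: "s (\<lambda>x. u x + v x) \<le> s u + s v" if u: "u \<in> E" and v: "v \<in> E" for u v
  proof -
    have "s (\<lambda>x. u x + v x) - (q (\<lambda>x. v x + r * y x) - r * q y) \<le> s u" if r: "0 < r" for r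
    proof (rule sge)
      fix t :: real assume t: "0 < t"
      have "s (\<lambda>x. u x + v x) \<le> q (\<lambda>x. (u x + v x) + (t + r) * y x) - (t + r) * q y"
        using u v t r by (intro sle Es(2)) auto
      also have "(\<lambda>x. (u x + v x) + (t + r) * y x) = (\<lambda>x. (u x + t * y x) + (v x + r * y x))"
        by (simp add: algebra_simps)
      also have "q \<dots> \<le> q (\<lambda>x. u x + t * y x) + q (\<lambda>x. v x + r * y x)"
        using u v y by (intro qs(1) Es(2,3))
      finally show "s (\<lambda>x. u x + v x) - (q (\<lambda>x. v x + r * y x) - r * q y)
          \<le> q (\<lambda>x. u x + t * y x) - t * q y" by (simp add: algebra_simps)
    qed
    then have "s (\<lambda>x. u x + v x) - s u \<le> s v" by (intro sge) (simp add: algebra_simps)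
    then show ?thesis by simp
  qed
  have scale: "s (\<lambda>x. c * u x) \<le> c * s u" if u: "u \<in> E" and c: "0 < c" for u c
  proof -
    have "s (\<lambda>x. c * u x) / c \<le> s u"
    proof (rule sge)
      fix t :: real assume t: "0 < t"
      have "s (\<lambda>x. c * u x) \<le> q (\<lambda>x. c * u x + (c * t) * y x) - (c * t) * q y"
        using u c t by (intro sle Es(3)) auto
      also have "(\<lambda>x. c * u x + (c * t) * y x) = (\<lambda>x. c * (u x + t * y x))"
        by (simp add: algebra_simps)
      also have "q \<dots> = c * q (\<lambda>x. u x + t * y x)"
        using u c y by (intro qs(2) Es(2,3))
      finally have "s (\<lambda>x. c * u x) \<le> c * (q (\<lambda>x. u x + t * y x) - t * q y)"
        by (simp add: algebra_simps)
      then show "s (\<lambda>x. c * u x) / c \<le> q (\<lambda>x. u x + t * y x) - t * q y"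
        using c by (simp add: divide_le_eq mult.commute)
    qed
    then show ?thesis using c by (simp add: divide_le_eq mult.commute)
  qed
  have sq: "s u \<le> q u" if u: "u \<in> E" for u
  proof -
    have "s u \<le> q u + t * (q y - q y)" if "0 < t" for t
      using sle[OF u that] qs(1)[OF u Es(3)[OF y, of t]] qs(2)[OF y that] by simp
    from this[of 1] show ?thesis by simp
  qed
  have "sublinear_on E s" by (rule sublinear_onI_scale_le[OF E add scale])
  with sq have "\<forall>u\<in>E. s u = q u" by (intro min) auto
  \<comment> \<open>At \<open>t = 1\<close> the equality \<open>s u = q u\<close> is the missing
    superadditive half \<open>q u + q y \<le> q (u + y)\<close>.\<close>
  then have "q u \<le> q (\<lambda>x. u x + 1 * y x) - 1 * q y" using sle[OF u, of 1] u by simp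
  with qs(1)[OF u y] show ?thesis by simp
qed

text \<open>Zorn's lemma gives a minimal sublinear functional below \<open>p\<close>, and minimality
  makes it additive in every direction. Prescribed values are encoded in \<open>p\<close>: if
  \<open>p u \<le> a\<close> and \<open>p (- u) \<le> - a\<close>, then
  \<open>L u = a\<close>.\<close>

theorem Hahn_Banach_sublinear:
  assumes E: "fun_subspace E" and p: "sublinear_on E p"
  shows "\<exists>L. (\<forall>u\<in>E. L u \<le> p u) \<and>
    (\<forall>u\<in>E. \<forall>v\<in>E. L (\<lambda>x. u x + v x) = L u + L v) \<and>
    (\<forall>u\<in>E. \<forall>c. L (\<lambda>x. c * u x) = c * L u)"
proof -
  \<comment> \<open>The value 0 off \<open>E\<close> is a normalisation: functionals that are
    comparable on \<open>E\<close> are then comparable at every argument.\<close>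
  define A where "A = {q. (\<forall>u. u \<notin> E \<longrightarrow> q u = 0) \<and> (\<forall>u\<in>E. q u \<le> p u) \<and> sublinear_on E q}"
  \<comment> \<open>\<open>?P q r\<close> says \<open>r \<le> q\<close>, so the maximal element
    produced by Zorn's lemma is a minimal functional.\<close>
  let ?P = "\<lambda>q r. \<forall>u. r u \<le> (q u :: real)"
  let ?res = "\<lambda>q u. if u \<in> E then q u else (0::real)"
  note Es = fun_subspaceD[OF E]
  have res: "sublinear_on E (?res q)" if "sublinear_on E q" for q
    using that Es by (auto simp: sublinear_on_def)
  have "\<exists>m\<in>A. \<forall>a\<in>A. ?P m a \<longrightarrow> a = m"
  proof (rule predicate_Zorn)
    show "partial_order_on A (relation_of ?P A)"
      by (rule partial_order_on_relation_ofI) (auto simp: fun_eq_iff intro: order_trans order_antisym)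
    fix C assume C: "C \<in> Chains (relation_of ?P A)"
    have CA: "C \<subseteq> A" and total: "\<And>q r. q \<in> C \<Longrightarrow> r \<in> C \<Longrightarrow> ?P q r \<or> ?P r q"
      using C by (auto simp: Chains_def relation_of_def)
    show "\<exists>r\<in>A. \<forall>q\<in>C. ?P q r"
    proof (cases "C = {}")
      case True
      have "?res p \<in> A" using res[OF p] by (auto simp: A_def)
      then show ?thesis using True by blast
    next
      case False
      define r where "r = (\<lambda>u. Inf ((\<lambda>q. q u) ` C))"
      have bdd: "bdd_below ((\<lambda>q. q u) ` C)" if "u \<in> E" for u
      proof (rule bdd_belowI2)
        fix q assume "q \<in> C"
        then have q: "sublinear_on E q" "\<forall>u\<in>E. q u \<le> p u" using CA by (auto simp: A_def)
        have "- p (\<lambda>x. - 1 * u x) \<le> - q (\<lambda>x. - 1 * u x)"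
          using q(2) Es(3)[OF that, of "-1"] by auto
        also have "\<dots> \<le> q u" by (rule sublinear_on_lower[OF E q(1) that])
        finally show "- p (\<lambda>x. - 1 * u x) \<le> q u" .
      qed
      have rle: "r u \<le> q u" if "u \<in> E" "q \<in> C" for u q
        unfolding r_def using that by (intro cINF_lower bdd)
      have rge: "z \<le> r u" if "\<And>q. q \<in> C \<Longrightarrow> z \<le> q u" for z u
        unfolding r_def using that False by (intro cINF_greatest)
      have add: "r (\<lambda>x. u x + v x) \<le> r u + r v" if u: "u \<in> E" and v: "v \<in> E" for u v
      proof -
        have "r (\<lambda>x. u x + v x) - r' v \<le> r u" if r': "r' \<in> C" for r'
        proof (rule rge)
          fix q assume q: "q \<in> C"
          \<comment> \<open>The smaller of two members of a chain is small at \<open>u\<close> and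
            at \<open>v\<close> simultaneously; this is what makes the infimum subadditive.\<close>
          obtain m where m: "m \<in> C" "m u \<le> q u" "m v \<le> r' v"
            using total[OF q r'] q r' by blast
          have "r (\<lambda>x. u x + v x) \<le> m (\<lambda>x. u x + v x)" using u v m Es by (intro rle) auto
          also have "\<dots> \<le> m u + m v"
            using m CA u v by (intro sublinear_onD(1)[of E]) (auto simp: A_def)
          finally show "r (\<lambda>x. u x + v x) - r' v \<le> q u" using m by simp
        qed
        then have "r (\<lambda>x. u x + v x) - r u \<le> r v" by (intro rge) (simp add: algebra_simps)
        then show ?thesis by simp
      qed
      have scale: "r (\<lambda>x. c * u x) \<le> c * r u" if u: "u \<in> E" and c: "0 < c" for u c
      proof -
        have "r (\<lambda>x. c * u x) / c \<le> r u"
        proof (rule rge)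
          fix q assume q: "q \<in> C"
          have "q (\<lambda>x. c * u x) = c * q u"
            using q CA u c by (intro sublinear_onD(2)[of E]) (auto simp: A_def)
          then show "r (\<lambda>x. c * u x) / c \<le> q u"
            using rle[OF Es(3)[OF u, of c] q] c by (simp add: divide_le_eq mult.commute)
        qed
        then show ?thesis using c by (simp add: divide_le_eq mult.commute)
      qed
      have "r u \<le> p u" if "u \<in> E" for u
      proof -
        obtain q where "q \<in> C" using False by blast
        then show ?thesis using rle[OF that, of q] CA that by (force simp: A_def)
      qed
      moreover have "sublinear_on E (?res r)"
        by (intro res sublinear_onI_scale_le[OF E add scale])
      ultimately have resA: "?res r \<in> A" unfolding A_def by simp
      have le: "\<forall>q\<in>C. ?P q (?res r)" using rle CA by (auto simp: A_def)
      show ?thesis by (rule bexI[where x = "?res r"]) fact+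
    qed
  qed
  then obtain q where qA: "q \<in> A" and qmin: "\<And>a. a \<in> A \<Longrightarrow> ?P q a \<Longrightarrow> a = q" by blast
  have q: "sublinear_on E q" and q0: "\<And>u. u \<notin> E \<Longrightarrow> q u = 0" and qp: "\<And>u. u \<in> E \<Longrightarrow> q u \<le> p u"
    using qA by (auto simp: A_def)
  have min: "\<forall>u\<in>E. s u = q u" if s: "sublinear_on E s" and sq: "\<forall>u\<in>E. s u \<le> q u" for s
  proof -
    have "?res s \<in> A" using res[OF s] sq qp by (force simp: A_def intro: order_trans)
    then have "?res s = q" using sq q0 by (intro qmin) auto
    then show ?thesis by (metis (mono_tags))
  qed
  have add: "q (\<lambda>x. u x + v x) = q u + q v" if "u \<in> E" "v \<in> E" for u v
    using minimal_sublinear_additive[OF E q] min that by blast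
  have zero: "q (\<lambda>_. 0) = 0" by (rule sublinear_on_zero[OF E q])
  have neg: "q (\<lambda>x. - 1 * u x) = - q u" if "u \<in> E" for u
    using add[OF that Es(3)[OF that, of "-1"]] zero by simp
  have "q (\<lambda>x. c * u x) = c * q u" if u: "u \<in> E" for u c
  proof (cases c "0::real" rule: linorder_cases)
    case less
    have "q (\<lambda>x. c * u x) = q (\<lambda>x. - 1 * (- c * u x))" by simp
    also have "\<dots> = - q (\<lambda>x. - c * u x)" by (rule neg[OF Es(3)[OF u]])
    also have "\<dots> = c * q u" using sublinear_onD(2)[OF q u, of "- c"] less by simp
    finally show ?thesis .
  qed (use zero sublinear_onD(2)[OF q u] in auto)
  then show ?thesis using qp add by (intro exI[of _ q] conjI ballI allI)
qed

section \<open>The Riesz representation theorem on compact Hausdorff spaces\<close>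

lemma space_borel_of_top [simp]: "space (borel_of_top X) = topspace X"
  unfolding borel_of_top_def by (rule space_measure_of) (auto dest: openin_subset)

lemma sets_borel_of_top: "sets (borel_of_top X) = sigma_sets (topspace X) {U. openin X U}"
  unfolding borel_of_top_def by (rule sets_measure_of) (auto dest: openin_subset)

lemma borel_of_top_open: "openin X U \<Longrightarrow> U \<in> sets (borel_of_top X)"
  by (auto simp: sets_borel_of_top)

lemma continuous_map_measurable:
  assumes "continuous_map X euclidean (f :: 'p \<Rightarrow> 'q::topological_space)"
    and "sets M = sets (borel_of_top X)"
  shows "f \<in> borel_measurable M"
proof (rule borel_measurableI)
  fix S :: "'q set" assume "open S"
  then have "openin X {x \<in> topspace X. f x \<in> S}"
    using assms(1) by (auto simp: continuous_map_def)
  moreover have "f -` S \<inter> space M = {x \<in> topspace X. f x \<in> S}"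
    using sets_eq_imp_space_eq[OF assms(2)] by auto
  ultimately show "f -` S \<inter> space M \<in> sets M" using assms(2) by (simp add: borel_of_top_open)
qed

section \<open>Positive linear functionals on the continuous functions\<close>

locale positive_linear_on_compact =
  fixes X :: "'p topology" and L :: "('p \<Rightarrow> real) \<Rightarrow> real"
  assumes compact: "compact_space X" and Hausdorff: "Hausdorff_space X"
    and L_add: "\<And>f g. continuous_map X euclideanreal f \<Longrightarrow> continuous_map X euclideanreal g \<Longrightarrow>
      L (\<lambda>x. f x + g x) = L f + L g"
    and L_scale: "\<And>f c. continuous_map X euclideanreal f \<Longrightarrow> L (\<lambda>x. c * f x) = c * L f"
    and L_nonneg: "\<And>f. continuous_map X euclideanreal f \<Longrightarrow> (\<And>x. x \<in> topspace X \<Longrightarrow> 0 \<le> f x) \<Longrightarrow> 0 \<le> L f"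
begin

abbreviation cont :: "('p \<Rightarrow> real) \<Rightarrow> bool"
  where "cont f \<equiv> continuous_map X euclideanreal f"

lemma L_mono:
  assumes "cont f" "cont g" "\<And>x. x \<in> topspace X \<Longrightarrow> f x \<le> g x"
  shows "L f \<le> L g"
proof -
  have "0 \<le> L (\<lambda>x. g x + (- 1) * f x)"
    using assms by (intro L_nonneg continuous_intros) auto
  also have "\<dots> = L g + L (\<lambda>x. (- 1) * f x)"
    using assms by (intro L_add continuous_intros) auto
  also have "\<dots> = L g - L f" using L_scale[OF assms(1), of "- 1"] by simp
  finally show ?thesis by simp
qed

text \<open>Continuity on \<open>X\<close> says nothing about values off \<open>topspace X\<close>;
  by monotonicity in both directions \<open>L\<close> does not see them.\<close>

lemma L_cong:
  assumes "cont f" "cont g" "\<And>x. x \<in> topspace X \<Longrightarrow> f x = g x"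
  shows "L f = L g"
  using assms by (intro antisym L_mono) auto

lemma L_diff: "cont f \<Longrightarrow> cont g \<Longrightarrow> L (\<lambda>x. f x - g x) = L f - L g"
  using L_add[of f "\<lambda>x. (- 1) * g x"] L_scale[of g "- 1"]
  by (simp add: continuous_map_real_mult_left)

lemma L_const: "L (\<lambda>_. c) = c * L (\<lambda>_. 1)"
  using L_scale[of "\<lambda>_. 1" c] by simp

lemma L_one_nonneg: "0 \<le> L (\<lambda>_. 1)"
  by (rule L_nonneg) auto

lemma L_zero: "L (\<lambda>_. 0) = 0"
  using L_const[of 0] by simp

lemma L_sum:
  assumes "finite I" "\<And>i. i \<in> I \<Longrightarrow> cont (f i)"
  shows "L (\<lambda>x. \<Sum>i\<in>I. f i x) = (\<Sum>i\<in>I. L (f i))"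
  using assms
proof (induction I)
  case (insert i I)
  then have "L (\<lambda>x. f i x + (\<Sum>i\<in>I. f i x)) = L (f i) + L (\<lambda>x. \<Sum>i\<in>I. f i x)"
    by (intro L_add continuous_map_sum) auto
  with insert show ?case by simp
qed (simp add: L_zero)

section \<open>Mass of open sets and outer mass\<close>

definition below :: "'p set \<Rightarrow> ('p \<Rightarrow> real) set"
  where "below U = {f. cont f \<and> (\<forall>x\<in>topspace X. 0 \<le> f x \<and> f x \<le> indicator U x)}"

text \<open>Members of \<open>below U\<close> vanish off \<open>U\<close>, but their support may
  reach the boundary of \<open>U\<close>; trimming by a small constant recovers a closed set inside
  \<open>U\<close> at a small loss in \<open>L\<close>.\<close>

definition open_mass :: "'p set \<Rightarrow> ennreal"
  where "open_mass U = (SUP f\<in>below U. ennreal (L f))"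

definition outer_mass :: "'p set \<Rightarrow> ennreal"
  where "outer_mass A = (INF U\<in>{U. openin X U \<and> A \<subseteq> U}. open_mass U)"

lemma belowD:
  assumes "f \<in> below U"
  shows "cont f" "\<And>x. x \<in> topspace X \<Longrightarrow> 0 \<le> f x" "\<And>x. x \<in> topspace X \<Longrightarrow> f x \<le> 1"
    "\<And>x. x \<in> topspace X \<Longrightarrow> x \<notin> U \<Longrightarrow> f x = 0"
  using assms by (auto simp: below_def split: split_indicator_asm)

lemma belowI:
  assumes "cont f" "\<And>x. x \<in> topspace X \<Longrightarrow> 0 \<le> f x" "\<And>x. x \<in> topspace X \<Longrightarrow> f x \<le> 1"
    "\<And>x. x \<in> topspace X \<Longrightarrow> x \<notin> U \<Longrightarrow> f x = 0"
  shows "f \<in> below U"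
  using assms by (auto simp: below_def indicator_def)

lemma open_mass_upper: "f \<in> below U \<Longrightarrow> ennreal (L f) \<le> open_mass U"
  unfolding open_mass_def by (rule SUP_upper)

lemma below_mono: "U \<subseteq> V \<Longrightarrow> below U \<subseteq> below V"
  by (auto intro!: belowI dest: belowD)

lemma open_mass_mono: "U \<subseteq> V \<Longrightarrow> open_mass U \<le> open_mass V"
  unfolding open_mass_def by (intro SUP_subset_mono below_mono) auto

lemma open_mass_space: "open_mass (topspace X) = ennreal (L (\<lambda>_. 1))"
proof (rule antisym)
  show "open_mass (topspace X) \<le> ennreal (L (\<lambda>_. 1))"
    unfolding open_mass_def by (intro SUP_least ennreal_leI L_mono) (auto dest: belowD)
  show "ennreal (L (\<lambda>_. 1)) \<le> open_mass (topspace X)"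
    by (rule open_mass_upper) (auto intro: belowI)
qed

text \<open>Lowering by \<open>e\<close> makes the support compact in \<open>U\<close>, at a cost of \<open>e * L 1\<close>.\<close>

lemma below_trim:
  assumes f: "f \<in> below U" and e: "0 < e"
  defines "g \<equiv> \<lambda>x. max 0 (f x - e)" and "C \<equiv> {x \<in> topspace X. e \<le> f x}"
  shows "g \<in> below C" "closedin X C" "C \<subseteq> U" "L f \<le> L g + e * L (\<lambda>_. 1)"
proof -
  have g: "cont g" unfolding g_def
    by (intro continuous_map_real_max continuous_intros) (auto intro: belowD[OF f])
  show "g \<in> below C"
  proof (rule belowI[OF g])
    fix x assume x: "x \<in> topspace X"
    show "0 \<le> g x" "g x \<le> 1" "x \<notin> C \<Longrightarrow> g x = 0"
      using belowD(2,3)[OF f x] e x by (auto simp: g_def C_def)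
  qed
  show "closedin X C"
  proof -
    have "closedin X {x \<in> topspace X. f x \<in> {e..}}"
      using belowD(1)[OF f] by (rule closedin_continuous_map_preimage) simp
    then show ?thesis by (simp add: C_def)
  qed
  show "C \<subseteq> U" using belowD(4)[OF f] e by (force simp: C_def)
  have "L f \<le> L (\<lambda>x. g x + e)"
    using belowD(1)[OF f] g by (intro L_mono continuous_intros) (auto simp: g_def)
  also have "\<dots> = L g + e * L (\<lambda>_. 1)"
    using L_add[OF g, of "\<lambda>_. e"] L_const[of e] by simp
  finally show "L f \<le> L g + e * L (\<lambda>_. 1)" .
qed

text \<open>Only trimmed functions have to be tested, because trimming by \<open>d\<close> costs at
  most \<open>d * L 1\<close>, which can be made smaller than any given \<open>e\<close>.\<close>

lemma open_mass_leI:
  assumes "\<And>f e. f \<in> below U \<Longrightarrow> 0 < e \<Longrightarrow> ennreal (L (\<lambda>x. max 0 (f x - e))) \<le> z"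
  shows "open_mass U \<le> z"
  unfolding open_mass_def
proof (rule SUP_least)
  fix f assume f: "f \<in> below U"
  show "ennreal (L f) \<le> z"
  proof (rule ennreal_le_epsilon)
    fix e :: real assume e: "0 < e"
    \<comment> \<open>The summand 1 keeps the denominator positive when
      \<open>L 1 = 0\<close>.\<close>
    define d where "d = e / (L (\<lambda>_. 1) + 1)"
    have d: "0 < d" "d * L (\<lambda>_. 1) \<le> e"
      using e L_one_nonneg by (auto simp: d_def divide_simps)
    let ?g = "\<lambda>x. max 0 (f x - d)"
    have "0 \<le> L ?g"
      by (rule L_nonneg) (use belowD[OF below_trim(1)[OF f d(1)]] in auto)
    have "ennreal (L f) \<le> ennreal (L ?g + e)"
      using below_trim(4)[OF f d(1)] d by (intro ennreal_leI) auto
    also have "\<dots> = ennreal (L ?g) + ennreal e"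
      using e \<open>0 \<le> L ?g\<close> by simp
    also have "\<dots> \<le> z + ennreal e" by (intro add_right_mono assms f d)
    finally show "ennreal (L f) \<le> z + ennreal e" .
  qed
qed

lemma Urysohn_function:
  assumes "closedin X S" "closedin X T" "S \<inter> T = {}"
  obtains h where "cont h" "\<And>x. x \<in> topspace X \<Longrightarrow> 0 \<le> h x \<and> h x \<le> 1"
    "\<And>x. x \<in> S \<Longrightarrow> h x = 0" "\<And>x. x \<in> T \<Longrightarrow> h x = 1"
proof -
  have "normal_space X"
    using compact Hausdorff by (simp add: compact_Hausdorff_or_regular_imp_normal_space)
  then obtain h where "continuous_map X (top_of_set {0..1::real}) h" "h ` S \<subseteq> {0}" "h ` T \<subseteq> {1}"
    using Urysohn_lemma[of X S T 0 1] assms by (auto simp: disjnt_def)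
  then show thesis
    by (intro that[of h]) (auto simp: continuous_map_in_subtopology image_subset_iff)
qed

text \<open>The closed sets \<open>C - U\<close> and \<open>C - V\<close> are disjoint, so a Urysohn
  function \<open>h\<close> separates them, and \<open>g = g * h + g * (1 - h)\<close> distributes a
  trimmed function over \<open>U\<close> and \<open>V\<close>.\<close>

lemma open_mass_Un:
  assumes U: "openin X U" and V: "openin X V"
  shows "open_mass (U \<union> V) \<le> open_mass U + open_mass V"
proof (rule open_mass_leI)
  fix f and e :: real assume f: "f \<in> below (U \<union> V)" and e: "0 < e"
  let ?g = "\<lambda>x. max 0 (f x - e)"
  define C where "C = {x \<in> topspace X. e \<le> f x}"
  note t = below_trim[OF f e, folded C_def]
  note g = belowD[OF t(1)]
  have "closedin X (C - U)" "closedin X (C - V)" using t(2) U V by (auto intro: closedin_diff)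
  moreover have "(C - U) \<inter> (C - V) = {}" using t(3) by auto
  ultimately obtain h where h: "cont h" "\<And>x. x \<in> topspace X \<Longrightarrow> 0 \<le> h x \<and> h x \<le> 1"
    "\<And>x. x \<in> C - U \<Longrightarrow> h x = 0" "\<And>x. x \<in> C - V \<Longrightarrow> h x = 1"
    by (rule Urysohn_function) blast
  have "(\<lambda>x. ?g x * h x) \<in> below U"
  proof (rule belowI)
    show "cont (\<lambda>x. ?g x * h x)" using g h by (intro continuous_map_real_mult) auto
    fix x assume x: "x \<in> topspace X"
    show "0 \<le> ?g x * h x" "?g x * h x \<le> 1"
      using g(2,3)[OF x] h(2)[OF x] by (auto intro: mult_nonneg_nonneg mult_le_one)
    show "?g x * h x = 0" if "x \<notin> U" using g(4)[OF x] h(3)[of x] that by auto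
  qed
  moreover have "(\<lambda>x. ?g x * (1 - h x)) \<in> below V"
  proof (rule belowI)
    show "cont (\<lambda>x. ?g x * (1 - h x))"
      by (intro continuous_map_real_mult[OF g(1)] continuous_map_diff h(1)) auto
    fix x assume x: "x \<in> topspace X"
    show "0 \<le> ?g x * (1 - h x)" "?g x * (1 - h x) \<le> 1"
      using g(2,3)[OF x] h(2)[OF x] by (auto intro: mult_nonneg_nonneg mult_le_one)
    show "?g x * (1 - h x) = 0" if "x \<notin> V" using g(4)[OF x] h(4)[of x] that by auto
  qed
  moreover have "L ?g = L (\<lambda>x. ?g x * h x) + L (\<lambda>x. ?g x * (1 - h x))"
    using calculation by (subst L_add[symmetric]) (auto dest: belowD simp: algebra_simps)
  moreover have "0 \<le> L (\<lambda>x. ?g x * h x)" "0 \<le> L (\<lambda>x. ?g x * (1 - h x))"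
    using calculation(1,2) by (auto intro!: L_nonneg dest: belowD)
  ultimately show "ennreal (L ?g) \<le> open_mass U + open_mass V"
    by (auto intro!: add_mono open_mass_upper)
qed

lemma open_mass_UN_lessThan:
  assumes "\<And>i::nat. openin X (U i)"
  shows "open_mass (\<Union>i<n. U i) \<le> (\<Sum>i<n. open_mass (U i))"
proof (induction n)
  case 0
  have "L f = 0" if "f \<in> below {}" for f
    using belowD[OF that] L_cong[of f "\<lambda>_. 0"] L_zero by auto
  then have "open_mass {} \<le> 0" unfolding open_mass_def by (intro SUP_least) simp
  then show ?case by simp
next
  case (Suc n)
  have "open_mass (\<Union>i<Suc n. U i) \<le> open_mass (\<Union>i<n. U i) + open_mass (U n)"
    using open_mass_Un[of "\<Union>i<n. U i" "U n"] assms
    by (auto simp: lessThan_Suc Un_commute intro!: openin_clauses)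
  also have "\<dots> \<le> (\<Sum>i<Suc n. open_mass (U i))" using Suc by (simp add: add_right_mono)
  finally show ?case .
qed

text \<open>Compactness of the closed set that carries a trimmed function reduces the countable
  cover to a finite one.\<close>

lemma open_mass_UN:
  assumes U: "\<And>i::nat. openin X (U i)"
  shows "open_mass (\<Union>i. U i) \<le> (\<Sum>i. open_mass (U i))"
proof (rule open_mass_leI)
  fix f and e :: real assume f: "f \<in> below (\<Union>i. U i)" and e: "0 < e"
  let ?g = "\<lambda>x. max 0 (f x - e)"
  define C where "C = {x \<in> topspace X. e \<le> f x}"
  note t = below_trim[OF f e, folded C_def]
  have "compactin X C" using closedin_compact_space[OF compact t(2)] .
  then obtain F where F: "finite F" "F \<subseteq> range U" "C \<subseteq> \<Union>F"
    using t(3) U compactinD[of X C "range U"] by blast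
  obtain I where I: "finite I" "F = U ` I" using F finite_subset_image by metis
  then obtain n where "I \<subseteq> {..<n}" using finite_nat_iff_bounded by auto
  then have "C \<subseteq> (\<Union>i<n. U i)" using F(3) I by blast
  then have "?g \<in> below (\<Union>i<n. U i)" using below_mono t(1) by blast
  then have "ennreal (L ?g) \<le> open_mass (\<Union>i<n. U i)" by (rule open_mass_upper)
  also have "\<dots> \<le> (\<Sum>i<n. open_mass (U i))" by (rule open_mass_UN_lessThan[OF U])
  also have "\<dots> \<le> (\<Sum>i. open_mass (U i))" by (intro sum_le_suminf) auto
  finally show "ennreal (L ?g) \<le> (\<Sum>i. open_mass (U i))" .
qed

lemma outer_mass_open: "openin X U \<Longrightarrow> outer_mass U = open_mass U"
  unfolding outer_mass_def by (intro antisym INF_lower INF_greatest) (auto intro: open_mass_mono)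

lemma outer_mass_mono: "A \<subseteq> B \<Longrightarrow> outer_mass A \<le> outer_mass B"
  unfolding outer_mass_def by (intro INF_superset_mono) auto

lemma outer_mass_approx:
  assumes "A \<subseteq> topspace X" "0 < e"
  obtains U where "openin X U" "A \<subseteq> U" "open_mass U \<le> outer_mass A + ennreal e"
proof -
  have "outer_mass A \<le> open_mass (topspace X)"
    unfolding outer_mass_def using assms by (intro INF_lower) auto
  then have fin: "outer_mass A < \<infinity>" by (simp add: open_mass_space order_le_less_trans)
  have "outer_mass A < outer_mass A + ennreal e"
    using fin assms(2) by (cases "outer_mass A") (auto simp: ennreal_plus[symmetric] ennreal_less_iff simp del: ennreal_plus)
  then obtain U where "openin X U" "A \<subseteq> U" "open_mass U < outer_mass A + ennreal e"
    unfolding outer_mass_def INF_less_iff by auto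
  then show thesis by (intro that) auto
qed

section \<open>Caratheodory measurability of open sets\<close>

lemma outer_measure_space_outer_mass: "outer_measure_space (Pow (topspace X)) outer_mass"
  unfolding outer_measure_space_def
proof (intro conjI)
  have "outer_mass {} = 0"
    using outer_mass_open[of "{}"] open_mass_UN_lessThan[of "\<lambda>_. {}" 0] by simp
  then show "positive (Pow (topspace X)) outer_mass" by (simp add: positive_def)
  show "increasing (Pow (topspace X)) outer_mass" by (auto simp: increasing_def outer_mass_mono)
  show "countably_subadditive (Pow (topspace X)) outer_mass"
    unfolding countably_subadditive_def
  proof (intro allI impI)
    fix A :: "nat \<Rightarrow> 'p set" assume A: "range A \<subseteq> Pow (topspace X)"
    show "outer_mass (\<Union>i. A i) \<le> (\<Sum>i. outer_mass (A i))"
    proof (rule ennreal_le_epsilon)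
      fix e :: real assume e: "0 < e"
      have "\<exists>U. openin X U \<and> A i \<subseteq> U \<and> open_mass U \<le> outer_mass (A i) + ennreal (e * (1/2)^Suc i)" for i
      proof -
        have "A i \<subseteq> topspace X" "0 < e * (1/2)^Suc i" using A e by auto
        from outer_mass_approx[OF this] show ?thesis by blast
      qed
      then obtain U where U: "\<And>i. openin X (U i)" "\<And>i. A i \<subseteq> U i"
        "\<And>i. open_mass (U i) \<le> outer_mass (A i) + ennreal (e * (1/2)^Suc i)"
        by metis
      have "outer_mass (\<Union>i. A i) \<le> outer_mass (\<Union>i. U i)"
        using U(2) by (intro outer_mass_mono) auto
      also have "\<dots> = open_mass (\<Union>i. U i)" using U(1) by (intro outer_mass_open) auto
      also have "\<dots> \<le> (\<Sum>i. open_mass (U i))" by (rule open_mass_UN[OF U(1)])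
      also have "\<dots> \<le> (\<Sum>i. outer_mass (A i) + ennreal (e * (1/2)^Suc i))"
        using U(3) by (intro suminf_le) auto
      also have "\<dots> = (\<Sum>i. outer_mass (A i)) + (\<Sum>i. ennreal (e * (1/2)^Suc i))"
        by (intro suminf_add[symmetric]) auto
      also have "(\<Sum>i. ennreal (e * (1/2)^Suc i)) = ennreal e"
        using e sums_mult[OF power_half_series, of e]
        by (intro suminf_ennreal_eq) auto
      finally show "outer_mass (\<Union>i. A i) \<le> (\<Sum>i. outer_mass (A i)) + ennreal e" .
    qed
  qed
qed

text \<open>A trimmed function \<open>g\<close> below \<open>V \<inter> U\<close> lives on a closed
  \<open>C \<subseteq> V \<inter> U\<close>, so \<open>V - C\<close> is open and contains
  \<open>V - U\<close>. Any \<open>k\<close> below \<open>V - C\<close> vanishes on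
  \<open>C\<close>; hence \<open>g + k\<close> is still below \<open>V\<close>, and the masses add
  up.\<close>

lemma open_mass_split:
  assumes U: "openin X U" and V: "openin X V"
  shows "open_mass (V \<inter> U) + outer_mass (V - U) \<le> open_mass V"
proof (cases "open_mass V = \<infinity>")
  case False
  have "open_mass (V \<inter> U) \<le> open_mass V - outer_mass (V - U)"
  proof (rule open_mass_leI)
    fix f and e :: real assume f: "f \<in> below (V \<inter> U)" and e: "0 < e"
    let ?g = "\<lambda>x. max 0 (f x - e)"
    define C where "C = {x \<in> topspace X. e \<le> f x}"
    note t = below_trim[OF f e, folded C_def]
    note g = belowD[OF t(1)]
    have g0: "0 \<le> L ?g" using g by (intro L_nonneg) auto
    have VC: "openin X (V - C)" using V t(2) by (rule openin_diff)
    have "open_mass (V - C) \<le> open_mass V - ennreal (L ?g)"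
      unfolding open_mass_def[of "V - C"]
    proof (rule SUP_least)
      fix k assume k: "k \<in> below (V - C)"
      note kD = belowD[OF k]
      have k0: "0 \<le> L k" using kD by (intro L_nonneg) auto
      have "(\<lambda>x. ?g x + k x) \<in> below V"
      proof (rule belowI)
        show "cont (\<lambda>x. ?g x + k x)" using g(1) kD(1) by (rule continuous_map_add)
        fix x assume x: "x \<in> topspace X"
        show "0 \<le> ?g x + k x" using g(2) kD(2) x by simp
        show "?g x + k x \<le> 1"
        proof (cases "x \<in> C")
          case True
          then show ?thesis using kD(4)[OF x] g(3)[OF x] by auto
        next
          case False
          then show ?thesis using g(4)[OF x] kD(3)[OF x] by auto
        qed
        show "?g x + k x = 0" if "x \<notin> V" using g(4)[OF x] kD(4)[OF x] that t(3) by auto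
      qed
      then have "ennreal (L (\<lambda>x. ?g x + k x)) \<le> open_mass V" by (rule open_mass_upper)
      then have "ennreal (L k) + ennreal (L ?g) \<le> open_mass V"
        using L_add[OF g(1) kD(1)] g0 k0 by (simp add: add.commute)
      then show "ennreal (L k) \<le> open_mass V - ennreal (L ?g)"
        by (metis ennreal_minus_mono ennreal_add_diff_cancel_right ennreal_neq_top order_refl)
    qed
    moreover have "outer_mass (V - U) \<le> open_mass (V - C)"
      using outer_mass_mono[of "V - U" "V - C"] outer_mass_open[OF VC] t(3) by auto
    ultimately have "outer_mass (V - U) \<le> open_mass V - ennreal (L ?g)" by (rule order_trans[rotated])
    moreover have "ennreal (L ?g) \<le> open_mass V"
      using t(1,3) below_mono[of C V] by (auto intro: open_mass_upper)
    ultimately have "outer_mass (V - U) + ennreal (L ?g) \<le> open_mass V"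
      by (metis add_right_mono diff_add_cancel_ennreal)
    moreover have "outer_mass (V - U) \<noteq> \<infinity>"
      using False outer_mass_mono[of "V - U" V] outer_mass_open[OF V]
      by (metis Diff_subset infinity_ennreal_def neq_top_trans)
    ultimately show "ennreal (L ?g) \<le> open_mass V - outer_mass (V - U)"
      by (metis add.commute ennreal_minus_mono ennreal_add_diff_cancel_right infinity_ennreal_def order_refl)
  qed
  moreover have "outer_mass (V - U) \<le> open_mass V"
    using outer_mass_mono[of "V - U" V] outer_mass_open[OF V] by auto
  ultimately show ?thesis
    by (metis add_right_mono diff_add_cancel_ennreal)
qed simp

text \<open>The splitting inequality passes from open sets \<open>V\<close> to arbitrary
  \<open>A\<close> because the outer mass of \<open>A\<close> is an infimum over open
  supersets.\<close>

lemma open_in_lambda_system: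
  assumes U: "openin X U"
  shows "U \<in> lambda_system (topspace X) (Pow (topspace X)) outer_mass"
proof -
  interpret sigma_algebra "topspace X" "Pow (topspace X)" by (rule sigma_algebra_Pow)
  have oms: "outer_measure_space (Pow (topspace X)) outer_mass"
    by (rule outer_measure_space_outer_mass)
  have "outer_mass (A \<inter> U) + outer_mass (A - U) = outer_mass A" if A: "A \<subseteq> topspace X" for A
  proof (rule antisym)
    show "outer_mass (A \<inter> U) + outer_mass (A - U) \<le> outer_mass A"
      unfolding outer_mass_def[of A]
    proof (rule INF_greatest, clarify)
      fix V assume V: "openin X V" "A \<subseteq> V"
      have "outer_mass (A \<inter> U) + outer_mass (A - U) \<le> outer_mass (V \<inter> U) + outer_mass (V - U)"
        using V by (intro add_mono outer_mass_mono) auto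
      also have "\<dots> \<le> open_mass V"
        using open_mass_split[OF U V(1)] V U by (simp add: outer_mass_open openin_Int)
      finally show "outer_mass (A \<inter> U) + outer_mass (A - U) \<le> open_mass V" .
    qed
    have "subadditive (Pow (topspace X)) outer_mass"
      using oms by (intro countably_subadditive_subadditive) (auto simp: outer_measure_space_def)
    then show "outer_mass A \<le> outer_mass (A \<inter> U) + outer_mass (A - U)"
      using A subadditiveD[of "Pow (topspace X)" outer_mass "A \<inter> U" "A - U"]
      by (auto simp: Int_Diff_Un)
  qed
  then show ?thesis using openin_subset[OF U] by (auto simp: lambda_system_eq)
qed

section \<open>The Riesz measure and its regularity\<close>

definition riesz_measure :: "'p measure"
  where "riesz_measure = measure_of (topspace X) {U. openin X U} outer_mass"

lemma riesz_measure_sets [simp]: "sets riesz_measure = sets (borel_of_top X)"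
  unfolding riesz_measure_def sets_borel_of_top by (rule sets_measure_of) (auto dest: openin_subset)

lemma riesz_measure_space [simp]: "space riesz_measure = topspace X"
  unfolding riesz_measure_def by (rule space_measure_of) (auto dest: openin_subset)

lemma emeasure_riesz_measure:
  assumes "A \<in> sets (borel_of_top X)"
  shows "emeasure riesz_measure A = outer_mass A"
proof -
  interpret sigma_algebra "topspace X" "Pow (topspace X)" by (rule sigma_algebra_Pow)
  let ?\<Lambda> = "lambda_system (topspace X) (Pow (topspace X)) outer_mass"
  have ms: "measure_space (topspace X) ?\<Lambda> outer_mass"
    by (rule caratheodory_lemma[OF outer_measure_space_outer_mass])
  interpret \<Lambda>: sigma_algebra "topspace X" ?\<Lambda> using ms by (simp add: measure_space_def)
  have sub: "sigma_sets (topspace X) {U. openin X U} \<subseteq> ?\<Lambda>"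
    by (rule \<Lambda>.sigma_sets_subset) (auto intro: open_in_lambda_system)
  have pos: "positive ?\<Lambda> outer_mass" and ca: "countably_additive ?\<Lambda> outer_mass"
    using ms by (auto simp: measure_space_def)
  have sets: "sets riesz_measure = sigma_sets (topspace X) {U. openin X U}"
    by (simp add: sets_borel_of_top)
  show ?thesis
  proof (rule emeasure_measure_of[OF riesz_measure_def])
    show "{U. openin X U} \<subseteq> Pow (topspace X)" by (auto dest: openin_subset)
    show "A \<in> sets riesz_measure" using assms by simp
    show "positive (sets riesz_measure) outer_mass" using pos by (simp add: positive_def)
    show "countably_additive (sets riesz_measure) outer_mass"
      using ca sub unfolding countably_additive_def sets by blast
  qed
qed

lemma emeasure_riesz_open: "openin X U \<Longrightarrow> emeasure riesz_measure U = open_mass U"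
  by (simp add: emeasure_riesz_measure borel_of_top_open outer_mass_open)

lemma emeasure_riesz_space: "emeasure riesz_measure (topspace X) = ennreal (L (\<lambda>_. 1))"
  by (simp add: emeasure_riesz_open open_mass_space)

lemma finite_riesz_measure: "finite_measure riesz_measure"
  by (rule finite_measureI) (simp add: emeasure_riesz_space)

text \<open>Outer regularity is built into the outer mass. Inner regularity at \<open>A\<close> is
  outer regularity at the complement of \<open>A\<close>, and tightness is immediate because the
  whole space is compact.\<close>

lemma pos_radon_riesz_measure: "pos_radon X riesz_measure"
  unfolding pos_radon_def
proof (intro conjI ballI)
  interpret finite_measure riesz_measure by (rule finite_riesz_measure)
  have outer: "emeasure riesz_measure A = (INF U\<in>{U. openin X U \<and> A \<subseteq> U}. emeasure riesz_measure U)"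
    if "A \<in> sets riesz_measure" for A
    using that unfolding riesz_measure_sets emeasure_riesz_measure[OF that[simplified]] outer_mass_def
    by (intro INF_cong) (auto simp: emeasure_riesz_open)
  fix A assume A: "A \<in> sets riesz_measure"
  show "emeasure riesz_measure A = (INF U\<in>{U. openin X U \<and> A \<subseteq> U}. emeasure riesz_measure U)"
    by (rule outer[OF A])
  have Asub: "A \<subseteq> topspace X" using sets.sets_into_space[OF A] by simp
  let ?B = "topspace X - A"
  have B: "?B \<in> sets riesz_measure" using sets.compl_sets[OF A] by simp
  show "emeasure riesz_measure A = (SUP C\<in>{C. closedin X C \<and> C \<subseteq> A}. emeasure riesz_measure C)"
  proof (rule antisym)
    show "(SUP C\<in>{C. closedin X C \<and> C \<subseteq> A}. emeasure riesz_measure C) \<le> emeasure riesz_measure A"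
      using A by (auto intro!: SUP_least emeasure_mono)
    show "emeasure riesz_measure A \<le> (SUP C\<in>{C. closedin X C \<and> C \<subseteq> A}. emeasure riesz_measure C)"
    proof (rule ennreal_le_epsilon)
      fix e :: real assume e: "0 < e"
      obtain U where U: "openin X U" "?B \<subseteq> U" "open_mass U \<le> outer_mass ?B + ennreal e"
        using outer_mass_approx[of ?B e] e by auto
      have Us: "U \<in> sets riesz_measure" using U by (simp add: borel_of_top_open)
      have Csub: "topspace X - U \<subseteq> A" using U(2) by auto
      have "emeasure riesz_measure U \<le> emeasure riesz_measure ?B + ennreal e"
        using U B by (simp add: emeasure_riesz_measure emeasure_riesz_open)
      then have "measure riesz_measure U \<le> measure riesz_measure ?B + e"
        using e by (simp add: emeasure_eq_measure flip: ennreal_plus)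
      moreover have "measure riesz_measure ?B = measure riesz_measure (space riesz_measure) - measure riesz_measure A"
        using finite_measure_compl[OF A] by simp
      moreover have "measure riesz_measure (topspace X - U)
          = measure riesz_measure (space riesz_measure) - measure riesz_measure U"
        using finite_measure_compl[OF Us] by simp
      ultimately have "measure riesz_measure A \<le> measure riesz_measure (topspace X - U) + e" by simp
      then have "emeasure riesz_measure A \<le> emeasure riesz_measure (topspace X - U) + ennreal e"
        using e by (simp add: emeasure_eq_measure flip: ennreal_plus)
      also have "\<dots> \<le> (SUP C\<in>{C. closedin X C \<and> C \<subseteq> A}. emeasure riesz_measure C) + ennreal e"
        using U(1) Csub by (intro add_right_mono SUP_upper) (auto intro: closedin_diff)
      finally show "emeasure riesz_measure A
          \<le> (SUP C\<in>{C. closedin X C \<and> C \<subseteq> A}. emeasure riesz_measure C) + ennreal e" .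
    qed
  qed
next
  show "emeasure riesz_measure (space riesz_measure) = (SUP K\<in>{K. compactin X K}. emeasure riesz_measure K)"
  proof (rule antisym)
    show "emeasure riesz_measure (space riesz_measure) \<le> (SUP K\<in>{K. compactin X K}. emeasure riesz_measure K)"
      using compact by (intro SUP_upper) (auto simp: compact_space_def)
  qed (intro SUP_least emeasure_space)
qed (auto intro: finite_riesz_measure)

section \<open>Integration against the Riesz measure\<close>

lemma riesz_integrable: "cont f \<Longrightarrow> integrable riesz_measure f"
proof -
  assume f: "cont f"
  interpret finite_measure riesz_measure by (rule finite_riesz_measure)
  have "compact (f ` topspace X)"
    using image_compactin[OF compact[unfolded compact_space_def] f] by simp
  then obtain B where "\<And>x. x \<in> topspace X \<Longrightarrow> norm (f x) \<le> B"
    using compact_imp_bounded bounded_iff by (metis image_eqI)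
  then show ?thesis
    using continuous_map_measurable[OF f riesz_measure_sets]
    by (intro integrable_const_bound[where B = B]) auto
qed

text \<open>Cutting the graph of \<open>f\<close> at the heights \<open>k / n\<close> gives slices
  \<open>s k\<close> for which \<open>L (s k)\<close> is at most the measure of \<open>U k\<close>
  divided by \<open>n\<close>, and the integral at least the measure of \<open>U (Suc k)\<close>
  divided by \<open>n\<close>. The shift by one index costs at most the total mass divided by
  \<open>n\<close>.\<close>

lemma riesz_integral_ge:
  assumes f: "cont f" and f01: "\<And>x. x \<in> topspace X \<Longrightarrow> 0 \<le> f x \<and> f x \<le> 1"
  shows "L f \<le> (\<integral>x. f x \<partial>riesz_measure)"
proof -
  interpret finite_measure riesz_measure by (rule finite_riesz_measure)
  let ?I = "\<integral>x. f x \<partial>riesz_measure"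
  let ?m = "measure riesz_measure (topspace X)"
  have "L f \<le> ?I + ?m * (1 / real n)" if n: "0 < n" for n :: nat
  proof -
    define s where "s k x = max 0 (min (1 / real n) (f x - real k / real n))" for k x
    define U where "U k = {x \<in> topspace X. real k / real n < f x}" for k
    have Uo: "openin X (U k)" for k
    proof -
      have "openin X {x \<in> topspace X. f x \<in> {real k / real n<..}}"
        using f by (rule openin_continuous_map_preimage) simp
      then show ?thesis by (simp add: U_def)
    qed
    have Us: "U k \<in> sets riesz_measure" for k using Uo by (simp add: borel_of_top_open)
    have sc: "cont (s k)" for k
      unfolding s_def using f by (intro continuous_map_real_max continuous_map_real_min continuous_intros) auto
    have tele: "(\<Sum>k<m. s k x) = min (real m / real n) (f x)" if x: "x \<in> topspace X" for x m
    proof (induction m)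
      case 0 then show ?case using f01[OF x] by simp
    next
      case (Suc m)
      have "real (Suc m) / real n = real m / real n + 1 / real n" by (simp add: add_divide_distrib)
      moreover have "min a y + max 0 (min b (y - a)) = min (a + b) y" if "0 \<le> b" for a b y :: real
        using that by (auto simp: min_def max_def)
      ultimately show ?case using Suc by (simp add: s_def)
    qed
    have fs: "f x = (\<Sum>k<n. s k x)" if "x \<in> topspace X" for x
      using tele[OF that, of n] f01[OF that] n by simp
    have upper: "L (s k) \<le> measure riesz_measure (U k) / real n" for k
    proof -
      have ns: "cont (\<lambda>x. real n * s k x)" using sc by (rule continuous_map_real_mult_left)
      have "(\<lambda>x. real n * s k x) \<in> below (U k)"
      proof (rule belowI[OF ns])
        fix x assume "x \<in> topspace X"
        show "0 \<le> real n * s k x" by (simp add: s_def)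
        have "real n * s k x \<le> real n * (1 / real n)" by (intro mult_left_mono) (auto simp: s_def)
        then show "real n * s k x \<le> 1" using n by simp
        show "real n * s k x = 0" if "x \<notin> U k" using that \<open>x \<in> topspace X\<close> by (auto simp: U_def s_def)
      qed
      then have "ennreal (L (\<lambda>x. real n * s k x)) \<le> emeasure riesz_measure (U k)"
        using open_mass_upper emeasure_riesz_open[OF Uo] by metis
      then have "real n * L (s k) \<le> measure riesz_measure (U k)"
        using L_scale[OF sc] by (simp add: emeasure_eq_measure)
      then show ?thesis using n by (simp add: field_simps)
    qed
    have lower: "measure riesz_measure (U (Suc k)) / real n \<le> (\<integral>x. s k x \<partial>riesz_measure)" for k
    proof -
      have "(\<integral>x. indicator (U (Suc k)) x * (1 / real n) \<partial>riesz_measure) \<le> (\<integral>x. s k x \<partial>riesz_measure)"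
      proof (rule integral_mono)
        show "integrable riesz_measure (\<lambda>x. indicator (U (Suc k)) x * (1 / real n))"
          using Us by (auto simp: emeasure_eq_measure)
        show "integrable riesz_measure (s k)" by (rule riesz_integrable[OF sc])
        fix x
        have "real (Suc k) / real n = real k / real n + 1 / real n" by (simp add: add_divide_distrib)
        then show "indicator (U (Suc k)) x * (1 / real n) \<le> s k x"
          by (auto simp: s_def U_def indicator_def)
      qed
      then show ?thesis using sets.Int_space_eq2[OF Us, of "Suc k"] by simp
    qed
    have "L f = L (\<lambda>x. \<Sum>k<n. s k x)"
      using f sc fs by (intro L_cong continuous_map_sum) auto
    also have "\<dots> = (\<Sum>k<n. L (s k))" using sc by (intro L_sum) auto
    also have "\<dots> \<le> (\<Sum>k<n. measure riesz_measure (U k) / real n)" by (intro sum_mono upper)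
    also have "\<dots> \<le> (\<Sum>k<Suc n. measure riesz_measure (U k) / real n)" by simp
    also have "\<dots> = measure riesz_measure (U 0) / real n + (\<Sum>k<n. measure riesz_measure (U (Suc k)) / real n)"
      by (rule sum.lessThan_Suc_shift)
    also have "\<dots> \<le> ?m * (1 / real n) + (\<Sum>k<n. (\<integral>x. s k x \<partial>riesz_measure))"
      using bounded_measure[of "U 0"] by (intro add_mono sum_mono lower) (auto intro: divide_right_mono)
    also have "(\<Sum>k<n. (\<integral>x. s k x \<partial>riesz_measure)) = (\<integral>x. (\<Sum>k<n. s k x) \<partial>riesz_measure)"
      by (rule Bochner_Integration.integral_sum[symmetric]) (rule riesz_integrable[OF sc])
    also have "\<dots> = ?I" by (rule Bochner_Integration.integral_cong) (auto simp: fs)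
    finally show ?thesis by simp
  qed
  then have *: "L f \<le> ?I + ?m * (1 / real (Suc n))" for n by blast
  have "(\<lambda>n. ?I + ?m * (1 / real (Suc n))) \<longlonglongrightarrow> ?I + ?m * 0"
    by (intro tendsto_intros) (rule LIMSEQ_inverse_real_of_nat[unfolded inverse_eq_divide])
  then show ?thesis using * by (intro LIMSEQ_le_const[where x = ?I]) auto
qed

lemma measure_riesz_space: "measure riesz_measure (topspace X) = L (\<lambda>_. 1)"
  using emeasure_riesz_space L_one_nonneg by (simp add: measure_def)

text \<open>\<open>L\<close> and the integral agree at the constant 1, so the one-sided estimate
  applied to \<open>1 - f\<close> gives equality for functions with values in \<open>[0, 1]\<close>;
  an affine change brings a bounded function into that range.\<close>

theorem riesz_integral:
  assumes f: "cont f"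
  shows "(\<integral>x. f x \<partial>riesz_measure) = L f"
proof -
  interpret finite_measure riesz_measure by (rule finite_riesz_measure)
  have eq: "(\<integral>x. f x \<partial>riesz_measure) = L f"
    if f: "cont f" and f01: "\<And>x. x \<in> topspace X \<Longrightarrow> 0 \<le> f x \<and> f x \<le> 1" for f
  proof (rule antisym)
    have "L (\<lambda>x. 1 - f x) \<le> (\<integral>x. 1 - f x \<partial>riesz_measure)"
      using f01 f by (intro riesz_integral_ge continuous_intros) auto
    also have "\<dots> = L (\<lambda>_. 1) - (\<integral>x. f x \<partial>riesz_measure)"
      using riesz_integrable[OF f] by (subst Bochner_Integration.integral_diff) (auto simp: measure_riesz_space)
    finally show "(\<integral>x. f x \<partial>riesz_measure) \<le> L f" using L_diff[of "\<lambda>_. 1" f] f by simp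
  qed (rule riesz_integral_ge[OF that])
  have "compact (f ` topspace X)"
    using image_compactin[OF compact[unfolded compact_space_def] f] by simp
  then obtain B where B: "0 < B" "\<And>x. x \<in> topspace X \<Longrightarrow> \<bar>f x\<bar> \<le> B"
    using compact_imp_bounded bounded_pos by (metis image_eqI real_norm_def)
  let ?g = "\<lambda>x. (1 / (2 * B)) * (f x + B)"
  have g: "cont ?g" using f by (intro continuous_map_real_mult_left continuous_intros) auto
  have "(\<integral>x. ?g x \<partial>riesz_measure) = L ?g"
  proof (rule eq[OF g])
    fix x assume "x \<in> topspace X"
    then have "- B \<le> f x" "f x \<le> B" using B(2)[of x] by auto
    then show "0 \<le> ?g x \<and> ?g x \<le> 1" using B(1) by (auto simp: field_simps)
  qed
  also have "L ?g = (1 / (2 * B)) * L (\<lambda>x. f x + B)"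
    using f by (intro L_scale continuous_intros) auto
  also have "L (\<lambda>x. f x + B) = L f + B * L (\<lambda>_. 1)"
    using L_add[OF f, of "\<lambda>_. B"] L_const[of B] by simp
  also have "(\<integral>x. ?g x \<partial>riesz_measure) = (1 / (2 * B)) * ((\<integral>x. f x \<partial>riesz_measure) + B * L (\<lambda>_. 1))"
    using riesz_integrable[OF f] by (simp add: measure_riesz_space mult.commute)
  finally show ?thesis using B(1) by simp
qed

end

section \<open>Limits along compactifications\<close>

lemma Hausdorff_euclidean: "Hausdorff_space (euclidean :: 'q::t2_space topology)"
  unfolding Hausdorff_space_def disjnt_def by (simp, metis hausdorff)

lemma compact_embed_apply [simp]: "f \<in> F \<Longrightarrow> compact_embed F x f = f x"
  by (simp add: compact_embed_def)

lemma compact_embed_closure: "x \<in> X \<Longrightarrow> compact_embed F x \<in> powertop_real F closure_of (compact_embed F ` X)"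
  by (rule subsetD[OF closure_of_subset]) (auto simp: compact_embed_def)

lemma topspace_compactification:
  "topspace (compactification X F) = powertop_real F closure_of (compact_embed F ` X)"
  unfolding compactification_def topspace_subtopology
  by (rule inf.absorb2[OF closure_of_subset_topspace])

lemma compact_embed_topspace: "x \<in> X \<Longrightarrow> compact_embed F x \<in> topspace (compactification X F)"
  by (simp add: topspace_compactification compact_embed_closure)

lemma compactification_dense:
  "compactification X F closure_of (compact_embed F ` X) = topspace (compactification X F)"
  unfolding compactification_def closure_of_subtopology topspace_subtopology
proof -
  have "compact_embed F ` X \<subseteq> powertop_real F closure_of (compact_embed F ` X)"
    by (rule image_subsetI) (rule compact_embed_closure)
  from inf.absorb2[OF this]
  show "(powertop_real F closure_of compact_embed F ` X) \<inter>
      powertop_real F closure_of (powertop_real F closure_of compact_embed F ` X \<inter> compact_embed F ` X) =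
    topspace (powertop_real F) \<inter> powertop_real F closure_of compact_embed F ` X"
    by (simp only: inf.idem inf.absorb2[OF closure_of_subset_topspace])
qed

lemma Hausdorff_compactification: "Hausdorff_space (compactification X F)"
  unfolding compactification_def
  by (rule Hausdorff_space_subtopology) (simp add: Hausdorff_space_product_topology)

text \<open>Tychonoff's theorem: the closure of the image is a closed subset of the product of the
  closures of the ranges, which are compact.\<close>

lemma compact_compactification:
  assumes "\<And>f. f \<in> F \<Longrightarrow> bounded (f ` X)"
  shows "compact_space (compactification X F)"
  unfolding compactification_def
proof (rule compact_space_subtopology, rule closed_compactin)
  let ?B = "\<Pi>\<^sub>E f\<in>F. closure (f ` X)"
  show "compactin (powertop_real F) ?B"
    unfolding compactin_PiE using assms by (simp add: compact_closure)
  have "closedin (powertop_real F) ?B" unfolding closedin_product_topology by simp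
  moreover have "compact_embed F ` X \<subseteq> ?B"
    using closure_subset by (fastforce simp: compact_embed_def)
  ultimately show "powertop_real F closure_of (compact_embed F ` X) \<subseteq> ?B"
    by (intro closure_of_minimal)
qed simp

lemma continuous_map_coordinate:
  assumes "f \<in> F"
  shows "continuous_map (compactification X F) euclideanreal (\<lambda>\<zeta>. \<zeta> f)"
  unfolding compactification_def
  by (intro continuous_map_from_subtopology continuous_map_product_projection assms)

text \<open>The chosen extension is accessible through uniqueness: two continuous maps into a
  Hausdorff space that agree on the dense image of \<open>X\<close> coincide, so any explicit
  extension \<open>h\<close> evaluates it.\<close>

lemma cont_extension:
  assumes Y: "Hausdorff_space Y" and h: "continuous_map (compactification X F) Y h"
    and hg: "\<And>x. x \<in> X \<Longrightarrow> h (compact_embed F x) = g x"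
  shows "continuous_map (compactification X F) Y (cont_extension X F Y g)"
    and "\<zeta> \<in> topspace (compactification X F) \<Longrightarrow> cont_extension X F Y g \<zeta> = h \<zeta>"
proof -
  let ?P = "\<lambda>h. continuous_map (compactification X F) Y h \<and> (\<forall>x\<in>X. h (compact_embed F x) = g x)"
  have "?P h" using h hg by simp
  then have *: "?P (cont_extension X F Y g)" unfolding cont_extension_def by (rule someI[of ?P])
  then show "continuous_map (compactification X F) Y (cont_extension X F Y g)" by blast
  show "cont_extension X F Y g \<zeta> = h \<zeta>" if "\<zeta> \<in> topspace (compactification X F)"
    by (rule forall_in_closure_of_eq[OF _ Y conjunct1[OF *] h, of \<zeta> "compact_embed F ` X"])
      (use * hg that in \<open>auto simp: compactification_dense\<close>)
qed

text \<open>The traces on \<open>X\<close> of the neighbourhoods of \<open>\<zeta>\<close>. The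
  value of a continuous extension at \<open>\<zeta>\<close> is the limit along this filter, so that
  identities and inequalities between functions on \<open>X\<close> pass to the compactification as
  limits.\<close>

definition trace_filter :: "'p set \<Rightarrow> ('p \<Rightarrow> real) set \<Rightarrow> 'p cpt \<Rightarrow> 'p filter"
  where "trace_filter X F \<zeta> =
    inf (filtercomap (compact_embed F) (nhdsin (compactification X F) \<zeta>)) (principal X)"

lemma eventually_trace_filter:
  assumes "\<zeta> \<in> topspace (compactification X F)"
  shows "eventually P (trace_filter X F \<zeta>) \<longleftrightarrow>
    (\<exists>U. openin (compactification X F) U \<and> \<zeta> \<in> U \<and> (\<forall>x\<in>X. compact_embed F x \<in> U \<longrightarrow> P x))"
proof -
  have "eventually P (trace_filter X F \<zeta>) \<longleftrightarrow>
    (\<exists>Q. (\<exists>U. openin (compactification X F) U \<and> \<zeta> \<in> U \<and> (\<forall>x\<in>U. Q x)) \<and>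
      (\<forall>x. Q (compact_embed F x) \<longrightarrow> x \<in> X \<longrightarrow> P x))"
    using assms
    by (auto simp: trace_filter_def eventually_inf_principal eventually_filtercomap eventually_nhdsin)
  also have "\<dots> \<longleftrightarrow> (\<exists>U. openin (compactification X F) U \<and> \<zeta> \<in> U \<and> (\<forall>x\<in>X. compact_embed F x \<in> U \<longrightarrow> P x))"
  proof safe
    fix U assume "openin (compactification X F) U" "\<zeta> \<in> U" "\<forall>x\<in>X. compact_embed F x \<in> U \<longrightarrow> P x"
    then show "\<exists>Q. (\<exists>U. openin (compactification X F) U \<and> \<zeta> \<in> U \<and> (\<forall>x\<in>U. Q x)) \<and>
      (\<forall>x. Q (compact_embed F x) \<longrightarrow> x \<in> X \<longrightarrow> P x)"
      by (intro exI[of _ "\<lambda>y. y \<in> U"]) auto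
  qed blast
  finally show ?thesis .
qed

lemma trace_filter_nontrivial:
  assumes "\<zeta> \<in> topspace (compactification X F)"
  shows "trace_filter X F \<zeta> \<noteq> bot"
proof
  assume "trace_filter X F \<zeta> = bot"
  then have "eventually (\<lambda>_. False) (trace_filter X F \<zeta>)" by simp
  then obtain U where "openin (compactification X F) U" "\<zeta> \<in> U" "\<forall>x\<in>X. compact_embed F x \<notin> U"
    using eventually_trace_filter[OF assms, of "\<lambda>_. False"] by auto
  moreover have "\<zeta> \<in> compactification X F closure_of (compact_embed F ` X)"
    unfolding compactification_dense by (rule assms)
  ultimately show False unfolding in_closure_of by blast
qed

lemma trace_filter_domain:
  assumes "\<zeta> \<in> topspace (compactification X F)"
  shows "eventually (\<lambda>x. x \<in> X) (trace_filter X F \<zeta>)"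
  using assms by (subst eventually_trace_filter) auto

lemma trace_filter_tendsto:
  fixes h :: "'p cpt \<Rightarrow> 'q::topological_space"
  assumes z: "\<zeta> \<in> topspace (compactification X F)"
    and h: "continuous_map (compactification X F) euclidean h"
    and hg: "\<And>x. x \<in> X \<Longrightarrow> h (compact_embed F x) = g x"
  shows "(g \<longlongrightarrow> h \<zeta>) (trace_filter X F \<zeta>)"
proof (rule topological_tendstoI)
  fix S assume S: "open S" "h \<zeta> \<in> S"
  have "openin (compactification X F) {x \<in> topspace (compactification X F). h x \<in> S}"
    using h S(1) by (intro openin_continuous_map_preimage) auto
  then show "eventually (\<lambda>x. g x \<in> S) (trace_filter X F \<zeta>)"
    unfolding eventually_trace_filter[OF z]
    using z S hg by (intro exI[of _ "{x \<in> topspace (compactification X F). h x \<in> S}"]) auto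
qed

lemma trace_filter_tendsto_extension:
  fixes h :: "'p cpt \<Rightarrow> 'q::t2_space"
  assumes z: "\<zeta> \<in> topspace (compactification X F)"
    and h: "continuous_map (compactification X F) euclidean h"
    and hg: "\<And>x. x \<in> X \<Longrightarrow> h (compact_embed F x) = g x"
  shows "(g \<longlongrightarrow> cont_extension X F euclidean g \<zeta>) (trace_filter X F \<zeta>)"
proof -
  have "cont_extension X F euclidean g \<zeta> = h \<zeta>"
    by (rule cont_extension(2)[OF Hausdorff_euclidean h hg z])
  then show ?thesis using trace_filter_tendsto[OF z h hg] by simp
qed

lemma trace_filter_tendsto_coordinate:
  assumes "\<zeta> \<in> topspace (compactification X F)" "f \<in> F"
  shows "(f \<longlongrightarrow> \<zeta> f) (trace_filter X F \<zeta>)"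
  using assms by (intro trace_filter_tendsto continuous_map_coordinate) auto

section \<open>Extension of functions with values in the extended line\<close>

definition squash :: "real \<Rightarrow> real"
  where "squash t = t / (1 + \<bar>t\<bar>)"

text \<open>The inverse of the homeomorphism \<open>squash\<close> from the line onto
  \<open>(-1, 1)\<close>, continued by infinite values so that it is monotone and continuous on the
  whole line. A Lipschitz function is extended by extending its bounded squashed version and undoing
  the squashing.\<close>

definition unsquash :: "real \<Rightarrow> ereal"
  where "unsquash t = (if t \<ge> 1 then \<infinity> else if t \<le> - 1 then - \<infinity> else ereal (t / (1 - \<bar>t\<bar>)))"

lemma abs_squash_less: "\<bar>squash t\<bar> < 1"
  by (simp add: squash_def)

lemma unsquash_squash: "unsquash (squash t) = ereal t"
proof -
  have "squash t < 1" "- 1 < squash t" using abs_squash_less[of t] by auto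
  moreover have "\<bar>squash t\<bar> = \<bar>t\<bar> / (1 + \<bar>t\<bar>)" by (simp add: squash_def)
  then have "1 - \<bar>squash t\<bar> = 1 / (1 + \<bar>t\<bar>)" by (simp add: field_simps)
  then have "squash t / (1 - \<bar>squash t\<bar>) = t" by (simp add: squash_def)
  ultimately show ?thesis by (simp add: unsquash_def)
qed

lemma unsquash_mono:
  assumes "s \<le> t" shows "unsquash s \<le> unsquash t"
proof -
  have "s / (1 - \<bar>s\<bar>) \<le> t / (1 - \<bar>t\<bar>)" if "- 1 < s" "t < 1"
  proof -
    consider "0 \<le> s" | "t \<le> 0" | "s \<le> 0" "0 \<le> t" by linarith
    then show ?thesis
    proof cases
      case 3
      then have "s / (1 - \<bar>s\<bar>) \<le> 0" "0 \<le> t / (1 - \<bar>t\<bar>)"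
        using that by (auto intro: divide_nonpos_pos divide_nonneg_pos)
      then show ?thesis by linarith
    qed (use that assms in \<open>auto simp: divide_simps algebra_simps\<close>)
  qed
  then show ?thesis using assms by (auto simp: unsquash_def)
qed

text \<open>A monotone map whose range is open has no jumps; here the range is all of
  \<open>ereal\<close>.\<close>

lemma continuous_unsquash: "continuous_on UNIV unsquash"
proof (rule continuous_onI_mono)
  have "\<exists>t. unsquash t = y" for y
  proof (cases y)
    case PInf then show ?thesis by (intro exI[of _ 1]) (simp add: unsquash_def)
  next
    case MInf then show ?thesis by (intro exI[of _ "- 1"]) (simp add: unsquash_def)
  qed (use unsquash_squash in blast)
  then show "open (range unsquash)" by (metis open_UNIV surj_def)
qed (rule unsquash_mono)

text \<open>On the nonnegative half-line the difference quotient is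
  \<open>1 / ((1 + a) * (1 + b))\<close>; oddness of \<open>squash\<close> covers the remaining
  cases.\<close>

lemma squash_diff_le: "\<bar>squash s - squash t\<bar> \<le> \<bar>s - t\<bar>"
proof -
  have pos: "0 \<le> squash b - squash a \<and> squash b - squash a \<le> b - a" if "0 \<le> a" "a \<le> b" for a b
  proof -
    have eq: "squash b - squash a = (b - a) / ((1 + a) * (1 + b))"
      using that by (simp add: squash_def divide_simps) (simp add: algebra_simps)
    have "1 * 1 \<le> (1 + a) * (1 + b)" using that by (intro mult_mono) auto
    then have "(b - a) / ((1 + a) * (1 + b)) \<le> (b - a) / 1"
      using that by (intro divide_left_mono) auto
    then show ?thesis unfolding eq using that by simp
  qed
  have odd: "squash (- x) = - squash x" for x by (simp add: squash_def)
  have "0 \<le> squash b - squash a \<and> squash b - squash a \<le> b - a" if "a \<le> b" for a b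
  proof -
    consider "0 \<le> a" | "b \<le> 0" | "a \<le> 0" "0 \<le> b" by linarith
    then show ?thesis
    proof cases
      case 2
      then show ?thesis using pos[of "- b" "- a"] that odd[of a] odd[of b] by simp
    next
      case 3
      then show ?thesis using pos[of 0 b] pos[of 0 "- a"] odd[of a] by (simp add: squash_def[of 0])
    qed (use pos that in blast)
  qed
  from this[of s t] this[of t s] show ?thesis by linarith
qed

lemma ereal_extension:
  assumes F: "(\<lambda>x. squash (g x)) \<in> F"
  shows "continuous_map (compactification X F) euclidean (cont_extension X F euclidean (\<lambda>x. ereal (g x)))"
    and "\<zeta> \<in> topspace (compactification X F) \<Longrightarrow>
      ((\<lambda>x. ereal (g x)) \<longlongrightarrow> cont_extension X F euclidean (\<lambda>x. ereal (g x)) \<zeta>) (trace_filter X F \<zeta>)"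
proof -
  let ?h = "unsquash \<circ> (\<lambda>\<zeta>. \<zeta> (\<lambda>x. squash (g x)))"
  have h: "continuous_map (compactification X F) euclidean ?h"
    using continuous_unsquash by (intro continuous_map_compose[OF continuous_map_coordinate[OF F]]) simp
  have hg: "?h (compact_embed F x) = ereal (g x)" for x
    using F by (simp add: unsquash_squash)
  show "continuous_map (compactification X F) euclidean (cont_extension X F euclidean (\<lambda>x. ereal (g x)))"
    by (rule cont_extension(1)[OF Hausdorff_euclidean h hg])
  show "((\<lambda>x. ereal (g x)) \<longlongrightarrow> cont_extension X F euclidean (\<lambda>x. ereal (g x)) \<zeta>) (trace_filter X F \<zeta>)"
    if "\<zeta> \<in> topspace (compactification X F)"
    by (rule trace_filter_tendsto_extension[OF that h hg])
qed

section \<open>The compactifications of the space and of the space of pairs\<close>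

abbreviation filterU :: "'a::metric_space cpt \<Rightarrow> 'a filter"
  where "filterU \<equiv> trace_filter UNIV bdd_unif_cont"

abbreviation filterB :: "('a::metric_space \<times> 'a) cpt \<Rightarrow> ('a \<times> 'a) filter"
  where "filterB \<equiv> trace_filter Mtilde bdd_cont"

lemma compact_betaM: "compact_space (betaM :: ('a::metric_space \<times> 'a) cpt topology)"
  unfolding betaM_def by (rule compact_compactification) (simp add: bdd_cont_def)

lemma Hausdorff_betaM: "Hausdorff_space betaM"
  unfolding betaM_def by (rule Hausdorff_compactification)

lemma Hausdorff_MU: "Hausdorff_space MU"
  unfolding MU_def by (rule Hausdorff_compactification)

lemma filterU_nontrivial: "\<xi> \<in> topspace MU \<Longrightarrow> filterU \<xi> \<noteq> bot"
  unfolding MU_def by (rule trace_filter_nontrivial)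

lemma filterB_nontrivial: "\<zeta> \<in> topspace betaM \<Longrightarrow> filterB \<zeta> \<noteq> bot"
  unfolding betaM_def by (rule trace_filter_nontrivial)

lemma filterB_distinct: "\<zeta> \<in> topspace betaM \<Longrightarrow> eventually (\<lambda>z. fst z \<noteq> snd z) (filterB \<zeta>)"
  unfolding betaM_def by (rule eventually_mono[OF trace_filter_domain]) (auto simp: Mtilde_def)

lemma filterB_coordinate: "\<zeta> \<in> topspace betaM \<Longrightarrow> u \<in> bdd_cont \<Longrightarrow> (u \<longlongrightarrow> \<zeta> u) (filterB \<zeta>)"
  unfolding betaM_def by (rule trace_filter_tendsto_coordinate)

lemma bdd_contI:
  assumes "continuous_on Mtilde u" "\<And>z. z \<in> Mtilde \<Longrightarrow> \<bar>u z\<bar> \<le> B"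
  shows "u \<in> bdd_cont"
  using assms by (fastforce simp: bdd_cont_def bounded_iff)

lemma squash_lipschitz_bdd_unif_cont:
  assumes "L-lipschitz_on UNIV f"
  shows "(\<lambda>x. squash (f x)) \<in> bdd_unif_cont"
proof -
  have "L-lipschitz_on UNIV (\<lambda>x. squash (f x))"
  proof (rule lipschitz_onI)
    fix x y
    have "dist (squash (f x)) (squash (f y)) \<le> dist (f x) (f y)"
      unfolding dist_real_def by (rule squash_diff_le)
    also have "\<dots> \<le> L * dist x y" by (rule lipschitz_onD[OF assms]) auto
    finally show "dist (squash (f x)) (squash (f y)) \<le> L * dist x y" .
  qed (rule lipschitz_on_nonneg[OF assms])
  moreover have "bounded (range (\<lambda>x. squash (f x)))"
    unfolding bounded_iff using abs_squash_less by (auto intro!: exI[of _ 1] less_imp_le)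
  ultimately show ?thesis
    by (auto simp: bdd_unif_cont_def intro: lipschitz_on_uniformly_continuous)
qed

lemma extU_continuous:
  "L-lipschitz_on UNIV f \<Longrightarrow> continuous_map MU euclidean (extU f)"
  unfolding extU_def MU_def by (intro ereal_extension squash_lipschitz_bdd_unif_cont)

lemma extU_tendsto:
  "L-lipschitz_on UNIV f \<Longrightarrow> \<xi> \<in> topspace MU \<Longrightarrow> ((\<lambda>x. ereal (f x)) \<longlongrightarrow> extU f \<xi>) (filterU \<xi>)"
  unfolding extU_def MU_def by (intro ereal_extension squash_lipschitz_bdd_unif_cont)

lemma extU_iotaU:
  assumes "L-lipschitz_on UNIV f"
  shows "extU f (iotaU x) = ereal (f x)"
proof -
  let ?h = "unsquash \<circ> (\<lambda>\<zeta>. \<zeta> (\<lambda>x. squash (f x)))"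
  note F = squash_lipschitz_bdd_unif_cont[OF assms]
  have "continuous_map (compactification UNIV bdd_unif_cont) euclidean ?h"
    using continuous_unsquash by (intro continuous_map_compose[OF continuous_map_coordinate[OF F]]) simp
  then have "extU f (iotaU x) = ?h (iotaU x)"
    unfolding extU_def
    by (rule cont_extension(2)[OF Hausdorff_euclidean])
      (use F in \<open>auto simp: unsquash_squash compact_embed_topspace\<close>)
  then show ?thesis using F by (simp add: unsquash_squash)
qed

lemma dist_ext_extends:
  "continuous_map betaM euclidean (dist_ext :: ('a::metric_space \<times> 'a) cpt \<Rightarrow> ennreal)"
  "\<zeta> \<in> topspace betaM \<Longrightarrow> ((\<lambda>z. ennreal (dist (fst z) (snd z :: 'a))) \<longlongrightarrow> dist_ext \<zeta>) (filterB \<zeta>)"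
proof -
  have F: "(\<lambda>z::'a \<times> 'a. squash (dist (fst z) (snd z))) \<in> bdd_cont"
  proof (rule bdd_contI[where B = 1])
    have "1 + \<bar>r\<bar> \<noteq> 0" for r :: real by linarith
    then show "continuous_on Mtilde (\<lambda>z::'a \<times> 'a. squash (dist (fst z) (snd z)))"
      unfolding squash_def by (intro continuous_intros) blast
    show "\<bar>squash (dist (fst z) (snd z :: 'a))\<bar> \<le> 1" for z
      using abs_squash_less less_imp_le by blast
  qed
  let ?h = "e2ennreal \<circ> (unsquash \<circ> (\<lambda>\<zeta>. \<zeta> (\<lambda>z::'a \<times> 'a. squash (dist (fst z) (snd z)))))"
  have h: "continuous_map (compactification Mtilde bdd_cont) euclidean ?h"
  proof -
    have "continuous_map euclidean euclidean unsquash" "continuous_map euclidean euclidean e2ennreal"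
      using continuous_unsquash continuous_on_e2ennreal[of UNIV] by auto
    then show ?thesis
      by (intro continuous_map_compose[OF continuous_map_compose[OF continuous_map_coordinate[OF F]]])
  qed
  have hg: "?h (compact_embed bdd_cont z) = (\<lambda>(x, y). ennreal (dist x y)) z" for z
    using F by (simp add: unsquash_squash case_prod_beta ennreal.rep_eq e2ennreal_ereal)
  show "continuous_map betaM euclidean (dist_ext :: ('a \<times> 'a) cpt \<Rightarrow> ennreal)"
    unfolding dist_ext_def betaM_def by (rule cont_extension(1)[OF Hausdorff_euclidean h hg])
  show "((\<lambda>z. ennreal (dist (fst z) (snd z :: 'a))) \<longlongrightarrow> dist_ext \<zeta>) (filterB \<zeta>)"
    if "\<zeta> \<in> topspace betaM"
    using trace_filter_tendsto_extension[OF that[unfolded betaM_def] h hg]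
    by (simp add: dist_ext_def case_prod_beta')
qed

text \<open>An explicit extension sends \<open>\<zeta>\<close> to the family of the values
  \<open>\<zeta> (g o p)\<close>, since composing a bounded uniformly continuous \<open>g\<close>
  with \<open>p\<close> gives a bounded continuous function of pairs. Continuity is checked
  coordinatewise, and density keeps the image inside \<open>MU\<close>.\<close>

lemma coord_extension:
  fixes p :: "'a::metric_space \<times> 'a \<Rightarrow> 'a"
  assumes p: "continuous_on UNIV p"
  defines "h \<equiv> cont_extension Mtilde bdd_cont MU (\<lambda>z. iotaU (p z))"
  shows "continuous_map betaM MU h"
    and "z \<in> Mtilde \<Longrightarrow> h (compact_embed bdd_cont z) = iotaU (p z)"
proof -
  let ?k = "\<lambda>\<zeta>. \<lambda>g\<in>bdd_unif_cont. \<zeta> (g \<circ> p)"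
  have gp: "g \<circ> p \<in> bdd_cont" if "g \<in> bdd_unif_cont" for g
  proof -
    have "continuous_on Mtilde (g \<circ> p)"
      using that continuous_on_subset[OF p]
      by (intro continuous_on_compose) (auto simp: bdd_unif_cont_def intro: uniformly_continuous_imp_continuous continuous_on_subset)
    moreover have "bounded ((g \<circ> p) ` Mtilde)"
      using that by (auto simp: bdd_unif_cont_def image_comp[symmetric] intro: bounded_subset)
    ultimately show ?thesis by (simp add: bdd_cont_def)
  qed
  have kg: "?k (compact_embed bdd_cont z) = iotaU (p z)" for z
    using gp by (auto simp: compact_embed_def fun_eq_iff)
  have k: "continuous_map betaM (powertop_real bdd_unif_cont) ?k"
    unfolding continuous_map_componentwise
    using gp by (auto simp: betaM_def intro!: continuous_map_coordinate)
  have "?k ` topspace betaM \<subseteq> topspace MU"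
  proof -
    have "?k ` (betaM closure_of (compact_embed bdd_cont ` Mtilde))
      \<subseteq> powertop_real bdd_unif_cont closure_of (?k ` compact_embed bdd_cont ` Mtilde)"
      by (rule continuous_map_image_closure_subset[OF k])
    also have "\<dots> \<subseteq> powertop_real bdd_unif_cont closure_of (range iotaU)"
      by (rule closure_of_mono) (use kg in auto)
    finally show ?thesis by (simp add: compactification_dense betaM_def MU_def topspace_compactification)
  qed
  then have k': "continuous_map betaM MU ?k"
    using k unfolding MU_def compactification_def continuous_map_in_subtopology
    by (auto simp: topspace_subtopology)
  show "continuous_map betaM MU h"
    using cont_extension(1)[OF Hausdorff_MU k'[unfolded betaM_def] kg]
    by (simp add: h_def betaM_def)
  have eq: "h \<zeta> = ?k \<zeta>" if "\<zeta> \<in> topspace betaM" for \<zeta>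
    unfolding h_def using that
    by (intro cont_extension(2)[OF Hausdorff_MU k'[unfolded betaM_def] kg]) (simp add: betaM_def)
  show "h (compact_embed bdd_cont z) = iotaU (p z)" if "z \<in> Mtilde"
    using eq[of "compact_embed bdd_cont z"] kg[of z] compact_embed_topspace[OF that, of bdd_cont]
    unfolding betaM_def by metis
qed

lemmas coord1_continuous = coord_extension(1)[of fst, folded coord1_def, OF continuous_on_fst[OF continuous_on_id]]
lemmas coord2_continuous = coord_extension(1)[of snd, folded coord2_def, OF continuous_on_snd[OF continuous_on_id]]
lemmas coord1_embed = coord_extension(2)[of fst, folded coord1_def, OF continuous_on_fst[OF continuous_on_id]]
lemmas coord2_embed = coord_extension(2)[of snd, folded coord2_def, OF continuous_on_snd[OF continuous_on_id]]

lemma extU_coord_tendsto: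
  fixes f :: "'a::metric_space \<Rightarrow> real"
  assumes f: "L-lipschitz_on UNIV f" and z: "\<zeta> \<in> topspace betaM"
  shows "((\<lambda>z. ereal (f (fst z))) \<longlongrightarrow> extU f (coord1 \<zeta>)) (filterB \<zeta>)"
    and "((\<lambda>z. ereal (f (snd z))) \<longlongrightarrow> extU f (coord2 \<zeta>)) (filterB \<zeta>)"
proof -
  have "continuous_map betaM euclidean (extU f \<circ> coord1)" "continuous_map betaM euclidean (extU f \<circ> coord2)"
    using f by (auto intro: continuous_map_compose extU_continuous coord1_continuous coord2_continuous)
  from this[unfolded betaM_def, THEN trace_filter_tendsto[OF z[unfolded betaM_def]]]
  show "((\<lambda>z. ereal (f (fst z))) \<longlongrightarrow> extU f (coord1 \<zeta>)) (filterB \<zeta>)"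
    "((\<lambda>z. ereal (f (snd z))) \<longlongrightarrow> extU f (coord2 \<zeta>)) (filterB \<zeta>)"
    by (auto simp: coord1_embed coord2_embed extU_iotaU[OF f])
qed

lemma coord_coordinate_tendsto:
  assumes z: "\<zeta> \<in> topspace betaM" and g: "g \<in> bdd_unif_cont"
  shows "((\<lambda>z. g (fst z)) \<longlongrightarrow> coord1 \<zeta> g) (filterB \<zeta>)"
    and "((\<lambda>z. g (snd z)) \<longlongrightarrow> coord2 \<zeta> g) (filterB \<zeta>)"
proof -
  have c: "continuous_map MU euclideanreal (\<lambda>\<xi>. \<xi> g)"
    unfolding MU_def by (rule continuous_map_coordinate[OF g])
  have "continuous_map betaM euclideanreal ((\<lambda>\<xi>. \<xi> g) \<circ> coord1)"
    "continuous_map betaM euclideanreal ((\<lambda>\<xi>. \<xi> g) \<circ> coord2)"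
    using continuous_map_compose[OF coord1_continuous c] continuous_map_compose[OF coord2_continuous c] by auto
  from this[unfolded betaM_def, THEN trace_filter_tendsto[OF z[unfolded betaM_def]]]
  show "((\<lambda>z. g (fst z)) \<longlongrightarrow> coord1 \<zeta> g) (filterB \<zeta>)"
    "((\<lambda>z. g (snd z)) \<longlongrightarrow> coord2 \<zeta> g) (filterB \<zeta>)"
    using g by (auto simp: coord1_embed coord2_embed)
qed

section \<open>Lipschitz functions and their functionals\<close>

lemma lip_apply_simps [simp]:
  "lip_apply (f + g) x = lip_apply f x + lip_apply g x"
  "lip_apply (f - g) x = lip_apply f x - lip_apply g x"
  "lip_apply (- f) x = - lip_apply f x"
  "lip_apply (c *\<^sub>R f) x = c * lip_apply f x"
  "lip_apply 0 x = 0"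
  by (transfer, simp)+

lemma lip_apply_base [simp]: "lip_apply f 0 = 0"
  using lip_apply[of f] by simp

lemma lip_apply_lipschitz: "(norm f)-lipschitz_on UNIV (lip_apply f)"
  using lip_apply[of f] by (auto simp: norm_lip0.rep_eq intro: lip_const_lipschitz)

lemma lip_apply_diff_le: "\<bar>lip_apply f x - lip_apply f y\<bar> \<le> norm f * dist x y"
  using lipschitz_onD[OF lip_apply_lipschitz[of f], of x y] by (simp add: dist_real_def)

lemma lip_apply_le: "\<bar>lip_apply f x\<bar> \<le> norm f * dist x 0"
  using lip_apply_diff_le[of f x 0] by simp

lemma lip_apply_Abs_lip0:
  assumes "f 0 = 0" "L-lipschitz_on UNIV f"
  shows "lip_apply (Abs_lip0 f) = f"
  using assms by (intro Abs_lip0_inverse) auto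

lemma norm_lip0_le: "L-lipschitz_on UNIV (lip_apply f) \<Longrightarrow> norm f \<le> L"
  by (simp add: norm_lip0.rep_eq lip_const_le)

lemma lip0_eqI: "(\<And>x. lip_apply f x = lip_apply g x) \<Longrightarrow> f = g"
  by (metis ext lip_apply_inject)

definition rho :: "'a::{metric_space, zero} lip0"
  where "rho = Abs_lip0 (\<lambda>x. dist x 0)"

lemma abs_dist_diff_right_le: "\<bar>dist x c - dist y c\<bar> \<le> dist x y"
  using abs_dist_diff_le[of x c y] by (simp add: dist_commute)

lemma dist_base_lipschitz: "1-lipschitz_on UNIV (\<lambda>x. dist x c)"
  by (rule lipschitz_onI) (simp_all add: dist_real_def abs_dist_diff_right_le)

lemma lip_apply_rho [simp]: "lip_apply rho x = dist x 0"
  unfolding rho_def by (subst lip_apply_Abs_lip0[OF _ dist_base_lipschitz]) auto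

text \<open>Equality can fail: on a one-point space \<open>rho\<close> is zero.\<close>

lemma norm_rho_le: "norm rho \<le> 1"
proof -
  have "lip_apply rho = (\<lambda>x. dist x 0)" by (rule ext) simp
  then show ?thesis using dist_base_lipschitz[of 0] by (intro norm_lip0_le) simp
qed

lemma lipschitz_on_max:
  fixes f g :: "'a::metric_space \<Rightarrow> real"
  assumes K: "K-lipschitz_on X f" and L: "L-lipschitz_on X g"
  shows "(max K L)-lipschitz_on X (\<lambda>x. max (f x) (g x))"
proof (rule lipschitz_onI)
  fix x y assume xy: "x \<in> X" "y \<in> X"
  have "K * dist x y \<le> max K L * dist x y" "L * dist x y \<le> max K L * dist x y"
    by (auto intro: mult_right_mono)
  then have "\<bar>f x - f y\<bar> \<le> max K L * dist x y" "\<bar>g x - g y\<bar> \<le> max K L * dist x y"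
    using lipschitz_onD[OF K xy] lipschitz_onD[OF L xy] by (simp_all only: dist_real_def)
  moreover have "\<bar>max a b - max c d\<bar> \<le> r" if "\<bar>a - c\<bar> \<le> r" "\<bar>b - d\<bar> \<le> r" for a b c d r :: real
    using that by linarith
  ultimately show "dist (max (f x) (g x)) (max (f y) (g y)) \<le> max K L * dist x y"
    by (simp only: dist_real_def)
qed (use lipschitz_on_nonneg[OF K] in auto)

lift_definition lip_max :: "'a::{metric_space, zero} lip0 \<Rightarrow> 'a lip0 \<Rightarrow> 'a lip0"
  is "\<lambda>f g x. max (f x) (g x)"
  using lipschitz_on_max by fastforce

lemma lip_apply_lip_max [simp]: "lip_apply (lip_max f g) x = max (lip_apply f x) (lip_apply g x)"
  by transfer simp

definition lip_min :: "'a::{metric_space, zero} lip0 \<Rightarrow> 'a lip0 \<Rightarrow> 'a lip0"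
  where "lip_min f g = - lip_max (- f) (- g)"

lemma lip_apply_lip_min [simp]: "lip_apply (lip_min f g) x = min (lip_apply f x) (lip_apply g x)"
  by (simp add: lip_min_def)

abbreviation lip_nonneg :: "'a::{metric_space, zero} lip0 \<Rightarrow> bool"
  where "lip_nonneg f \<equiv> \<forall>x. 0 \<le> lip_apply f x"

section \<open>Multiplication by weights and cutoffs\<close>

definition lip_weight :: "('a::{metric_space, zero} \<Rightarrow> real) \<Rightarrow> real \<Rightarrow> bool"
  where "lip_weight h C \<longleftrightarrow> (\<forall>f. (C * norm f)-lipschitz_on UNIV (\<lambda>x. lip_apply f x * h x))"

text \<open>For \<open>x\<close> in the ball of radius \<open>R\<close>, where
  \<open>|f(x)| \<le> R * norm f\<close>, the splitting
  \<open>f(x) (h(x) - h(y)) + h(y) (f(x) - f(y))\<close> yields the constant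
  \<open>R * K + 1\<close>. By symmetry one point in the ball suffices, and if neither is there,
  both products vanish.\<close>

lemma lip_weight_compact_support:
  fixes h :: "'a::{metric_space, zero} \<Rightarrow> real"
  assumes K: "K-lipschitz_on UNIV h" and h1: "\<And>x. \<bar>h x\<bar> \<le> 1"
    and R: "0 \<le> R" "\<And>x. R \<le> dist x 0 \<Longrightarrow> h x = 0"
  shows "lip_weight h (R * K + 1)"
  unfolding lip_weight_def
proof (intro allI lipschitz_onI)
  fix f :: "'a lip0" and x y :: 'a
  have K0: "0 \<le> K" by (rule lipschitz_on_nonneg[OF K])
  show "0 \<le> (R * K + 1) * norm f" using K0 R(1) by simp
  have main: "\<bar>lip_apply f x * h x - lip_apply f y * h y\<bar> \<le> (R * K + 1) * norm f * dist x y"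
    if x: "dist x 0 \<le> R" for x y
  proof -
    have "\<bar>lip_apply f x\<bar> * \<bar>h x - h y\<bar> \<le> (norm f * R) * (K * dist x y)"
    proof (rule mult_mono)
      show "\<bar>lip_apply f x\<bar> \<le> norm f * R"
        using lip_apply_le[of f x] mult_left_mono[OF x, of "norm f"] by simp
      show "\<bar>h x - h y\<bar> \<le> K * dist x y"
        using lipschitz_onD[OF K, of x y] by (simp add: dist_real_def)
    qed (use R(1) in auto)
    moreover have "\<bar>h y\<bar> * \<bar>lip_apply f x - lip_apply f y\<bar> \<le> 1 * (norm f * dist x y)"
      by (rule mult_mono) (use h1 lip_apply_diff_le in auto)
    moreover have "lip_apply f x * h x - lip_apply f y * h y
        = lip_apply f x * (h x - h y) + h y * (lip_apply f x - lip_apply f y)"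
      by (simp add: algebra_simps)
    moreover have "\<bar>lip_apply f x * (h x - h y) + h y * (lip_apply f x - lip_apply f y)\<bar>
        \<le> \<bar>lip_apply f x\<bar> * \<bar>h x - h y\<bar> + \<bar>h y\<bar> * \<bar>lip_apply f x - lip_apply f y\<bar>"
      using abs_triangle_ineq[of "lip_apply f x * (h x - h y)" "h y * (lip_apply f x - lip_apply f y)"]
      by (simp only: abs_mult)
    ultimately have "\<bar>lip_apply f x * h x - lip_apply f y * h y\<bar>
        \<le> norm f * R * (K * dist x y) + 1 * (norm f * dist x y)"
      by linarith
    also have "\<dots> = (R * K + 1) * norm f * dist x y" by (simp add: algebra_simps)
    finally show ?thesis .
  qed
  show "dist (lip_apply f x * h x) (lip_apply f y * h y) \<le> (R * K + 1) * norm f * dist x y"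
  proof (cases "dist x 0 \<le> R \<or> dist y 0 \<le> R")
    case True
    then show ?thesis
      using main[of x y] main[of y x] by (auto simp: dist_real_def dist_commute abs_minus_commute)
  next
    case False
    then have "h x = 0" "h y = 0" using R(2) by auto
    then show ?thesis using K0 R(1) by simp
  qed
qed

lemma lip_weight_compl:
  assumes "lip_weight h C"
  shows "lip_weight (\<lambda>x. 1 - h x) (1 + C)"
  unfolding lip_weight_def
proof
  fix f :: "'a lip0"
  have "(norm f + C * norm f)-lipschitz_on UNIV (\<lambda>x. lip_apply f x - lip_apply f x * h x)"
    using assms lip_apply_lipschitz by (intro lipschitz_on_diff) (auto simp: lip_weight_def)
  then show "((1 + C) * norm f)-lipschitz_on UNIV (\<lambda>x. lip_apply f x * (1 - h x))"
    by (simp add: algebra_simps)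
qed

text \<open>\<open>lip_weight\<close> makes the product with \<open>h\<close> Lipschitz, with a
  constant linear in the norm of \<open>f\<close>; this gives \<open>Abs_lip0\<close> and
  \<open>Blinfun\<close> in \<open>weight_op\<close> their intended meaning.\<close>

lemma lip_apply_weight_op:
  assumes h: "lip_weight h C"
  shows "lip_apply (weight_op h f) x = lip_apply f x * h x"
proof -
  define T where "T f = Abs_lip0 (\<lambda>x. lip_apply f x * h x)" for f
  have app: "lip_apply (T f) = (\<lambda>x. lip_apply f x * h x)" for f
    unfolding T_def using h
    by (intro lip_apply_Abs_lip0[where L = "C * norm f"]) (auto simp: lip_weight_def)
  have "bounded_linear T"
  proof (rule bounded_linear_intro)
    fix f g :: "'a lip0" and r :: real
    show "T (f + g) = T f + T g" "T (r *\<^sub>R f) = r *\<^sub>R T f"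
      by (rule lip0_eqI, simp add: app algebra_simps)+
    show "norm (T f) \<le> norm f * C"
      using h by (intro norm_lip0_le) (simp add: app lip_weight_def mult.commute)
  qed
  moreover have "weight_op h = Blinfun T" by (simp add: weight_op_def T_def[abs_def])
  ultimately show ?thesis by (simp add: bounded_linear_Blinfun_apply app)
qed

text \<open>The cutoff as a function of the radius, written as a clamped line: continuity is then
  evident, and the radius can be replaced by its extension to \<open>MR\<close>.\<close>

definition cutoff_profile :: "int \<Rightarrow> real \<Rightarrow> real"
  where "cutoff_profile n r = max 0 (min 1 (2 - 2 powi (- n) * r))"

lemma two_powi_minus: "2 powi (- n) * (2 powi n) = (1 :: real)"
  by (simp add: power_int_minus)

lemma cutoff_eq_profile: "cutoff n x = cutoff_profile n (dist x 0)"
proof -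
  let ?a = "2 powi (- n) :: real" and ?r = "dist x 0"
  have a: "0 < ?a" by simp
  have 1: "?r \<le> 2 powi n \<longleftrightarrow> ?a * ?r \<le> 1"
    using mult_le_cancel_left_pos[OF a, of ?r "2 powi n"] by (simp only: two_powi_minus)
  have "?a * 2 powi (n + 1) = 2"
    using two_powi_minus[of n] by (simp add: power_int_add)
  then have 2: "?r \<le> 2 powi (n + 1) \<longleftrightarrow> ?a * ?r \<le> 2"
    using mult_le_cancel_left_pos[OF a, of ?r "2 powi (n + 1)"] by simp
  show ?thesis unfolding cutoff_def cutoff_profile_def 1 2 by (auto simp: max_def min_def)
qed

lemma cutoff_profile_bounds: "0 \<le> cutoff_profile n r" "cutoff_profile n r \<le> 1"
  by (auto simp: cutoff_profile_def)

lemma cutoff_profile_continuous: "continuous_on A (cutoff_profile n)"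
  unfolding cutoff_profile_def by (intro continuous_intros)

lemma cutoff_profile_eq_1: "r \<le> 2 powi n \<Longrightarrow> cutoff_profile n r = 1"
  using mult_left_mono[of r "2 powi n" "2 powi (- n)"]
  by (simp add: cutoff_profile_def two_powi_minus)

lemma cutoff_profile_eq_0:
  assumes "2 powi (n + 1) \<le> r" shows "cutoff_profile n r = 0"
proof -
  have "2 powi (- n) * 2 powi (n + 1) = (2 :: real)"
    using two_powi_minus[of n] by (simp add: power_int_add)
  then have "2 \<le> 2 powi (- n) * r" using mult_left_mono[OF assms, of "2 powi (- n)"] by simp
  then show ?thesis by (simp add: cutoff_profile_def)
qed

lemma cutoff_lipschitz: "(2 powi (- n))-lipschitz_on UNIV (cutoff n)"
proof (rule lipschitz_onI)
  fix x y :: 'a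
  have "\<bar>cutoff_profile n (dist x 0) - cutoff_profile n (dist y 0)\<bar>
      \<le> \<bar>2 powi (- n) * dist x 0 - 2 powi (- n) * dist y 0\<bar>"
    by (auto simp: cutoff_profile_def max_def min_def)
  also have "\<dots> = 2 powi (- n) * \<bar>dist x 0 - dist y 0\<bar>"
    by (simp add: right_diff_distrib[symmetric] abs_mult)
  also have "\<dots> \<le> 2 powi (- n) * dist x y"
    by (intro mult_left_mono abs_dist_diff_right_le zero_le_power_int) simp
  finally show "dist (cutoff n x) (cutoff n y) \<le> 2 powi (- n) * dist x y"
    by (simp only: cutoff_eq_profile dist_real_def)
qed simp

lemma lip_weight_cutoff: "\<exists>C. lip_weight (cutoff n) C"
proof -
  have "lip_weight (cutoff n) (2 powi (n + 1) * 2 powi (- n) + 1)"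
    using cutoff_profile_bounds[of n]
    by (intro lip_weight_compact_support cutoff_lipschitz)
      (auto simp: cutoff_eq_profile cutoff_profile_eq_0)
  then show ?thesis by blast
qed

lemma weight_op_cutoff_apply [simp]:
  "lip_apply (weight_op (cutoff n) f) x = lip_apply f x * cutoff n x"
  "lip_apply (weight_op (\<lambda>x. 1 - cutoff n x) f) x = lip_apply f x * (1 - cutoff n x)"
  using lip_weight_cutoff[of n] lip_weight_compl by (blast intro: lip_apply_weight_op)+

lemma cutoff_profile_at_top: "((\<lambda>n. cutoff_profile n r) \<longlongrightarrow> 1) at_top"
proof -
  obtain m :: nat where m: "r < 2 ^ m"
    using real_arch_pow[of 2 r] by auto
  have "cutoff_profile n r = 1" if "int m \<le> n" for n
  proof (rule cutoff_profile_eq_1)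
    have "(2::real) powi (int m) \<le> 2 powi n" using that by (intro power_int_increasing) auto
    then show "r \<le> 2 powi n" using m by simp
  qed
  then have "eventually (\<lambda>n. cutoff_profile n r = 1) at_top" by (auto simp: eventually_at_top_linorder)
  then show ?thesis by (rule tendsto_eventually)
qed

lemma cutoff_profile_at_bot:
  assumes "0 < r"
  shows "((\<lambda>n. cutoff_profile (- n) r) \<longlongrightarrow> 0) at_top"
proof -
  obtain m :: nat where m: "(1/2) ^ m < r"
    using real_arch_pow_inv[OF assms, of "1/2"] by auto
  \<comment> \<open>The extra 1 compensates for the support of the cutoff, which reaches up to
    \<open>2 powi (- n + 1)\<close>.\<close>
  have "cutoff_profile (- n) r = 0" if "int m + 1 \<le> n" for n
  proof (rule cutoff_profile_eq_0)
    have "(2::real) powi (- n + 1) \<le> 2 powi (- int m)" using that by (intro power_int_increasing) auto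
    also have "\<dots> = (1/2) ^ m" by (simp add: power_int_minus power_divide field_simps)
    finally show "2 powi (- n + 1) \<le> r" using m by simp
  qed
  then have "eventually (\<lambda>n. cutoff_profile (- n) r = 0) at_top" by (auto simp: eventually_at_top_linorder)
  then show ?thesis by (rule tendsto_eventually)
qed

section \<open>Jordan decomposition of a majorisable functional\<close>

locale Jordan_pair =
  fixes \<phi> :: "'a::{metric_space, zero} lip0 \<Rightarrow>\<^sub>L real" and P N :: "'a lip0 \<Rightarrow> real"
  assumes P_linear: "linear P" and N_linear: "linear N"
    and P_nonneg: "\<And>f. lip_nonneg f \<Longrightarrow> 0 \<le> P f" and N_nonneg: "\<And>f. lip_nonneg f \<Longrightarrow> 0 \<le> N f"
    and \<phi>_eq: "\<And>f. blinfun_apply \<phi> f = P f - N f"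
    and orthogonal: "\<And>f e. lip_nonneg f \<Longrightarrow> 0 < e \<Longrightarrow>
      \<exists>g. lip_nonneg g \<and> lip_nonneg (f - g) \<and> P (f - g) + N g \<le> e"

text \<open>On nonnegative \<open>f\<close> the positive part is the Riesz-Kantorovich supremum of
  \<open>\<phi> g\<close> over \<open>0 \<le> g \<le> f\<close>, finite because
  \<open>\<phi>1 f\<close> bounds it. With \<open>N = P - \<phi>\<close> the cost
  \<open>P (f - g) + N g\<close> equals \<open>P f - \<phi> g\<close>. A nearly optimal
  \<open>g\<close> therefore shows that the lattice infimum of \<open>P\<close> and \<open>N\<close>
  is zero, which is the condition \<open>orthogonal\<close>.\<close>

lemma Jordan_decomposition:
  fixes \<phi> :: "'a::{metric_space, zero} lip0 \<Rightarrow>\<^sub>L real"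
  assumes "majorisable \<phi>"
  shows "\<exists>P N. Jordan_pair \<phi> P N"
proof -
  obtain \<phi>1 \<phi>2 where pos: "positive_functional \<phi>1" "positive_functional \<phi>2" and \<phi>: "\<phi> = \<phi>1 - \<phi>2"
    using assms by (auto simp: majorisable_def)
  define S where "S f = {blinfun_apply \<phi> g | g. lip_nonneg g \<and> lip_nonneg (f - g)}" for f
  define Q where "Q f = Sup (S f)" for f
  have bdd: "bdd_above (S f)" if "lip_nonneg f" for f
  proof (rule bdd_aboveI)
    fix t assume "t \<in> S f"
    then obtain g where g: "t = blinfun_apply \<phi> g" "lip_nonneg g" "lip_nonneg (f - g)"
      by (auto simp: S_def)
    have "0 \<le> blinfun_apply \<phi>1 (f - g)" "0 \<le> blinfun_apply \<phi>2 g"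
      using pos g(2,3) unfolding positive_functional_def by blast+
    then show "t \<le> blinfun_apply \<phi>1 f"
      unfolding g(1) \<phi> by (simp add: blinfun.diff_left blinfun.diff_right)
  qed
  have Q_upper: "blinfun_apply \<phi> g \<le> Q f" if "lip_nonneg g" "lip_nonneg (f - g)" for f g
  proof -
    have "lip_nonneg f" using that by (auto intro: order_trans)
    then show ?thesis unfolding Q_def using that by (intro cSup_upper bdd) (auto simp: S_def)
  qed
  have Q_least: "Q f \<le> c"
    if "lip_nonneg f" "\<And>g. lip_nonneg g \<Longrightarrow> lip_nonneg (f - g) \<Longrightarrow> blinfun_apply \<phi> g \<le> c" for f c
  proof -
    have "S f \<noteq> {}" using that(1) by (auto simp: S_def intro!: exI[of _ 0])
    then show ?thesis unfolding Q_def using that(2) by (intro cSup_least) (auto simp: S_def)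
  qed
  have Q0: "0 \<le> Q f" if "lip_nonneg f" for f
    using Q_upper[of 0 f] that by (simp add: blinfun.zero_right)
  have Q_add: "Q (f1 + f2) = Q f1 + Q f2" if f: "lip_nonneg f1" "lip_nonneg f2" for f1 f2
  proof (rule antisym)
    show "Q (f1 + f2) \<le> Q f1 + Q f2"
    proof (rule Q_least)
      fix g assume g: "lip_nonneg g" "lip_nonneg (f1 + f2 - g)"
      \<comment> \<open>Riesz decomposition: a function below \<open>f1 + f2\<close> is cut at
        \<open>f1\<close>, and the remainder lies between 0 and \<open>f2\<close>.\<close>
      have "blinfun_apply \<phi> (lip_min g f1) \<le> Q f1" using g f by (intro Q_upper) auto
      moreover have "blinfun_apply \<phi> (g - lip_min g f1) \<le> Q f2"
        using g f by (intro Q_upper) (auto simp: min_def algebra_simps)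
      ultimately show "blinfun_apply \<phi> g \<le> Q f1 + Q f2" by (simp add: blinfun.diff_right)
    qed (use f in auto)
    have "Q f1 \<le> Q (f1 + f2) - Q f2"
    proof (rule Q_least[OF f(1)])
      fix g1 assume g1: "lip_nonneg g1" "lip_nonneg (f1 - g1)"
      have "Q f2 \<le> Q (f1 + f2) - blinfun_apply \<phi> g1"
      proof (rule Q_least[OF f(2)])
        fix g2 assume g2: "lip_nonneg g2" "lip_nonneg (f2 - g2)"
        have "blinfun_apply \<phi> (g1 + g2) \<le> Q (f1 + f2)"
          using g1 g2 by (intro Q_upper) (auto intro: add_mono)
        then show "blinfun_apply \<phi> g2 \<le> Q (f1 + f2) - blinfun_apply \<phi> g1"
          by (simp add: blinfun.add_right)
      qed
      then show "blinfun_apply \<phi> g1 \<le> Q (f1 + f2) - Q f2" by simp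
    qed
    then show "Q f1 + Q f2 \<le> Q (f1 + f2)" by simp
  qed
  have Q_scale_le: "Q (c *\<^sub>R f) \<le> c * Q f" if f: "lip_nonneg f" and c: "0 < c" for c f
  proof (rule Q_least)
    fix g assume g: "lip_nonneg g" "lip_nonneg (c *\<^sub>R f - g)"
    have "blinfun_apply \<phi> (inverse c *\<^sub>R g) \<le> Q f"
    proof (rule Q_upper)
      show "lip_nonneg (f - inverse c *\<^sub>R g)"
        using g(2) c by (auto simp: field_simps)
    qed (use g(1) c in auto)
    then show "blinfun_apply \<phi> g \<le> c * Q f" using c by (simp add: blinfun.scaleR_right field_simps)
  qed (use f c in auto)
  have Q_scale: "Q (c *\<^sub>R f) = c * Q f" if f: "lip_nonneg f" and c: "0 \<le> c" for c f
  proof (cases "c = 0")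
    case True
    have "Q 0 = 0" using Q_add[of 0 0] by simp
    then show ?thesis using True by simp
  next
    case False
    then have c: "0 < c" using c by simp
    have "Q f \<le> inverse c * Q (c *\<^sub>R f)"
      using Q_scale_le[of "c *\<^sub>R f" "inverse c"] f c by simp
    then have "c * Q f \<le> Q (c *\<^sub>R f)" using c by (simp add: field_simps)
    then show ?thesis using Q_scale_le[OF f c] by simp
  qed
  \<comment> \<open>Adding \<open>norm f * rho\<close> makes any \<open>f\<close> nonnegative. By
    \<open>P_eq\<close> a larger multiple of \<open>rho\<close> gives the same value, so that two
    functions can be shifted together when proving additivity.\<close>
  define P where "P f = Q (f + norm f *\<^sub>R rho) - norm f * Q rho" for f
  have shift: "lip_nonneg (f + t *\<^sub>R rho)" if "norm f \<le> t" for f :: "'a lip0" and t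
  proof
    fix x :: 'a
    have "norm f * dist x 0 \<le> t * dist x 0" using that by (rule mult_right_mono) simp
    then show "0 \<le> lip_apply (f + t *\<^sub>R rho) x" using lip_apply_le[of f x] by simp
  qed
  have P_eq: "P f = Q (f + t *\<^sub>R rho) - t * Q rho" if "norm f \<le> t" for f t
  proof -
    have "Q (f + t *\<^sub>R rho) = Q ((f + norm f *\<^sub>R rho) + (t - norm f) *\<^sub>R rho)"
      by (simp add: algebra_simps)
    also have "\<dots> = Q (f + norm f *\<^sub>R rho) + (t - norm f) * Q rho"
      using that shift[of f "norm f"] by (subst Q_add) (auto simp: Q_scale)
    finally show ?thesis by (simp add: P_def algebra_simps)
  qed
  have P_add: "P (f + g) = P f + P g" for f g
  proof -
    have "P (f + g) = Q ((f + norm f *\<^sub>R rho) + (g + norm g *\<^sub>R rho)) - (norm f + norm g) * Q rho"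
      using P_eq[OF norm_triangle_ineq[of f g]] by (simp add: algebra_simps)
    also have "\<dots> = P f + P g"
      using shift[of f "norm f"] shift[of g "norm g"] by (subst Q_add) (auto simp: P_def algebra_simps)
    finally show ?thesis .
  qed
  have P_zero: "P 0 = 0" using P_add[of 0 0] by simp
  have P_minus: "P (- f) = - P f" for f using P_add[of f "- f"] P_zero by simp
  have P_scale_nonneg: "P (c *\<^sub>R f) = c * P f" if c: "0 \<le> c" for c f
  proof -
    have "P (c *\<^sub>R f) = Q (c *\<^sub>R (f + norm f *\<^sub>R rho)) - (c * norm f) * Q rho"
      using P_eq[of "c *\<^sub>R f" "c * norm f"] c by (simp add: algebra_simps)
    also have "\<dots> = c * P f"
      using shift[of f "norm f"] c by (subst Q_scale) (auto simp: P_def algebra_simps)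
    finally show ?thesis .
  qed
  have linP: "linear P"
  proof (rule linearI)
    show "P (c *\<^sub>R f) = c *\<^sub>R P f" for c f
      using P_scale_nonneg[of c f] P_scale_nonneg[of "- c" f] P_minus[of "c *\<^sub>R f"]
      by (cases "0 \<le> c") auto
  qed (rule P_add)
  have PQ: "P f = Q f" if "lip_nonneg f" for f
    unfolding P_def using that by (subst Q_add) (auto simp: Q_scale)
  define N where "N f = P f - blinfun_apply \<phi> f" for f
  have linN: "linear N"
    unfolding N_def using linP by (intro linear_compose_sub) (simp_all add: blinfun.bounded_linear_right bounded_linear.linear)
  have "Jordan_pair \<phi> P N"
  proof (rule Jordan_pair.intro[OF linP linN])
    fix f :: "'a lip0"
    show "blinfun_apply \<phi> f = P f - N f" by (simp add: N_def)
    assume f: "lip_nonneg f"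
    show "0 \<le> P f" using PQ[OF f] Q0[OF f] by simp
    show "0 \<le> N f" using PQ[OF f] Q_upper[of f f] f by (simp add: N_def)
    fix e :: real assume e: "0 < e"
    have "S f \<noteq> {}" using f by (auto simp: S_def intro!: exI[of _ 0])
    moreover have "P f - e < Sup (S f)" using PQ[OF f] e by (simp add: Q_def)
    ultimately obtain t where "t \<in> S f" "P f - e < t" using less_cSup_iff[OF _ bdd[OF f]] by blast
    then obtain g where g: "lip_nonneg g" "lip_nonneg (f - g)" "P f - e < blinfun_apply \<phi> g"
      by (auto simp: S_def)
    have "P (f - g) + N g \<le> e"
      using g(3) linear_diff[OF linP, of f g] by (simp add: N_def)
    then show "\<exists>g. lip_nonneg g \<and> lip_nonneg (f - g) \<and> P (f - g) + N g \<le> e"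
      using g by blast
  qed
  then show ?thesis by blast
qed

text \<open>A \<open>g \<le> rho\<close> that is nearly optimal for \<open>rho\<close> has
  \<open>\<phi> g\<close> close to \<open>P rho\<close>, while
  \<open>\<phi> (W i g) \<le> P (W i rho)\<close>. Convergence of \<open>\<phi> (W i g)\<close> to
  \<open>\<phi> g\<close> thus controls \<open>P (rho - W i rho)\<close>, and convergence at
  \<open>rho\<close> carries the estimate over to \<open>N\<close>, so no cancellation between the
  two parts can hide a loss of mass.\<close>

lemma (in Jordan_pair) parts_vanish:
  assumes W: "\<And>i f x. lip_apply (W i f) x = lip_apply f x * h i x"
    and h: "\<And>i x. 0 \<le> h i x \<and> h i x \<le> 1"
    and lim: "\<And>f. ((\<lambda>i. blinfun_apply \<phi> (W i f)) \<longlongrightarrow> blinfun_apply \<phi> f) F"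
  shows "((\<lambda>i. P (rho - W i rho) + N (rho - W i rho)) \<longlongrightarrow> 0) F"
proof (rule tendstoI)
  fix e :: real assume "0 < e"
  \<comment> \<open>The estimates below are \<open>2 * d\<close> for \<open>P\<close> and
    \<open>3 * d\<close> for \<open>N\<close>, together less than \<open>6 * d\<close>.\<close>
  define d where "d = e / 6"
  have d: "0 < d" using \<open>0 < e\<close> by (simp add: d_def)
  obtain g where g: "lip_nonneg g" "lip_nonneg (rho - g)" "P (rho - g) + N g \<le> d"
    using orthogonal[of rho d] d by auto
  have ev: "eventually (\<lambda>i. dist (blinfun_apply \<phi> (W i f)) (blinfun_apply \<phi> f) < d) F" for f
    using lim d by (rule tendstoD)
  show "eventually (\<lambda>i. dist (P (rho - W i rho) + N (rho - W i rho)) 0 < e) F"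
    using ev[of g] ev[of rho]
  proof eventually_elim
    case (elim i)
    have nn: "lip_nonneg (rho - W i rho)" "lip_nonneg (W i rho - W i g)" "lip_nonneg (W i g)"
      using h g(1,2) by (auto simp: W left_diff_distrib[symmetric] mult_left_le)
    have "P (W i g) \<le> P (W i rho)"
      using P_nonneg[OF nn(2)] linear_diff[OF P_linear] by simp
    moreover have "0 \<le> N (W i g)" by (rule N_nonneg[OF nn(3)])
    moreover have "P rho - P g + N g \<le> d" using g(3) linear_diff[OF P_linear] by simp
    ultimately have "P rho - P (W i rho) \<le> 2 * d"
      using elim(1) \<phi>_eq[of "W i g"] \<phi>_eq[of g] by (simp add: dist_real_def)
    then have "P (rho - W i rho) \<le> 2 * d" using linear_diff[OF P_linear] by simp
    moreover have "N (rho - W i rho) \<le> P (rho - W i rho) + d"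
      using elim(2) \<phi>_eq[of "W i rho"] \<phi>_eq[of rho] linear_diff[OF P_linear] linear_diff[OF N_linear]
      by (simp add: dist_real_def)
    moreover have "0 \<le> P (rho - W i rho)" "0 \<le> N (rho - W i rho)"
      using P_nonneg[OF nn(1)] N_nonneg[OF nn(1)] by auto
    ultimately show ?case using d by (simp add: dist_real_def d_def)
  qed
qed

section \<open>From representations to functionals\<close>

lemma lip_apply_rho_fun: "lip_apply rho = (\<lambda>x. dist x 0)"
  by (rule ext) simp

abbreviation lipR :: "'a::{metric_space, zero} lip0 \<Rightarrow> 'a cpt \<Rightarrow> real"
  where "lipR f \<equiv> extR (lip_apply f)"

abbreviation val1 :: "'a::{metric_space, zero} lip0 \<Rightarrow> ('a \<times> 'a) cpt \<Rightarrow> real"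
  where "val1 f \<zeta> \<equiv> extR (lip_apply f) (coord1 \<zeta>)"

abbreviation val2 :: "'a::{metric_space, zero} lip0 \<Rightarrow> ('a \<times> 'a) cpt \<Rightarrow> real"
  where "val2 f \<zeta> \<equiv> extR (lip_apply f) (coord2 \<zeta>)"

lemma MR_setD:
  "\<xi> \<in> MR_set \<Longrightarrow> \<xi> \<in> topspace MU"
  "\<xi> \<in> MR_set \<Longrightarrow> extU (lip_apply rho) \<xi> < \<infinity>"
  by (simp_all add: MR_set_def lip_apply_rho_fun)

lemma extU_lip0_tendsto:
  "\<xi> \<in> topspace MU \<Longrightarrow> ((\<lambda>x. ereal (lip_apply f x)) \<longlongrightarrow> extU (lip_apply f) \<xi>) (filterU \<xi>)"
  by (rule extU_tendsto[OF lip_apply_lipschitz])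

lemma extU_rho_nonneg:
  assumes "\<xi> \<in> topspace MU"
  shows "0 \<le> extU (lip_apply rho) \<xi>"
  by (rule tendsto_lowerbound[OF extU_lip0_tendsto[OF assms] _ filterU_nontrivial[OF assms]]) simp

text \<open>Near a point of \<open>MR\<close> the function \<open>rho\<close> stays below some
  \<open>r + 1\<close>, and \<open>|f| \<le> norm f * rho\<close>, so the extended value lies
  between finite bounds.\<close>

lemma extU_lip0_real:
  assumes \<xi>: "\<xi> \<in> MR_set"
  shows "extU (lip_apply f) \<xi> = ereal (lipR f \<xi>)"
proof -
  note top = MR_setD(1)[OF \<xi>]
  obtain r where r: "extU (lip_apply rho) \<xi> = ereal r"
    using extU_rho_nonneg[OF top] MR_setD(2)[OF \<xi>] by (cases "extU (lip_apply rho) \<xi>") auto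
  have "((\<lambda>x. lip_apply rho x) \<longlongrightarrow> r) (filterU \<xi>)"
    using extU_lip0_tendsto[OF top, of rho] unfolding r by simp
  then have ev: "eventually (\<lambda>x. lip_apply rho x < r + 1) (filterU \<xi>)"
    by (rule order_tendstoD) simp
  have "eventually (\<lambda>x. \<bar>lip_apply f x\<bar> \<le> norm f * (r + 1)) (filterU \<xi>)"
    using ev
  proof eventually_elim
    case (elim x)
    then have "norm f * dist x 0 \<le> norm f * (r + 1)" by (intro mult_left_mono) auto
    then show ?case using lip_apply_le[of f x] by linarith
  qed
  then have "eventually (\<lambda>x. ereal (lip_apply f x) \<le> ereal (norm f * (r + 1))) (filterU \<xi>)"
    "eventually (\<lambda>x. ereal (- (norm f * (r + 1))) \<le> ereal (lip_apply f x)) (filterU \<xi>)"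
    by (eventually_elim, simp)+
  then have "extU (lip_apply f) \<xi> \<le> ereal (norm f * (r + 1))"
    "ereal (- (norm f * (r + 1))) \<le> extU (lip_apply f) \<xi>"
    using tendsto_upperbound[OF extU_lip0_tendsto[OF top] _ filterU_nontrivial[OF top]]
      tendsto_lowerbound[OF extU_lip0_tendsto[OF top] _ filterU_nontrivial[OF top]] by blast+
  then show ?thesis unfolding extR_def by (cases "extU (lip_apply f) \<xi>") auto
qed

lemma extR_tendsto:
  assumes "\<xi> \<in> MR_set"
  shows "(lip_apply f \<longlongrightarrow> lipR f \<xi>) (filterU \<xi>)"
  using extU_lip0_tendsto[OF MR_setD(1)[OF assms], of f] by (simp add: extU_lip0_real[OF assms])

lemma extR_coord_tendsto:
  assumes "\<zeta> \<in> topspace betaM"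
  shows "coord1 \<zeta> \<in> MR_set \<Longrightarrow>
      ((\<lambda>z. lip_apply f (fst z)) \<longlongrightarrow> val1 f \<zeta>) (filterB \<zeta>)"
    and "coord2 \<zeta> \<in> MR_set \<Longrightarrow>
      ((\<lambda>z. lip_apply f (snd z)) \<longlongrightarrow> val2 f \<zeta>) (filterB \<zeta>)"
  using extU_coord_tendsto[OF lip_apply_lipschitz assms, of f] by (simp_all add: extU_lip0_real)

lemma iotaU_MR: "iotaU x \<in> MR_set"
proof -
  have "extU (\<lambda>y. dist y 0) (iotaU x) = ereal (dist x 0)"
    by (rule extU_iotaU[OF dist_base_lipschitz])
  then show ?thesis by (simp add: MR_set_def MU_def compact_embed_topspace)
qed

lemma extR_iotaU: "lipR f (iotaU x) = lip_apply f x"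
  by (simp add: extR_def extU_iotaU[OF lip_apply_lipschitz])

lemma extR_nonneg:
  assumes "\<xi> \<in> MR_set" "lip_nonneg f"
  shows "0 \<le> lipR f \<xi>"
  by (rule tendsto_lowerbound[OF extR_tendsto[OF assms(1)] _ filterU_nontrivial[OF MR_setD(1)[OF assms(1)]]])
    (use assms(2) in simp)

lemma extR_abs_le:
  assumes "\<xi> \<in> MR_set"
  shows "\<bar>lipR f \<xi>\<bar> \<le> norm f * lipR rho \<xi>"
proof (rule tendsto_le[OF filterU_nontrivial[OF MR_setD(1)[OF assms]]])
  show "((\<lambda>x. norm f * lip_apply rho x) \<longlongrightarrow> norm f * lipR rho \<xi>) (filterU \<xi>)"
    by (intro tendsto_intros extR_tendsto assms)
  show "((\<lambda>x. \<bar>lip_apply f x\<bar>) \<longlongrightarrow> \<bar>lipR f \<xi>\<bar>) (filterU \<xi>)"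
    by (intro tendsto_intros extR_tendsto assms)
  show "\<forall>\<^sub>F x in filterU \<xi>. \<bar>lip_apply f x\<bar> \<le> norm f * lip_apply rho x"
    by (simp add: lip_apply_le)
qed

lemma extR_add:
  assumes "\<xi> \<in> MR_set"
  shows "lipR (f + g) \<xi> = lipR f \<xi> + lipR g \<xi>"
proof (rule tendsto_unique[OF filterU_nontrivial[OF MR_setD(1)[OF assms]] extR_tendsto[OF assms]])
  show "(lip_apply (f + g) \<longlongrightarrow> lipR f \<xi> + lipR g \<xi>) (filterU \<xi>)"
    using tendsto_add[OF extR_tendsto[OF assms, of f] extR_tendsto[OF assms, of g]]
    by (rule Lim_transform_eventually) simp
qed

lemma extR_scaleR:
  assumes "\<xi> \<in> MR_set"
  shows "lipR (c *\<^sub>R f) \<xi> = c * lipR f \<xi>"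
proof (rule tendsto_unique[OF filterU_nontrivial[OF MR_setD(1)[OF assms]] extR_tendsto[OF assms]])
  show "(lip_apply (c *\<^sub>R f) \<longlongrightarrow> c * lipR f \<xi>) (filterU \<xi>)"
    using tendsto_mult_left[OF extR_tendsto[OF assms, of f], of c]
    by (rule Lim_transform_eventually) simp
qed

lemma extR_mult_profile:
  assumes \<xi>: "\<xi> \<in> MR_set" and k: "continuous_on UNIV k"
    and u: "\<And>x. lip_apply u x = lip_apply f x * k (dist x 0)"
  shows "lipR u \<xi> = lipR f \<xi> * k (lipR rho \<xi>)"
proof (rule tendsto_unique[OF filterU_nontrivial[OF MR_setD(1)[OF \<xi>]] extR_tendsto[OF \<xi>]])
  have "isCont k (lipR rho \<xi>)"
    using k by (simp add: continuous_on_eq_continuous_at)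
  from isCont_tendsto_compose[OF this extR_tendsto[OF \<xi>, of rho]]
  have "((\<lambda>x. k (dist x 0)) \<longlongrightarrow> k (lipR rho \<xi>)) (filterU \<xi>)" by simp
  from tendsto_mult[OF extR_tendsto[OF \<xi>, of f] this]
  show "(lip_apply u \<longlongrightarrow> lipR f \<xi> * k (lipR rho \<xi>)) (filterU \<xi>)"
    by (rule Lim_transform_eventually) (simp add: u)
qed

text \<open>The functional at the base point is zero. The inequality
  \<open>|f| \<le> norm f * rho\<close> extends to \<open>\<xi>\<close> and bounds the norm of
  \<open>delta \<xi>\<close> from above; testing on \<open>rho\<close>, of norm at most 1, bounds it
  from below. The weight in the moment condition is thus the extension of
  \<open>rho\<close>.\<close>

lemma dbar_base:
  assumes \<xi>: "\<xi> \<in> MR_set"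
  shows "dbar \<xi> (iotaU 0) = lipR rho \<xi>"
proof -
  have bl: "bounded_linear (\<lambda>f. lipR f \<eta>)" if "\<eta> \<in> MR_set" for \<eta> :: "'a cpt"
    using extR_add[OF that] extR_scaleR[OF that] extR_abs_le[OF that]
    by (intro bounded_linear_intro[where K = "lipR rho \<eta>"]) auto
  have app: "blinfun_apply (delta \<eta>) f = lipR f \<eta>" if "\<eta> \<in> MR_set" for \<eta> :: "'a cpt" and f
    unfolding delta_def by (simp add: bounded_linear_Blinfun_apply[OF bl[OF that]])
  have "delta (iotaU 0) = (0 :: 'a lip0 \<Rightarrow>\<^sub>L real)"
    by (rule blinfun_eqI) (simp add: app[OF iotaU_MR] extR_iotaU blinfun.zero_left)
  then have eq: "dbar \<xi> (iotaU 0) = norm (delta \<xi>)" by (simp add: dbar_def)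
  have r0: "0 \<le> lipR rho \<xi>" by (rule extR_nonneg[OF \<xi>]) simp
  have "norm (delta \<xi>) \<le> lipR rho \<xi>"
    using extR_abs_le[OF \<xi>] by (intro norm_blinfun_bound r0) (simp add: app[OF \<xi>] mult.commute)
  moreover have "lipR rho \<xi> \<le> norm (delta \<xi>)"
  proof -
    have "norm (blinfun_apply (delta \<xi>) rho) \<le> norm (delta \<xi>) * norm (rho :: 'a lip0)"
      by (rule norm_blinfun)
    also have "\<dots> \<le> norm (delta \<xi>) * 1" by (intro mult_left_mono norm_rho_le) simp
    finally show ?thesis using app[OF \<xi>, of rho] by simp
  qed
  ultimately show ?thesis unfolding eq by simp
qed

section \<open>The de Leeuw transform and the distance on the compactification\<close>

lemma quotient_bdd_cont:
  fixes f :: "'a::{metric_space, zero} lip0"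
  shows "(\<lambda>(x, y). (lip_apply f x - lip_apply f y) / dist x y) \<in> bdd_cont"
proof (rule bdd_contI[where B = "norm f"])
  have c: "continuous_on UNIV (lip_apply f)"
    by (rule lipschitz_on_continuous_on[OF lip_apply_lipschitz])
  show "continuous_on Mtilde (\<lambda>(x, y). (lip_apply f x - lip_apply f y) / dist x y)"
    unfolding case_prod_beta
    by (intro continuous_intros continuous_on_compose2[OF c]) (auto simp: Mtilde_def)
  show "\<bar>(\<lambda>(x, y). (lip_apply f x - lip_apply f y) / dist x y) z\<bar> \<le> norm f" if "z \<in> Mtilde" for z
    using that lip_apply_diff_le[of f "fst z" "snd z"]
    by (auto simp: Mtilde_def divide_le_eq abs_divide)
qed

lemma de_Leeuw_coordinate:
  fixes f :: "'a::{metric_space, zero} lip0"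
  shows de_Leeuw_continuous: "continuous_map betaM euclideanreal (de_Leeuw f)"
    and de_Leeuw_eq: "\<zeta> \<in> topspace betaM \<Longrightarrow>
      de_Leeuw f \<zeta> = \<zeta> (\<lambda>(x, y). (lip_apply f x - lip_apply f y) / dist x y)"
proof -
  note c = continuous_map_coordinate[OF quotient_bdd_cont[of f]]
  show "continuous_map betaM euclideanreal (de_Leeuw f)"
    unfolding de_Leeuw_def betaM_def
    by (rule cont_extension(1)[OF Hausdorff_euclidean c]) (simp add: quotient_bdd_cont)
  show "de_Leeuw f \<zeta> = \<zeta> (\<lambda>(x, y). (lip_apply f x - lip_apply f y) / dist x y)"
    if "\<zeta> \<in> topspace betaM"
    using that unfolding de_Leeuw_def betaM_def
    by (intro cont_extension(2)[OF Hausdorff_euclidean c]) (simp_all add: quotient_bdd_cont)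
qed

lemma de_Leeuw_tendsto:
  assumes "\<zeta> \<in> topspace betaM"
  shows "((\<lambda>z. (lip_apply f (fst z) - lip_apply f (snd z)) / dist (fst z) (snd z)) \<longlongrightarrow> de_Leeuw f \<zeta>) (filterB \<zeta>)"
  using filterB_coordinate[OF assms quotient_bdd_cont[of f]] de_Leeuw_eq[OF assms, of f]
  by (simp add: case_prod_beta')

lemma de_Leeuw_linear:
  assumes z: "\<zeta> \<in> topspace betaM"
  shows "de_Leeuw (f + g) \<zeta> = de_Leeuw f \<zeta> + de_Leeuw g \<zeta>"
    "de_Leeuw (c *\<^sub>R f) \<zeta> = c * de_Leeuw f \<zeta>"
    "\<bar>de_Leeuw f \<zeta>\<bar> \<le> norm f"
proof -
  note nt = filterB_nontrivial[OF z]
  show "de_Leeuw (f + g) \<zeta> = de_Leeuw f \<zeta> + de_Leeuw g \<zeta>"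
    by (rule tendsto_unique[OF nt de_Leeuw_tendsto[OF z]])
      (use tendsto_add[OF de_Leeuw_tendsto[OF z, of f] de_Leeuw_tendsto[OF z, of g]] in
        \<open>simp add: add_divide_distrib[symmetric] algebra_simps\<close>)
  show "de_Leeuw (c *\<^sub>R f) \<zeta> = c * de_Leeuw f \<zeta>"
    by (rule tendsto_unique[OF nt de_Leeuw_tendsto[OF z]])
      (use tendsto_mult_left[OF de_Leeuw_tendsto[OF z, of f], of c] in
        \<open>simp add: right_diff_distrib[symmetric]\<close>)
  have "((\<lambda>z. \<bar>(lip_apply f (fst z) - lip_apply f (snd z)) / dist (fst z) (snd z)\<bar>) \<longlongrightarrow> \<bar>de_Leeuw f \<zeta>\<bar>) (filterB \<zeta>)"
    by (intro tendsto_intros de_Leeuw_tendsto z)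
  then show "\<bar>de_Leeuw f \<zeta>\<bar> \<le> norm f"
  proof (rule tendsto_upperbound[OF _ _ nt])
    show "\<forall>\<^sub>F z in filterB \<zeta>. \<bar>(lip_apply f (fst z) - lip_apply f (snd z)) / dist (fst z) (snd z)\<bar> \<le> norm f"
      using filterB_distinct[OF z]
      by eventually_elim (simp add: abs_divide divide_le_eq lip_apply_diff_le)
  qed
qed

text \<open>\<open>enn2real\<close> sends infinity to 0, so the value is the true distance only
  where \<open>dist_ext\<close> is finite, in particular where both coordinates lie in
  \<open>MR\<close>.\<close>

definition pair_dist :: "('a::metric_space \<times> 'a) cpt \<Rightarrow> real"
  where "pair_dist \<zeta> = enn2real (dist_ext \<zeta>)"

lemma pair_dist_finite:
  fixes \<zeta> :: "('a::{metric_space, zero} \<times> 'a) cpt"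
  assumes z: "\<zeta> \<in> topspace betaM" and p: "coord1 \<zeta> \<in> MR_set" "coord2 \<zeta> \<in> MR_set"
  shows "dist_ext \<zeta> = ennreal (pair_dist \<zeta>)"
    and "((\<lambda>z. dist (fst z) (snd z)) \<longlongrightarrow> pair_dist \<zeta>) (filterB \<zeta>)"
    and "0 \<le> pair_dist \<zeta>"
proof -
  let ?r1 = "val1 rho \<zeta>" and ?r2 = "val2 rho \<zeta>"
  have "eventually (\<lambda>z. lip_apply rho (fst z) < ?r1 + 1) (filterB \<zeta>)"
    by (rule order_tendstoD[OF extR_coord_tendsto(1)[OF z p(1)]]) simp
  moreover have "eventually (\<lambda>z. lip_apply rho (snd z) < ?r2 + 1) (filterB \<zeta>)"
    by (rule order_tendstoD[OF extR_coord_tendsto(2)[OF z p(2)]]) simp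
  ultimately have "eventually (\<lambda>z. ennreal (dist (fst z) (snd z)) \<le> ennreal (?r1 + ?r2 + 2)) (filterB \<zeta>)"
  proof eventually_elim
    case (elim z)
    then show ?case using dist_triangle2[of "fst z" "snd z" 0] by (intro ennreal_leI) simp
  qed
  then have "dist_ext \<zeta> \<le> ennreal (?r1 + ?r2 + 2)"
    by (rule tendsto_upperbound[OF dist_ext_extends(2)[OF z] _ filterB_nontrivial[OF z]])
  then have fin: "dist_ext \<zeta> < top" by (simp add: order_le_less_trans)
  then show eq: "dist_ext \<zeta> = ennreal (pair_dist \<zeta>)" by (simp add: pair_dist_def)
  show nn: "0 \<le> pair_dist \<zeta>" by (simp add: pair_dist_def)
  show "((\<lambda>z. dist (fst z) (snd z)) \<longlongrightarrow> pair_dist \<zeta>) (filterB \<zeta>)"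
    using tendsto_enn2real[OF dist_ext_extends(2)[OF z, unfolded eq] nn] by simp
qed

lemma topspace_MU_eqI:
  assumes "\<xi> \<in> topspace MU" "\<eta> \<in> topspace MU" "\<And>g. g \<in> bdd_unif_cont \<Longrightarrow> \<xi> g = \<eta> g"
  shows "\<xi> = \<eta>"
proof -
  have "topspace MU \<subseteq> extensional bdd_unif_cont"
    by (auto simp: MU_def compactification_def PiE_def)
  then show ?thesis using assms by (intro extensionalityI[of \<xi> bdd_unif_cont]) auto
qed

lemma coord_topspace:
  "\<zeta> \<in> topspace betaM \<Longrightarrow> coord1 \<zeta> \<in> topspace MU"
  "\<zeta> \<in> topspace betaM \<Longrightarrow> coord2 \<zeta> \<in> topspace MU"
  using coord1_continuous coord2_continuous by (auto simp: continuous_map_def)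

text \<open>A point of \<open>MU\<close> is determined by its values at uniformly continuous
  functions, and these cannot distinguish the two entries of a pair whose distance tends to 0.
  Contrapositively, the distance is positive on \<open>Rplus\<close>.\<close>

lemma coord_eq_if_dist_tendsto_0:
  assumes z: "\<zeta> \<in> topspace betaM" and d: "((\<lambda>z. dist (fst z) (snd z)) \<longlongrightarrow> 0) (filterB \<zeta>)"
  shows "coord1 \<zeta> = coord2 \<zeta>"
proof (rule topspace_MU_eqI[OF coord_topspace[OF z]])
  fix g :: "'a \<Rightarrow> real" assume g: "g \<in> bdd_unif_cont"
  have "((\<lambda>z. g (fst z) - g (snd z)) \<longlongrightarrow> 0) (filterB \<zeta>)"
  proof (rule tendstoI)
    fix e :: real assume "0 < e"
    then obtain s where s: "0 < s" "\<And>x y. dist x y < s \<Longrightarrow> dist (g x) (g y) < e"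
      using g unfolding bdd_unif_cont_def uniformly_continuous_on_def by auto
    have "eventually (\<lambda>z. dist (fst z) (snd z) < s) (filterB \<zeta>)"
      using order_tendstoD(2)[OF d s(1)] .
    then show "eventually (\<lambda>z. dist (g (fst z) - g (snd z)) 0 < e) (filterB \<zeta>)"
      by eventually_elim (use s(2) in \<open>simp add: dist_real_def\<close>)
  qed
  from tendsto_unique[OF filterB_nontrivial[OF z] this
      tendsto_diff[OF coord_coordinate_tendsto(1)[OF z g] coord_coordinate_tendsto(2)[OF z g]]]
  show "coord1 \<zeta> g = coord2 \<zeta> g" by simp
qed

lemma RplusD:
  assumes "\<zeta> \<in> Rplus"
  shows "\<zeta> \<in> topspace betaM" "coord1 \<zeta> \<in> MR_set" "coord2 \<zeta> \<in> MR_set" "coord1 \<zeta> \<noteq> coord2 \<zeta>"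
  using assms by (auto simp: Rplus_def)

lemma pair_dist_pos:
  assumes "\<zeta> \<in> Rplus"
  shows "0 < pair_dist \<zeta>"
  using pair_dist_finite(2,3)[OF RplusD(1-3)[OF assms]] coord_eq_if_dist_tendsto_0[OF RplusD(1)[OF assms]]
    RplusD(4)[OF assms] by (cases "pair_dist \<zeta> = 0") auto

lemma de_Leeuw_Rplus:
  assumes z: "\<zeta> \<in> Rplus"
  shows "de_Leeuw f \<zeta> = (val1 f \<zeta> - val2 f \<zeta>) / pair_dist \<zeta>"
proof (rule tendsto_unique[OF filterB_nontrivial[OF RplusD(1)[OF z]] de_Leeuw_tendsto[OF RplusD(1)[OF z]]])
  show "((\<lambda>z. (lip_apply f (fst z) - lip_apply f (snd z)) / dist (fst z) (snd z)) \<longlongrightarrow>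
     (val1 f \<zeta> - val2 f \<zeta>) / pair_dist \<zeta>) (filterB \<zeta>)"
    using RplusD[OF z] pair_dist_pos[OF z]
    by (intro tendsto_intros extR_coord_tendsto pair_dist_finite) auto
qed

lemma extR_rho_coord2_le:
  assumes z: "\<zeta> \<in> topspace betaM" and p: "coord1 \<zeta> \<in> MR_set" "coord2 \<zeta> \<in> MR_set"
  shows "val2 rho \<zeta> \<le> val1 rho \<zeta> + pair_dist \<zeta>"
proof (rule tendsto_le[OF filterB_nontrivial[OF z]])
  show "((\<lambda>z. lip_apply rho (fst z) + dist (fst z) (snd z)) \<longlongrightarrow> val1 rho \<zeta> + pair_dist \<zeta>) (filterB \<zeta>)"
    by (intro tendsto_intros extR_coord_tendsto pair_dist_finite z p)
  show "((\<lambda>z. lip_apply rho (snd z)) \<longlongrightarrow> val2 rho \<zeta>) (filterB \<zeta>)"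
    by (intro extR_coord_tendsto z p)
  show "\<forall>\<^sub>F z in filterB \<zeta>. lip_apply rho (snd z) \<le> lip_apply rho (fst z) + dist (fst z) (snd z)"
    by (rule always_eventually) (simp add: dist_commute dist_triangle add.commute)
qed

lemma openin_MR_set: "openin MU (MR_set :: 'a::{metric_space, zero} cpt set)"
proof -
  have "openin MU {\<xi> \<in> topspace MU. extU (\<lambda>x::'a. dist x 0) \<xi> \<in> {..<\<infinity>}}"
    by (rule openin_continuous_map_preimage[OF extU_continuous[OF dist_base_lipschitz]]) simp
  then show ?thesis by (simp add: MR_set_def)
qed

text \<open>\<open>MR_set\<close> is an open sublevel set, and the coincidence set of two continuous
  maps into a Hausdorff space is closed. Openness makes \<open>Rplus\<close> Borel.\<close>

lemma openin_Rplus: "openin betaM (Rplus :: ('a::{metric_space, zero} \<times> 'a) cpt set)"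
proof -
  have "openin betaM {\<zeta> \<in> topspace betaM. coord1 \<zeta> \<in> (MR_set :: 'a cpt set)}"
    "openin betaM {\<zeta> \<in> topspace betaM. coord2 \<zeta> \<in> (MR_set :: 'a cpt set)}"
    using openin_MR_set coord1_continuous coord2_continuous
    by (auto intro: openin_continuous_map_preimage)
  moreover have "closedin betaM {\<zeta> \<in> topspace betaM. coord1 \<zeta> = (coord2 \<zeta> :: 'a cpt)}"
    by (rule closedin_continuous_maps_eq[OF Hausdorff_MU coord1_continuous coord2_continuous])
  ultimately have "openin betaM (({\<zeta> \<in> topspace betaM. coord1 \<zeta> \<in> (MR_set :: 'a cpt set)} \<inter>
      {\<zeta> \<in> topspace betaM. coord2 \<zeta> \<in> (MR_set :: 'a cpt set)}) -
      {\<zeta> \<in> topspace betaM. coord1 \<zeta> = (coord2 \<zeta> :: 'a cpt)})"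
    by (intro openin_diff openin_Int)
  moreover have "\<dots> = Rplus" by (auto simp: Rplus_def)
  ultimately show ?thesis by simp
qed

section \<open>Measurability and the adjoint of the de Leeuw transform\<close>

lemma extR_coord_measurable:
  fixes f :: "'a::{metric_space, zero} lip0"
  assumes "sets \<mu> = sets (borel_of_top betaM)"
  shows "(\<lambda>\<zeta>. val1 f \<zeta>) \<in> borel_measurable \<mu>"
    "(\<lambda>\<zeta>. val2 f \<zeta>) \<in> borel_measurable \<mu>"
proof -
  have "(extU (lip_apply f) \<circ> coord1) \<in> borel_measurable \<mu>" "(extU (lip_apply f) \<circ> coord2) \<in> borel_measurable \<mu>"
    using continuous_map_compose[OF coord1_continuous extU_continuous[OF lip_apply_lipschitz[of f]]]
      continuous_map_compose[OF coord2_continuous extU_continuous[OF lip_apply_lipschitz[of f]]] assms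
    by (auto intro: continuous_map_measurable)
  then show "(\<lambda>\<zeta>. val1 f \<zeta>) \<in> borel_measurable \<mu>"
    "(\<lambda>\<zeta>. val2 f \<zeta>) \<in> borel_measurable \<mu>"
    unfolding extR_def by (auto simp: comp_def)
qed

lemma pair_dist_measurable:
  assumes "sets \<mu> = sets (borel_of_top betaM)"
  shows "pair_dist \<in> borel_measurable \<mu>"
  using continuous_map_measurable[OF dist_ext_extends(1) assms] unfolding pair_dist_def[abs_def] by simp

lemma abs_integral_le_AE:
  fixes f g :: "'b \<Rightarrow> real"
  assumes "integrable M f" "integrable M g" "AE x in M. \<bar>f x\<bar> \<le> g x"
  shows "\<bar>integral\<^sup>L M f\<bar> \<le> integral\<^sup>L M g"
proof -
  have "\<bar>integral\<^sup>L M f\<bar> \<le> (\<integral>x. \<bar>f x\<bar> \<partial>M)" by (rule integral_abs_bound)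
  also have "\<dots> \<le> integral\<^sup>L M g" using assms by (intro integral_mono_AE) auto
  finally show ?thesis .
qed

lemma de_Leeuw_integrable:
  assumes "sets \<mu> = sets (borel_of_top betaM)" "finite_measure \<mu>"
  shows "integrable \<mu> (de_Leeuw f)"
proof -
  interpret finite_measure \<mu> by fact
  show ?thesis
    using de_Leeuw_linear(3)[of _ f] sets_eq_imp_space_eq[OF assms(1)]
      continuous_map_measurable[OF de_Leeuw_continuous assms(1)]
    by (intro integrable_const_bound[where B = "norm f"]) auto
qed

lemma de_Leeuw_adj_apply:
  assumes "sets \<mu> = sets (borel_of_top betaM)" "finite_measure \<mu>"
  shows "blinfun_apply (de_Leeuw_adj \<mu>) f = (\<integral>\<zeta>. de_Leeuw f \<zeta> \<partial>\<mu>)"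
proof -
  interpret finite_measure \<mu> by fact
  note int = de_Leeuw_integrable[OF assms]
  have sp: "space \<mu> = topspace betaM" using sets_eq_imp_space_eq[OF assms(1)] by simp
  have "bounded_linear (\<lambda>f. \<integral>\<zeta>. de_Leeuw f \<zeta> \<partial>\<mu>)"
  proof (rule bounded_linear_intro)
    fix f g :: "'a lip0" and c :: real
    have "(\<integral>\<zeta>. de_Leeuw (f + g) \<zeta> \<partial>\<mu>) = (\<integral>\<zeta>. de_Leeuw f \<zeta> + de_Leeuw g \<zeta> \<partial>\<mu>)"
      by (rule Bochner_Integration.integral_cong) (auto simp: sp de_Leeuw_linear)
    then show "(\<integral>\<zeta>. de_Leeuw (f + g) \<zeta> \<partial>\<mu>) = (\<integral>\<zeta>. de_Leeuw f \<zeta> \<partial>\<mu>) + (\<integral>\<zeta>. de_Leeuw g \<zeta> \<partial>\<mu>)"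
      using int by simp
    have "(\<integral>\<zeta>. de_Leeuw (c *\<^sub>R f) \<zeta> \<partial>\<mu>) = (\<integral>\<zeta>. c * de_Leeuw f \<zeta> \<partial>\<mu>)"
      by (rule Bochner_Integration.integral_cong) (auto simp: sp de_Leeuw_linear)
    then show "(\<integral>\<zeta>. de_Leeuw (c *\<^sub>R f) \<zeta> \<partial>\<mu>) = c *\<^sub>R (\<integral>\<zeta>. de_Leeuw f \<zeta> \<partial>\<mu>)" by simp
    have "norm (\<integral>\<zeta>. de_Leeuw f \<zeta> \<partial>\<mu>) \<le> (\<integral>\<zeta>. norm f \<partial>\<mu>)"
      unfolding real_norm_def by (rule abs_integral_le_AE) (auto simp: sp de_Leeuw_linear int)
    then show "norm (\<integral>\<zeta>. de_Leeuw f \<zeta> \<partial>\<mu>) \<le> norm f * measure \<mu> (space \<mu>)"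
      by (simp add: mult.commute)
  qed
  then show ?thesis unfolding de_Leeuw_adj_def by (simp add: bounded_linear_Blinfun_apply)
qed
text \<open>Dominated convergence speaks of sequences, while the cutoffs are indexed by integers; a
  limit at \<open>at_top\<close> only involves nonnegative integers.\<close>

lemma tendsto_int_at_top:
  assumes "((\<lambda>n. f (int n)) \<longlongrightarrow> l) sequentially"
  shows "(f \<longlongrightarrow> l) at_top"
proof (rule topological_tendstoI)
  fix S assume "open S" "l \<in> S"
  then have "eventually (\<lambda>n. f (int n) \<in> S) sequentially" by (rule topological_tendstoD[OF assms])
  then obtain N where N: "\<And>n. N \<le> n \<Longrightarrow> f (int n) \<in> S" by (auto simp: eventually_sequentially)
  have "f m \<in> S" if "int N \<le> m" for m
  proof -
    have "m = int (nat m)" "N \<le> nat m" using that by auto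
    then show ?thesis using N by metis
  qed
  then show "eventually (\<lambda>m. f m \<in> S) at_top" by (auto simp: eventually_at_top_linorder)
qed

section \<open>Consequences of an admissible representation\<close>

locale admissible =
  fixes \<mu> :: "('a::{metric_space, zero} \<times> 'a) cpt measure" and \<phi> :: "'a lip0 \<Rightarrow>\<^sub>L real"
  assumes admissible: "admissible_representation \<mu> \<phi>"
begin

abbreviation quot1 :: "'a lip0 \<Rightarrow> ('a \<times> 'a) cpt \<Rightarrow> real"
  where "quot1 f \<zeta> \<equiv> val1 f \<zeta> / pair_dist \<zeta>"

abbreviation quot2 :: "'a lip0 \<Rightarrow> ('a \<times> 'a) cpt \<Rightarrow> real"
  where "quot2 f \<zeta> \<equiv> val2 f \<zeta> / pair_dist \<zeta>"

lemma radon: "pos_radon betaM \<mu>"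
  and adj: "de_Leeuw_adj \<mu> = \<phi>"
  and conc: "concentrated_on \<mu> Rplus"
  using admissible by (auto simp: admissible_representation_def optimal_representation_def M_op_def)

lemma sets_\<mu>: "sets \<mu> = sets (borel_of_top betaM)"
  and fin: "finite_measure \<mu>"
  using radon by (auto simp: pos_radon_def)

text \<open>Concentration refers to the completion of \<open>\<mu>\<close>; since
  \<open>Rplus\<close> is Borel, its complement is null for \<open>\<mu>\<close> itself.\<close>

lemma AE_Rplus: "AE \<zeta> in \<mu>. \<zeta> \<in> Rplus"
proof -
  have R: "Rplus \<in> sets \<mu>" unfolding sets_\<mu> by (rule borel_of_top_open[OF openin_Rplus])
  then have "space \<mu> - Rplus \<in> sets \<mu>" by auto
  then have "space \<mu> - Rplus \<in> null_sets \<mu>"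
    using conc by (auto simp: concentrated_on_def null_sets_def emeasure_completion main_part_sets)
  then show ?thesis by (rule AE_I') auto
qed

lemma \<phi>_apply: "blinfun_apply \<phi> f = (\<integral>\<zeta>. de_Leeuw f \<zeta> \<partial>\<mu>)"
  using de_Leeuw_adj_apply[OF sets_\<mu> fin, of f] by (simp add: adj)

lemmas meas = extR_coord_measurable[OF sets_\<mu>] pair_dist_measurable[OF sets_\<mu>]

lemma rho1_integrable: "integrable \<mu> (quot1 rho)"
proof (rule integrableI_bounded)
  show "(quot1 rho) \<in> borel_measurable \<mu>" using meas by measurable
  have "(\<integral>\<^sup>+\<zeta>. ennreal (norm (quot1 rho \<zeta>)) \<partial>\<mu>)
      = (\<integral>\<^sup>+\<zeta>\<in>Rplus. (ennreal (dbar (coord1 \<zeta>) (iotaU 0)) / dist_ext \<zeta>) \<partial>\<mu>)"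
  proof (rule nn_integral_cong_AE)
    show "AE \<zeta> in \<mu>. ennreal (norm (quot1 rho \<zeta>))
        = ennreal (dbar (coord1 \<zeta>) (iotaU 0)) / dist_ext \<zeta> * indicator Rplus \<zeta>"
      using AE_Rplus
    proof eventually_elim
      case (elim \<zeta>)
      note R = RplusD[OF elim]
      have "0 \<le> val1 rho \<zeta>" by (rule extR_nonneg[OF R(2)]) simp
      then show ?case
        using elim pair_dist_pos[OF elim]
        by (simp add: dbar_base[OF R(2)] pair_dist_finite(1)[OF R(1-3)] divide_ennreal)
    qed
  qed
  also have "\<dots> < \<infinity>" using admissible by (simp add: admissible_representation_def)
  finally show "(\<integral>\<^sup>+\<zeta>. ennreal (norm (quot1 rho \<zeta>)) \<partial>\<mu>) < \<infinity>" .
qed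

lemma rho2_integrable: "integrable \<mu> (quot2 rho)"
proof (rule Bochner_Integration.integrable_bound)
  interpret finite_measure \<mu> by (rule fin)
  show "integrable \<mu> (\<lambda>\<zeta>. quot1 rho \<zeta> + 1)" using rho1_integrable by simp
  show "(quot2 rho) \<in> borel_measurable \<mu>" using meas by measurable
  show "AE \<zeta> in \<mu>. norm (quot2 rho \<zeta>) \<le> norm (quot1 rho \<zeta> + 1)"
    using AE_Rplus
  proof eventually_elim
    case (elim \<zeta>)
    note R = RplusD[OF elim]
    have "0 \<le> val1 rho \<zeta>" "0 \<le> val2 rho \<zeta>" by (intro extR_nonneg R; simp)+
    moreover note extR_rho_coord2_le[OF R(1-3)] pair_dist_pos[OF elim]
    ultimately show ?case by (simp add: field_simps)
  qed
qed

lemma part_integrable: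
  shows "integrable \<mu> (quot1 f)" "integrable \<mu> (quot2 f)"
    and part_bound:
    "AE \<zeta> in \<mu>. \<bar>quot1 f \<zeta>\<bar> \<le> norm f * (quot1 rho \<zeta>)"
    "AE \<zeta> in \<mu>. \<bar>quot2 f \<zeta>\<bar> \<le> norm f * (quot2 rho \<zeta>)"
proof -
  have quot: "\<bar>a / d\<bar> \<le> c * (b / d)" if "\<bar>a\<bar> \<le> c * b" "0 < d" for a b c d :: real
    using divide_right_mono[OF that(1), of d] that(2) by (simp add: abs_divide)
  show b1: "AE \<zeta> in \<mu>. \<bar>quot1 f \<zeta>\<bar> \<le> norm f * (quot1 rho \<zeta>)"
    using AE_Rplus
    by eventually_elim (intro quot extR_abs_le RplusD pair_dist_pos)
  show b2: "AE \<zeta> in \<mu>. \<bar>quot2 f \<zeta>\<bar> \<le> norm f * (quot2 rho \<zeta>)"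
    using AE_Rplus
    by eventually_elim (intro quot extR_abs_le RplusD pair_dist_pos)
  show "integrable \<mu> (quot1 f)"
  proof (rule Bochner_Integration.integrable_bound)
    show "integrable \<mu> (\<lambda>\<zeta>. norm f * (quot1 rho \<zeta>))"
      by (intro integrable_mult_right rho1_integrable)
    show "(quot1 f) \<in> borel_measurable \<mu>" using meas by measurable
  qed (use b1 in \<open>eventually_elim, unfold real_norm_def, linarith\<close>)
  show "integrable \<mu> (quot2 f)"
  proof (rule Bochner_Integration.integrable_bound)
    show "integrable \<mu> (\<lambda>\<zeta>. norm f * (quot2 rho \<zeta>))"
      by (intro integrable_mult_right rho2_integrable)
    show "(quot2 f) \<in> borel_measurable \<mu>" using meas by measurable
  qed (use b2 in \<open>eventually_elim, unfold real_norm_def, linarith\<close>)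
qed

lemma \<phi>_split:
  "blinfun_apply \<phi> f = integral\<^sup>L \<mu> (quot1 f) - integral\<^sup>L \<mu> (quot2 f)"
proof -
  have "(\<integral>\<zeta>. de_Leeuw f \<zeta> \<partial>\<mu>) = (\<integral>\<zeta>. quot1 f \<zeta> - quot2 f \<zeta> \<partial>\<mu>)"
  proof (rule integral_cong_AE)
    show "de_Leeuw f \<in> borel_measurable \<mu>"
      using de_Leeuw_integrable[OF sets_\<mu> fin] by (rule borel_measurable_integrable)
    show "AE \<zeta> in \<mu>. de_Leeuw f \<zeta> = quot1 f \<zeta> - quot2 f \<zeta>"
      using AE_Rplus by eventually_elim (simp add: de_Leeuw_Rplus diff_divide_distrib)
  qed (use meas in measurable)
  then show ?thesis unfolding \<phi>_apply using part_integrable[of f] by simp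
qed

text \<open>Formulated for an abstract integrand so that it serves for the quotients of both
  coordinates; domination by \<open>norm f * v rho\<close> supplies the operator bound.\<close>

lemma part_functional:
  fixes v :: "'a lip0 \<Rightarrow> ('a \<times> 'a) cpt \<Rightarrow> real"
  assumes int: "\<And>f. integrable \<mu> (v f)"
    and bound: "\<And>f. AE \<zeta> in \<mu>. \<bar>v f \<zeta>\<bar> \<le> norm f * v rho \<zeta>"
    and add: "\<And>f g \<zeta>. \<zeta> \<in> Rplus \<Longrightarrow> v (f + g) \<zeta> = v f \<zeta> + v g \<zeta>"
    and scale: "\<And>c f \<zeta>. \<zeta> \<in> Rplus \<Longrightarrow> v (c *\<^sub>R f) \<zeta> = c * v f \<zeta>"
    and nonneg: "\<And>f \<zeta>. \<zeta> \<in> Rplus \<Longrightarrow> lip_nonneg f \<Longrightarrow> 0 \<le> v f \<zeta>"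
  shows "\<exists>\<psi>. positive_functional \<psi> \<and> (\<forall>f. blinfun_apply \<psi> f = integral\<^sup>L \<mu> (v f))"
proof -
  have "bounded_linear (\<lambda>f. integral\<^sup>L \<mu> (v f))"
  proof (rule bounded_linear_intro)
    fix f g :: "'a lip0" and c :: real
    have "integral\<^sup>L \<mu> (v (f + g)) = (\<integral>\<zeta>. v f \<zeta> + v g \<zeta> \<partial>\<mu>)"
      using AE_Rplus int by (intro integral_cong_AE) (auto simp: add)
    then show "integral\<^sup>L \<mu> (v (f + g)) = integral\<^sup>L \<mu> (v f) + integral\<^sup>L \<mu> (v g)"
      using int by simp
    have "integral\<^sup>L \<mu> (v (c *\<^sub>R f)) = (\<integral>\<zeta>. c * v f \<zeta> \<partial>\<mu>)"
      using AE_Rplus int by (intro integral_cong_AE) (auto simp: scale)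
    then show "integral\<^sup>L \<mu> (v (c *\<^sub>R f)) = c *\<^sub>R integral\<^sup>L \<mu> (v f)" by simp
    have "\<bar>integral\<^sup>L \<mu> (v f)\<bar> \<le> (\<integral>\<zeta>. norm f * v rho \<zeta> \<partial>\<mu>)"
      by (intro abs_integral_le_AE integrable_mult_right int bound)
    then show "norm (integral\<^sup>L \<mu> (v f)) \<le> norm f * integral\<^sup>L \<mu> (v rho)" by simp
  qed
  note app = fun_cong[OF bounded_linear_Blinfun_apply[OF this]]
  have "0 \<le> integral\<^sup>L \<mu> (v f)" if "lip_nonneg f" for f
  proof (rule integral_nonneg_AE)
    show "AE \<zeta> in \<mu>. 0 \<le> v f \<zeta>" using AE_Rplus by eventually_elim (rule nonneg[OF _ that])
  qed
  then have "positive_functional (Blinfun (\<lambda>f. integral\<^sup>L \<mu> (v f)))"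
    unfolding positive_functional_def app by blast
  then show ?thesis using app by blast
qed

lemma majorisable_\<phi>: "majorisable \<phi>"
proof -
  have "\<exists>\<psi>. positive_functional \<psi> \<and> (\<forall>f. blinfun_apply \<psi> f = integral\<^sup>L \<mu> (quot1 f))"
    by (rule part_functional[OF part_integrable(1) part_bound(1)])
      (auto simp: extR_add extR_scaleR add_divide_distrib RplusD less_imp_le[OF pair_dist_pos]
        intro!: divide_nonneg_nonneg extR_nonneg)
  moreover have "\<exists>\<psi>. positive_functional \<psi> \<and> (\<forall>f. blinfun_apply \<psi> f = integral\<^sup>L \<mu> (quot2 f))"
    by (rule part_functional[OF part_integrable(2) part_bound(2)])
      (auto simp: extR_add extR_scaleR add_divide_distrib RplusD less_imp_le[OF pair_dist_pos]
        intro!: divide_nonneg_nonneg extR_nonneg)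
  ultimately obtain \<psi>1 \<psi>2 where \<psi>: "positive_functional \<psi>1" "positive_functional \<psi>2"
    "\<And>f. blinfun_apply \<psi>1 f = integral\<^sup>L \<mu> (quot1 f)" "\<And>f. blinfun_apply \<psi>2 f = integral\<^sup>L \<mu> (quot2 f)"
    by blast
  have "\<phi> = \<psi>1 - \<psi>2" by (rule blinfun_eqI) (simp add: \<phi>_split \<psi> blinfun.diff_left)
  then show ?thesis using \<psi> unfolding majorisable_def by blast
qed

text \<open>The operator \<open>W n\<close> removes the part \<open>f * k n rho\<close> of
  \<open>f\<close>. The value of \<open>\<phi>\<close> at this part is at most \<open>norm f\<close>
  times an integral independent of \<open>f\<close>, so dominated convergence gives convergence in
  norm. The limit is imposed on \<open>r * k n r\<close> because at \<open>r = 0\<close> the cutoff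
  towards the base point stays equal to 1.\<close>

lemma weight_tendsto:
  fixes W :: "int \<Rightarrow> 'a lip0 \<Rightarrow>\<^sub>L 'a lip0"
  assumes k: "\<And>n. continuous_on UNIV (k n)" "\<And>n r. 0 \<le> k n r" "\<And>n r. k n r \<le> 1"
    and W: "\<And>n f x. lip_apply (blinfun_apply (W n) f) x = lip_apply f x * (1 - k n (dist x 0))"
    and lim: "\<And>r. 0 \<le> r \<Longrightarrow> ((\<lambda>n. r * k n r) \<longlongrightarrow> 0) at_top"
  shows "((\<lambda>n. \<phi> o\<^sub>L W n) \<longlongrightarrow> \<phi>) at_top"
proof -
  let ?b = "\<lambda>n \<zeta>. (val1 rho \<zeta> * k n (val1 rho \<zeta>) + val2 rho \<zeta> * k n (val2 rho \<zeta>)) / pair_dist \<zeta>"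
  let ?B = "\<lambda>\<zeta>. quot1 rho \<zeta> + quot2 rho \<zeta>"
  have rho_nn: "0 \<le> val1 rho \<zeta>" "0 \<le> val2 rho \<zeta>" if "\<zeta> \<in> Rplus" for \<zeta>
    using RplusD[OF that] by (auto intro!: extR_nonneg)
  have bmeas: "?b n \<in> borel_measurable \<mu>" for n
  proof -
    have [measurable]: "k n \<in> borel_measurable borel" using k(1) by (rule borel_measurable_continuous_onI)
    note [measurable] = meas
    show ?thesis by measurable
  qed
  have Bint: "integrable \<mu> ?B" using rho1_integrable rho2_integrable by simp
  have bB: "AE \<zeta> in \<mu>. norm (?b n \<zeta>) \<le> ?B \<zeta>" for n
    using AE_Rplus
  proof eventually_elim
    case (elim \<zeta>)
    note r = rho_nn[OF elim] and d = pair_dist_pos[OF elim]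
    have "0 \<le> ?b n \<zeta>" using r d k(2) by (intro divide_nonneg_pos add_nonneg_nonneg mult_nonneg_nonneg) auto
    moreover have "?b n \<zeta> \<le> (val1 rho \<zeta> + val2 rho \<zeta>) / pair_dist \<zeta>"
      using r d k(3) by (intro divide_right_mono add_mono mult_left_le) auto
    ultimately show ?case by (simp add: add_divide_distrib)
  qed
  have bint: "integrable \<mu> (?b n)" for n
    by (rule Bochner_Integration.integrable_bound[OF Bint bmeas]) (use bB[of n] in \<open>eventually_elim, simp\<close>)
  have "(\<lambda>n. \<integral>\<zeta>. ?b (int n) \<zeta> \<partial>\<mu>) \<longlonglongrightarrow> (\<integral>\<zeta>. 0 \<partial>\<mu>)"
  proof (rule integral_dominated_convergence[OF _ bmeas Bint _ bB])
    show "AE \<zeta> in \<mu>. (\<lambda>n. ?b (int n) \<zeta>) \<longlonglongrightarrow> 0"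
      using AE_Rplus
    proof eventually_elim
      case (elim \<zeta>)
      note r = rho_nn[OF elim] and d = pair_dist_pos[OF elim]
      have "((\<lambda>n. ?b n \<zeta>) \<longlongrightarrow> (0 + 0) / pair_dist \<zeta>) at_top"
        using lim r d by (intro tendsto_intros) auto
      then show ?case
        using filterlim_compose[OF _ filterlim_int_sequentially] by fastforce
    qed
  qed simp
  then have b0: "((\<lambda>n. \<integral>\<zeta>. ?b n \<zeta> \<partial>\<mu>) \<longlongrightarrow> 0) at_top"
    by (intro tendsto_int_at_top) simp
  have "norm ((\<phi> o\<^sub>L W n) - \<phi>) \<le> (\<integral>\<zeta>. ?b n \<zeta> \<partial>\<mu>)" for n
  proof (rule norm_blinfun_bound)
    show "0 \<le> (\<integral>\<zeta>. ?b n \<zeta> \<partial>\<mu>)"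
    proof (rule integral_nonneg_AE)
      show "AE \<zeta> in \<mu>. 0 \<le> ?b n \<zeta>"
        using AE_Rplus
        by eventually_elim
          (intro divide_nonneg_pos add_nonneg_nonneg mult_nonneg_nonneg rho_nn k(2) pair_dist_pos)
    qed
    fix f :: "'a lip0"
    let ?u = "f - blinfun_apply (W n) f"
    have u: "lip_apply ?u x = lip_apply f x * k n (dist x 0)" for x
      by (simp add: W algebra_simps)
    have "\<bar>blinfun_apply \<phi> ?u\<bar> \<le> (\<integral>\<zeta>. norm f * ?b n \<zeta> \<partial>\<mu>)"
      unfolding \<phi>_apply
    proof (rule abs_integral_le_AE)
      show "integrable \<mu> (de_Leeuw ?u)" by (rule de_Leeuw_integrable[OF sets_\<mu> fin])
      show "integrable \<mu> (\<lambda>\<zeta>. norm f * ?b n \<zeta>)" by (intro integrable_mult_right bint)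
      show "AE \<zeta> in \<mu>. \<bar>de_Leeuw ?u \<zeta>\<bar> \<le> norm f * ?b n \<zeta>"
        using AE_Rplus
      proof eventually_elim
        case (elim \<zeta>)
        note R = RplusD[OF elim] and d = pair_dist_pos[OF elim]
        have "\<bar>val1 f \<zeta>\<bar> * k n (val1 rho \<zeta>) \<le> (norm f * val1 rho \<zeta>) * k n (val1 rho \<zeta>)"
          "\<bar>val2 f \<zeta>\<bar> * k n (val2 rho \<zeta>) \<le> (norm f * val2 rho \<zeta>) * k n (val2 rho \<zeta>)"
          using extR_abs_le R k(2) by (auto intro!: mult_right_mono)
        moreover have "\<bar>val1 ?u \<zeta>\<bar> = \<bar>val1 f \<zeta>\<bar> * k n (val1 rho \<zeta>)" "\<bar>val2 ?u \<zeta>\<bar> = \<bar>val2 f \<zeta>\<bar> * k n (val2 rho \<zeta>)"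
          using extR_mult_profile[OF R(2) k(1) u] extR_mult_profile[OF R(3) k(1) u] k(2)
          by (simp_all add: abs_mult)
        ultimately have "\<bar>val1 ?u \<zeta> - val2 ?u \<zeta>\<bar>
            \<le> norm f * (val1 rho \<zeta> * k n (val1 rho \<zeta>) + val2 rho \<zeta> * k n (val2 rho \<zeta>))"
          by (simp add: algebra_simps)
        then show ?case unfolding de_Leeuw_Rplus[OF elim] using d
          by (simp add: abs_divide divide_right_mono)
      qed
    qed
    then show "norm (blinfun_apply ((\<phi> o\<^sub>L W n) - \<phi>) f) \<le> (\<integral>\<zeta>. ?b n \<zeta> \<partial>\<mu>) * norm f"
      unfolding integral_mult_right_zero
      by (simp add: blinfun.diff_left blinfun.diff_right abs_minus_commute mult.commute)
  qed
  then have "((\<lambda>n. norm ((\<phi> o\<^sub>L W n) - \<phi>)) \<longlongrightarrow> 0) at_top"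
    by (intro Lim_null_comparison[OF _ b0]) simp
  then show ?thesis using tendsto_norm_zero_iff LIM_zero_iff by blast
qed

lemma avoids_infinity_\<phi>: "avoids_infinity \<phi>"
  unfolding avoids_infinity_def weight_op_adj_def
proof (rule weight_tendsto[where k = "\<lambda>n r. 1 - cutoff_profile n r"])
  fix r :: real assume "0 \<le> r"
  have "((\<lambda>n. r * (1 - cutoff_profile n r)) \<longlongrightarrow> r * (1 - 1)) at_top"
    by (intro tendsto_intros cutoff_profile_at_top)
  then show "((\<lambda>n. r * (1 - cutoff_profile n r)) \<longlongrightarrow> 0) at_top" by simp
qed (use cutoff_profile_bounds in
    \<open>auto simp: cutoff_eq_profile intro!: continuous_intros cutoff_profile_continuous\<close>)

lemma avoids_zero_\<phi>: "avoids_zero \<phi>"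
  unfolding avoids_zero_def weight_op_adj_def
proof (rule weight_tendsto[where k = "\<lambda>n r. cutoff_profile (- n) r"])
  fix r :: real assume "0 \<le> r"
  show "((\<lambda>n. r * cutoff_profile (- n) r) \<longlongrightarrow> 0) at_top"
  proof (cases "r = 0")
    case False
    then have "((\<lambda>n. r * cutoff_profile (- n) r) \<longlongrightarrow> r * 0) at_top"
      using \<open>0 \<le> r\<close> by (intro tendsto_intros cutoff_profile_at_bot) simp
    then show ?thesis by simp
  qed simp
next
  fix n f and x :: 'a
  show "lip_apply (blinfun_apply (weight_op (\<lambda>x. 1 - cutoff (- n) x)) f) x
      = lip_apply f x * (1 - cutoff_profile (- n) (dist x 0))"
    unfolding weight_op_cutoff_apply unfolding cutoff_eq_profile ..
qed (use cutoff_profile_bounds in \<open>auto intro!: cutoff_profile_continuous\<close>)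

end

section \<open>Construction of the representing measure\<close>

text \<open>With \<open>- g\<close> in place of \<open>g\<close> this majorises by sums of
  \<open>f(x)\<close> and \<open>g(y)\<close> over the distance, the form in which nonnegative test
  functions are bounded.\<close>

abbreviation majorant ::
    "('a::{metric_space, zero} \<times> 'a \<Rightarrow> real) \<Rightarrow> real \<Rightarrow> 'a lip0 \<Rightarrow> 'a lip0 \<Rightarrow> bool"
  where "majorant u c f g \<equiv>
    \<forall>x y. x \<noteq> y \<longrightarrow> u (x, y) \<le> c + (lip_apply f x - lip_apply g y) / dist x y"

context Jordan_pair
begin

lemmas P_simps = linear_add[OF P_linear] linear_diff[OF P_linear] linear_scale[OF P_linear]
  linear_neg[OF P_linear] linear_0[OF P_linear]

lemmas N_simps = linear_add[OF N_linear] linear_diff[OF N_linear] linear_scale[OF N_linear]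
  linear_neg[OF N_linear] linear_0[OF N_linear]

lemma P_mono: "(\<And>x. lip_apply f x \<le> lip_apply g x) \<Longrightarrow> P f \<le> P g"
  using P_nonneg[of "g - f"] by (simp add: P_simps)

lemma N_mono: "(\<And>x. lip_apply f x \<le> lip_apply g x) \<Longrightarrow> N f \<le> N g"
  using N_nonneg[of "g - f"] by (simp add: N_simps)

text \<open>Positivity bounds each part by its value at \<open>rho\<close>. The estimate serves the
  case of a negative constant in the dual bound, where multiplication reverses it.\<close>

lemma norm_\<phi>_le: "norm \<phi> \<le> P rho + N rho"
proof (rule norm_blinfun_bound)
  show "0 \<le> P rho + N rho" using P_nonneg[of rho] N_nonneg[of rho] by simp
  fix f :: "'a lip0"
  have le: "lip_apply f x \<le> lip_apply (norm f *\<^sub>R rho) x" "lip_apply (- norm f *\<^sub>R rho) x \<le> lip_apply f x" for x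
    using lip_apply_le[of f x] by auto
  have "\<bar>P f\<bar> \<le> norm f * P rho"
    using P_mono[OF le(1)] P_mono[OF le(2)] by (simp add: P_simps)
  moreover have "\<bar>N f\<bar> \<le> norm f * N rho"
    using N_mono[OF le(1)] N_mono[OF le(2)] by (simp add: N_simps)
  ultimately show "norm (blinfun_apply \<phi> f) \<le> (P rho + N rho) * norm f"
    by (simp add: \<phi>_eq algebra_simps)
qed

text \<open>An intermediate function \<open>g \<le> k \<le> f\<close> with \<open>k\<close> being \<open>c\<close>-Lipschitz is the inf-convolution
  of \<open>f\<close> with \<open>c * dist\<close>.\<close>

lemma dual_bound_diagonal:
  assumes c: "0 \<le> c" and le: "\<And>x y. lip_apply g y - lip_apply f x \<le> c * dist x y"
  shows "N g - P f \<le> c * norm \<phi>"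
proof -
  define k where "k y = (INF x. lip_apply f x + c * dist x y)" for y
  have bdd: "bdd_below (range (\<lambda>x. lip_apply f x + c * dist x y))" for y
    using le[of y] by (intro bdd_belowI2[of _ "lip_apply g y"]) (simp add: algebra_simps)
  have k_le: "k y \<le> lip_apply f x + c * dist x y" for x y
    unfolding k_def by (intro cINF_lower bdd) simp
  have k_ge: "z \<le> k y" if "\<And>x. z \<le> lip_apply f x + c * dist x y" for y z
    unfolding k_def using that by (intro cINF_greatest) auto
  have kf: "k x \<le> lip_apply f x" for x using k_le[of x x] by simp
  have gk: "lip_apply g y \<le> k y" for y
    using le[of y] by (intro k_ge) (simp add: algebra_simps)
  have step: "k y \<le> k y' + c * dist y y'" for y y'
  proof -
    have "k y - c * dist y y' \<le> k y'"
    proof (rule k_ge)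
      fix x
      have "c * dist x y \<le> c * (dist x y' + dist y y')"
        by (intro mult_left_mono dist_triangle2 c)
      then show "k y - c * dist y y' \<le> lip_apply f x + c * dist x y'"
        using k_le[of y x] by (simp add: algebra_simps)
    qed
    then show ?thesis by simp
  qed
  have lip: "c-lipschitz_on UNIV k"
  proof (rule lipschitz_onI)
    show "dist (k y) (k y') \<le> c * dist y y'" for y y'
      using step[of y y'] step[of y' y] by (simp add: dist_real_def dist_commute abs_le_iff)
  qed (rule c)
  have "k 0 = 0" using kf[of 0] gk[of 0] by simp
  then have app: "lip_apply (Abs_lip0 k) = k" by (rule lip_apply_Abs_lip0[OF _ lip])
  have "N g \<le> N (Abs_lip0 k)" by (rule N_mono) (simp add: app gk)
  moreover have "P (Abs_lip0 k) \<le> P f" by (rule P_mono) (simp add: app kf)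
  ultimately have "N g - P f \<le> - blinfun_apply \<phi> (Abs_lip0 k)" by (simp add: \<phi>_eq)
  also have "\<dots> \<le> norm \<phi> * norm (Abs_lip0 k)"
    using norm_blinfun[of \<phi> "Abs_lip0 k"] by simp
  also have "\<dots> \<le> norm \<phi> * c"
    using lip by (intro mult_left_mono norm_lip0_le) (simp_all add: app)
  finally show ?thesis by (simp add: mult.commute)
qed

text \<open>At isolated points the hypothesis says nothing about \<open>f x\<close> and \<open>g x\<close>; orthogonality of \<open>P\<close>
  and \<open>N\<close> allows us to enforce \<open>g \<le> f\<close> at a small cost.\<close>

lemma dual_bound:
  assumes le: "\<And>x y. x \<noteq> y \<Longrightarrow> lip_apply g y - lip_apply f x \<le> c * dist x y"
  shows "N g - P f \<le> c * norm \<phi>"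
proof (cases "c < 0")
  case True
  \<comment> \<open>Testing one variable at the base point, where \<open>f\<close> and
    \<open>g\<close> vanish, bounds \<open>f\<close> from below and \<open>g\<close> from above by
    multiples of \<open>rho\<close>.\<close>
  have "lip_apply ((- c) *\<^sub>R rho) x \<le> lip_apply f x" for x
    using le[of x 0] by (cases "x = 0") auto
  then have "- c * P rho \<le> P f" using P_mono[of "(- c) *\<^sub>R rho" f] by (simp add: P_simps)
  moreover have "lip_apply g y \<le> lip_apply (c *\<^sub>R rho) y" for y
    using le[of 0 y] by (cases "y = 0") (auto simp: dist_commute)
  then have "N g \<le> c * N rho" using N_mono[of g "c *\<^sub>R rho"] by (simp add: N_simps)
  moreover have "c * (P rho + N rho) \<le> c * norm \<phi>"
    using norm_\<phi>_le True by (intro mult_left_mono_neg) auto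
  ultimately show ?thesis by (simp add: algebra_simps)
next
  case False
  have "N g - P f \<le> c * norm \<phi> + e" if e: "0 < e" for e
  proof -
    \<comment> \<open>\<open>d\<close> is the amount by which \<open>g\<close> exceeds
      \<open>f\<close>. Splitting it as \<open>w + (d - w)\<close>, lowering \<open>g\<close> by
      \<open>w\<close> and raising \<open>f\<close> by \<open>d - w\<close> orders the two functions
      on the diagonal and changes \<open>N g - P f\<close> by at most \<open>e\<close>.\<close>
    define d where "d = lip_max (g - f) 0"
    have d: "lip_nonneg d" by (simp add: d_def)
    obtain w where w: "lip_nonneg w" "lip_nonneg (d - w)" "P (d - w) + N w \<le> e"
      using orthogonal[OF d e] by blast
    have "N (g - w) - P (f + (d - w)) \<le> c * norm \<phi>"
    proof (rule dual_bound_diagonal)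
      fix x y
      show "lip_apply (g - w) y - lip_apply (f + (d - w)) x \<le> c * dist x y"
      proof (cases "x = y")
        case True
        then show ?thesis by (simp add: d_def)
      next
        case False
        have "0 \<le> lip_apply w y" "0 \<le> lip_apply (d - w) x" using w by blast+
        then show ?thesis using le[OF False] by simp
      qed
    qed (use False in simp)
    then show ?thesis using w(3) by (simp add: P_simps N_simps)
  qed
  then show ?thesis by (rule field_le_epsilon)
qed

section \<open>The cost of majorants and the representing measure\<close>

definition majorant_values :: "('a \<times> 'a \<Rightarrow> real) \<Rightarrow> real set"
  where "majorant_values u = {c * norm \<phi> + P f - N g | c f g. majorant u c f g}"

text \<open>The cost of the cheapest majorant of \<open>u\<close>. A linear functional below this
  quantity satisfies all the inequalities wanted of the measure at once.\<close>

definition upper_value :: "('a \<times> 'a \<Rightarrow> real) \<Rightarrow> real"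
  where "upper_value u = Inf (majorant_values u)"

text \<open>Hahn-Banach is applied to all functions bounded on pairs of distinct points, a space
  that contains \<open>bdd_cont\<close>; continuity enters only through the Riesz
  representation.\<close>

definition bdd_funs :: "('a \<times> 'a \<Rightarrow> real) set"
  where "bdd_funs = {u. \<exists>B. \<forall>z\<in>Mtilde. \<bar>u z\<bar> \<le> B}"

lemma bdd_funs_subspace: "fun_subspace bdd_funs"
  unfolding fun_subspace_def
proof (intro conjI ballI allI)
  show "(\<lambda>_. 0) \<in> bdd_funs" by (auto simp: bdd_funs_def)
  fix u assume "u \<in> bdd_funs"
  then obtain B where B: "\<And>z. z \<in> Mtilde \<Longrightarrow> \<bar>u z\<bar> \<le> B" by (auto simp: bdd_funs_def)
  show "(\<lambda>z. c * u z) \<in> bdd_funs" for c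
    unfolding bdd_funs_def using B
    by (intro CollectI exI[of _ "\<bar>c\<bar> * B"]) (auto simp: abs_mult intro: mult_left_mono)
  fix v assume "v \<in> bdd_funs"
  then obtain B' where B': "\<And>z. z \<in> Mtilde \<Longrightarrow> \<bar>v z\<bar> \<le> B'" by (auto simp: bdd_funs_def)
  have "\<bar>u z + v z\<bar> \<le> B + B'" if "z \<in> Mtilde" for z
    using B[OF that] B'[OF that] by linarith
  then show "(\<lambda>z. u z + v z) \<in> bdd_funs" unfolding bdd_funs_def by blast
qed

lemma majorant_values_nonempty:
  assumes "u \<in> bdd_funs"
  shows "majorant_values u \<noteq> {}"
proof -
  obtain B where B: "\<And>z. z \<in> Mtilde \<Longrightarrow> \<bar>u z\<bar> \<le> B" using assms by (auto simp: bdd_funs_def)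
  have "u (x, y) \<le> B + (lip_apply 0 x - lip_apply 0 y) / dist x y" if "x \<noteq> y" for x y
    using B[of "(x, y)"] that by (auto simp: Mtilde_def abs_le_iff)
  then have "B * norm \<phi> + P 0 - N 0 \<in> majorant_values u" unfolding majorant_values_def by blast
  then show ?thesis by blast
qed

text \<open>Weak duality: a majorant of a function bounded below by \<open>- B\<close> satisfies
  \<open>g(y) - f(x) \<le> (c + B) d(x, y)\<close>, and \<open>dual_bound\<close> turns this into
  the lower bound \<open>- B * norm \<phi>\<close> for its cost.\<close>

lemma majorant_values_bdd:
  assumes "u \<in> bdd_funs"
  shows "bdd_below (majorant_values u)"
proof -
  obtain B where B: "\<And>z. z \<in> Mtilde \<Longrightarrow> \<bar>u z\<bar> \<le> B" using assms by (auto simp: bdd_funs_def)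
  show ?thesis
  proof (rule bdd_belowI)
    fix s assume "s \<in> majorant_values u"
    then obtain c f g where s: "s = c * norm \<phi> + P f - N g"
      and le: "\<And>x y. x \<noteq> y \<Longrightarrow> u (x, y) \<le> c + (lip_apply f x - lip_apply g y) / dist x y"
      by (auto simp: majorant_values_def)
    have "N g - P f \<le> (c + B) * norm \<phi>"
    proof (rule dual_bound)
      fix x y :: 'a assume xy: "x \<noteq> y"
      have "- B \<le> c + (lip_apply f x - lip_apply g y) / dist x y"
        using le[OF xy] B[of "(x, y)"] xy by (auto simp: Mtilde_def abs_le_iff)
      then have "(lip_apply g y - lip_apply f x) / dist x y \<le> c + B"
        by (simp add: diff_divide_distrib)
      then show "lip_apply g y - lip_apply f x \<le> (c + B) * dist x y"
        using xy by (simp add: divide_le_eq)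
    qed
    then show "- B * norm \<phi> \<le> s" by (simp add: s algebra_simps)
  qed
qed

lemma upper_value_le:
  assumes "u \<in> bdd_funs" "\<And>x y. x \<noteq> y \<Longrightarrow> u (x, y) \<le> c + (lip_apply f x - lip_apply g y) / dist x y"
  shows "upper_value u \<le> c * norm \<phi> + P f - N g"
  unfolding upper_value_def using assms
  by (intro cInf_lower majorant_values_bdd) (auto simp: majorant_values_def)

lemma upper_value_sublinear: "sublinear_on bdd_funs upper_value"
proof (rule sublinear_onI_scale_le[OF bdd_funs_subspace])
  fix u v assume u: "u \<in> bdd_funs" and v: "v \<in> bdd_funs"
  have uv: "(\<lambda>x. u x + v x) \<in> bdd_funs" by (rule fun_subspaceD(2)[OF bdd_funs_subspace u v])
  have sum: "upper_value (\<lambda>x. u x + v x) \<le> s + t"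
    if s: "s \<in> majorant_values u" and t: "t \<in> majorant_values v" for s t
  proof -
    obtain c f g where s: "s = c * norm \<phi> + P f - N g"
      and le1: "\<And>x y. x \<noteq> y \<Longrightarrow> u (x, y) \<le> c + (lip_apply f x - lip_apply g y) / dist x y"
      using s by (auto simp: majorant_values_def)
    obtain c' f' g' where t: "t = c' * norm \<phi> + P f' - N g'"
      and le2: "\<And>x y. x \<noteq> y \<Longrightarrow> v (x, y) \<le> c' + (lip_apply f' x - lip_apply g' y) / dist x y"
      using t by (auto simp: majorant_values_def)
    have "upper_value (\<lambda>x. u x + v x) \<le> (c + c') * norm \<phi> + P (f + f') - N (g + g')"
    proof (rule upper_value_le[OF uv])
      fix x y :: 'a assume "x \<noteq> y"
      from add_mono[OF le1[OF this] le2[OF this]]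
      show "u (x, y) + v (x, y) \<le> (c + c') + (lip_apply (f + f') x - lip_apply (g + g') y) / dist x y"
        by (simp add: add_divide_distrib diff_divide_distrib)
    qed
    also have "\<dots> = s + t" by (simp add: s t P_simps N_simps algebra_simps)
    finally show ?thesis .
  qed
  have "upper_value (\<lambda>x. u x + v x) - t \<le> upper_value u" if t: "t \<in> majorant_values v" for t
    unfolding upper_value_def[of u]
    by (rule cInf_greatest[OF majorant_values_nonempty[OF u]]) (use sum t in force)
  then have "upper_value (\<lambda>x. u x + v x) - upper_value u \<le> upper_value v"
    unfolding upper_value_def[of v]
    by (intro cInf_greatest[OF majorant_values_nonempty[OF v]]) (simp add: algebra_simps)
  then show "upper_value (\<lambda>x. u x + v x) \<le> upper_value u + upper_value v" by simp
next
  fix u and r :: real assume u: "u \<in> bdd_funs" and r: "0 < r"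
  have ru: "(\<lambda>x. r * u x) \<in> bdd_funs" by (rule fun_subspaceD(3)[OF bdd_funs_subspace u])
  have "upper_value (\<lambda>x. r * u x) / r \<le> upper_value u"
    unfolding upper_value_def[of u]
  proof (rule cInf_greatest[OF majorant_values_nonempty[OF u]])
    fix s assume "s \<in> majorant_values u"
    then obtain c f g where s: "s = c * norm \<phi> + P f - N g"
      and le: "\<And>x y. x \<noteq> y \<Longrightarrow> u (x, y) \<le> c + (lip_apply f x - lip_apply g y) / dist x y"
      by (auto simp: majorant_values_def)
    have "upper_value (\<lambda>x. r * u x) \<le> (r * c) * norm \<phi> + P (r *\<^sub>R f) - N (r *\<^sub>R g)"
    proof (rule upper_value_le[OF ru])
      fix x y :: 'a assume "x \<noteq> y"
      from mult_left_mono[OF le[OF this], of r] r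
      show "r * u (x, y) \<le> r * c + (lip_apply (r *\<^sub>R f) x - lip_apply (r *\<^sub>R g) y) / dist x y"
        by (simp add: distrib_left right_diff_distrib[symmetric])
    qed
    also have "\<dots> = s * r" by (simp add: s P_simps N_simps algebra_simps)
    finally show "upper_value (\<lambda>x. r * u x) / r \<le> s" using r by (simp add: divide_le_eq)
  qed
  then show "upper_value (\<lambda>x. r * u x) \<le> r * upper_value u"
    using r by (simp add: divide_le_eq mult.commute)
qed

text \<open>A continuous function on the compactification is evaluated by the dominated functional
  through its values on pairs. Positivity comes from the domination: the zero majorant bounds
  \<open>- f\<close> for \<open>f \<ge> 0\<close>, so \<open>- L f \<le> 0\<close>.\<close>

lemma representing_measure:
  "\<exists>\<mu>. pos_radon betaM \<mu> \<and> (\<forall>u\<in>bdd_cont. \<forall>c f g.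
    majorant u c f g \<longrightarrow> (\<integral>\<zeta>. \<zeta> u \<partial>\<mu>) \<le> c * norm \<phi> + P f - N g)"
proof -
  obtain \<Lambda> where "(\<forall>u\<in>bdd_funs. \<Lambda> u \<le> upper_value u) \<and>
      (\<forall>u\<in>bdd_funs. \<forall>v\<in>bdd_funs. \<Lambda> (\<lambda>x. u x + v x) = \<Lambda> u + \<Lambda> v) \<and>
      (\<forall>u\<in>bdd_funs. \<forall>c. \<Lambda> (\<lambda>x. c * u x) = c * \<Lambda> u)"
    using Hahn_Banach_sublinear[OF bdd_funs_subspace upper_value_sublinear] by (rule exE)
  then have \<Lambda>_le: "\<And>u. u \<in> bdd_funs \<Longrightarrow> \<Lambda> u \<le> upper_value u"
    and \<Lambda>_add: "\<And>u v. u \<in> bdd_funs \<Longrightarrow> v \<in> bdd_funs \<Longrightarrow> \<Lambda> (\<lambda>x. u x + v x) = \<Lambda> u + \<Lambda> v"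
    and \<Lambda>_scale: "\<And>u c. u \<in> bdd_funs \<Longrightarrow> \<Lambda> (\<lambda>x. c * u x) = c * \<Lambda> u"
    by simp_all
  define L where "L h = \<Lambda> (\<lambda>z. h (compact_embed bdd_cont z))" for h
  have top: "compact_embed bdd_cont z \<in> topspace betaM" if "z \<in> Mtilde" for z :: "'a \<times> 'a"
    using that by (simp add: betaM_def compact_embed_topspace)
  have bdd: "(\<lambda>z. h (compact_embed bdd_cont z)) \<in> bdd_funs"
    if "continuous_map betaM euclideanreal h" for h
  proof -
    have "compact (h ` topspace betaM)"
      using image_compactin[OF compact_betaM[unfolded compact_space_def] that] by simp
    then obtain B where "\<And>\<zeta>. \<zeta> \<in> topspace betaM \<Longrightarrow> \<bar>h \<zeta>\<bar> \<le> B"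
      using compact_imp_bounded bounded_iff by (metis image_eqI real_norm_def)
    then have "\<forall>z\<in>Mtilde. \<bar>h (compact_embed bdd_cont z)\<bar> \<le> B" using top by blast
    then show ?thesis unfolding bdd_funs_def by blast
  qed
  interpret positive_linear_on_compact betaM L
  proof
    show "compact_space (betaM :: ('a \<times> 'a) cpt topology)" by (rule compact_betaM)
    show "Hausdorff_space (betaM :: ('a \<times> 'a) cpt topology)" by (rule Hausdorff_betaM)
    fix f :: "('a \<times> 'a) cpt \<Rightarrow> real" assume f: "continuous_map betaM euclideanreal f"
    show "L (\<lambda>x. c * f x) = c * L f" for c
      unfolding L_def by (rule \<Lambda>_scale[OF bdd[OF f]])
    show "L (\<lambda>x. f x + g x) = L f + L g" if "continuous_map betaM euclideanreal g" for g
      unfolding L_def by (rule \<Lambda>_add[OF bdd[OF f] bdd[OF that]])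
    assume nonneg: "\<And>x. x \<in> topspace betaM \<Longrightarrow> 0 \<le> f x"
    have mem: "(\<lambda>z. - 1 * f (compact_embed bdd_cont z)) \<in> bdd_funs"
      by (rule fun_subspaceD(3)[OF bdd_funs_subspace bdd[OF f]])
    have "- L f = \<Lambda> (\<lambda>z. - 1 * f (compact_embed bdd_cont z))"
      unfolding L_def by (subst \<Lambda>_scale[OF bdd[OF f]]) simp
    also have "\<dots> \<le> upper_value (\<lambda>z. - 1 * f (compact_embed bdd_cont z))" by (rule \<Lambda>_le[OF mem])
    also have "\<dots> \<le> 0 * norm \<phi> + P 0 - N 0"
      by (rule upper_value_le[OF mem]) (use nonneg top in \<open>simp add: Mtilde_def\<close>)
    finally show "0 \<le> L f" by (simp add: P_simps N_simps)
  qed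
  show ?thesis
  proof (intro exI[of _ riesz_measure] conjI ballI allI impI pos_radon_riesz_measure)
    fix u :: "'a \<times> 'a \<Rightarrow> real" and c f g assume u: "u \<in> bdd_cont"
      and le: "majorant u c f g"
    have c: "continuous_map betaM euclideanreal (\<lambda>\<zeta>. \<zeta> u)"
      unfolding betaM_def by (rule continuous_map_coordinate[OF u])
    have "(\<integral>\<zeta>. \<zeta> u \<partial>riesz_measure) = \<Lambda> u"
      unfolding riesz_integral[OF c] L_def using u by simp
    moreover have ub: "u \<in> bdd_funs"
      using bdd[OF c] u by simp
    ultimately show "(\<integral>\<zeta>. \<zeta> u \<partial>riesz_measure) \<le> c * norm \<phi> + P f - N g"
      using \<Lambda>_le[OF ub] upper_value_le[OF ub le[rule_format]] by linarith
  qed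
qed

end

lemma dist_le_base_sum: "dist x y \<le> dist x 0 + dist y 0"
  by (rule dist_triangle2)

lemma dist_le_twice_base_sum: "dist x y \<le> 2 * (dist x 0 + dist y 0)"
  by (rule order_trans[OF dist_le_base_sum]) simp

text \<open>The sum of the series has a finite integral, so the series converges almost everywhere
  and its terms tend to 0.\<close>

lemma AE_tendsto_0_if_integral_le_geometric:
  fixes f :: "nat \<Rightarrow> 'b \<Rightarrow> real"
  assumes int: "\<And>k. integrable M (f k)" and nonneg: "\<And>k x. x \<in> space M \<Longrightarrow> 0 \<le> f k x"
    and le: "\<And>k. (\<integral>x. f k x \<partial>M) \<le> (1/2) ^ k"
  shows "AE x in M. (\<lambda>k. f k x) \<longlonglongrightarrow> 0"
proof -
  have [measurable]: "f k \<in> borel_measurable M" for k using int by auto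
  have "(\<integral>\<^sup>+x. (\<Sum>k. ennreal (f k x)) \<partial>M) = (\<Sum>k. \<integral>\<^sup>+x. ennreal (f k x) \<partial>M)"
    by (rule nn_integral_suminf) simp
  also have "\<dots> \<le> (\<Sum>k. ennreal ((1/2) ^ k))"
  proof (intro suminf_le)
    show "(\<integral>\<^sup>+x. ennreal (f k x) \<partial>M) \<le> ennreal ((1/2) ^ k)" for k
      using nn_integral_eq_integral[OF int[of k]] nonneg le[of k] by (simp add: ennreal_leI)
  qed auto
  also have "\<dots> = ennreal 2"
    using geometric_sums[of "1/2 :: real"] by (intro suminf_ennreal_eq) auto
  finally have "(\<integral>\<^sup>+x. (\<Sum>k. ennreal (f k x)) \<partial>M) \<noteq> \<infinity>" by (auto simp: top_unique)
  then have "AE x in M. (\<Sum>k. ennreal (f k x)) \<noteq> \<infinity>"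
    by (intro nn_integral_PInf_AE) auto
  then show ?thesis
    using AE_space
  proof eventually_elim
    case (elim x)
    then have "summable (\<lambda>k. f k x)"
      using nonneg by (intro summable_suminf_not_top) auto
    then show ?case by (rule summable_LIMSEQ_zero)
  qed
qed

text \<open>If \<open>rho\<close> tends to 0 along the filter of \<open>\<xi>\<close>, uniform
  continuity makes every coordinate converge to its value at the base point. The base point is thus
  the zero set of the extension of \<open>rho\<close> in \<open>MR\<close>, hence measurable
  there.\<close>

lemma MR_base_unique:
  assumes \<xi>: "\<xi> \<in> MR_set" and r: "lipR rho \<xi> = 0"
  shows "\<xi> = iotaU (0 :: 'a::{metric_space, zero})"
proof (rule topspace_MU_eqI)
  show "\<xi> \<in> topspace MU" "iotaU (0::'a) \<in> topspace MU"
    using MR_setD(1) \<xi> iotaU_MR by blast+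
  fix g :: "'a \<Rightarrow> real" assume g: "g \<in> bdd_unif_cont"
  have rt: "((\<lambda>x. dist x (0::'a)) \<longlongrightarrow> 0) (filterU \<xi>)"
    using extR_tendsto[OF \<xi>, of rho] r by (simp add: lip_apply_rho_fun)
  have "(g \<longlongrightarrow> g 0) (filterU \<xi>)"
  proof (rule tendstoI)
    fix e :: real assume "0 < e"
    then obtain s where s: "0 < s" "\<And>x y. dist x y < s \<Longrightarrow> dist (g x) (g y) < e"
      using g unfolding bdd_unif_cont_def uniformly_continuous_on_def by auto
    have "eventually (\<lambda>x. dist x 0 < s) (filterU \<xi>)" using order_tendstoD(2)[OF rt s(1)] .
    then show "eventually (\<lambda>x. dist (g x) (g 0) < e) (filterU \<xi>)"
      by eventually_elim (rule s(2))
  qed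
  moreover have "(g \<longlongrightarrow> \<xi> g) (filterU \<xi>)"
    using MR_setD(1)[OF \<xi>] g unfolding MU_def by (rule trace_filter_tendsto_coordinate)
  ultimately show "\<xi> g = iotaU 0 g"
    using tendsto_unique[OF filterU_nontrivial[OF MR_setD(1)[OF \<xi>]]] g by simp
qed

section \<open>Pushforwards to the finite part of the compactification\<close>

lemma Rplus_sets: "sets \<mu> = sets (borel_of_top betaM) \<Longrightarrow> Rplus \<in> sets \<mu>"
  by (simp add: borel_of_top_open openin_Rplus)

lemma coord_measurable_MR:
  assumes sets: "sets \<mu> = sets (borel_of_top betaM)"
  shows "coord1 \<in> measurable (restrict_space \<mu> Rplus) (borel_of_top (MR :: 'a::{metric_space, zero} cpt topology))"
    and "coord2 \<in> measurable (restrict_space \<mu> Rplus) (borel_of_top (MR :: 'a::{metric_space, zero} cpt topology))"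
proof -
  have space: "space (restrict_space \<mu> Rplus) = (Rplus :: ('a \<times> 'a) cpt set)"
    using sets_eq_imp_space_eq[OF sets] openin_subset[OF openin_Rplus] by (auto simp: space_restrict_space)
  have *: "p \<in> measurable (restrict_space \<mu> Rplus) (borel_of_top (MR :: 'a cpt topology))"
    if p: "continuous_map betaM MU p" and MR: "\<And>\<zeta>. \<zeta> \<in> Rplus \<Longrightarrow> p \<zeta> \<in> (MR_set :: 'a cpt set)" for p
    unfolding borel_of_top_def
  proof (rule measurable_measure_of)
    show "{U. openin MR U} \<subseteq> Pow (topspace (MR :: 'a cpt topology))" by (auto dest: openin_subset)
    show "p \<in> space (restrict_space \<mu> Rplus) \<rightarrow> topspace MR"
      unfolding space using MR MR_setD(1) by (auto simp: MR_def)
    fix U :: "'a cpt set" assume "U \<in> {U. openin MR U}"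
    then obtain V where V: "openin MU V" "U = V \<inter> MR_set" by (auto simp: MR_def openin_subtopology)
    have "openin betaM ({\<zeta> \<in> topspace betaM. p \<zeta> \<in> V} \<inter> Rplus)"
      by (intro openin_Int openin_Rplus openin_continuous_map_preimage[OF p V(1)])
    moreover have "p -` U \<inter> space (restrict_space \<mu> Rplus) = {\<zeta> \<in> topspace betaM. p \<zeta> \<in> V} \<inter> Rplus"
      unfolding space V(2) using MR openin_subset[OF openin_Rplus] by auto
    moreover have "Rplus \<inter> space \<mu> \<in> sets \<mu>"
      using Rplus_sets[OF sets] by auto
    ultimately show "p -` U \<inter> space (restrict_space \<mu> Rplus) \<in> sets (restrict_space \<mu> Rplus)"
      using borel_of_top_open sets by (subst sets_restrict_space_iff) auto
  qed
  show "coord1 \<in> measurable (restrict_space \<mu> Rplus) (borel_of_top (MR :: 'a cpt topology))"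
    by (rule *[OF coord1_continuous RplusD(2)])
  show "coord2 \<in> measurable (restrict_space \<mu> Rplus) (borel_of_top (MR :: 'a cpt topology))"
    by (rule *[OF coord2_continuous RplusD(3)])
qed

lemma extR_measurable_MR:
  fixes f :: "'a::{metric_space, zero} lip0"
  shows "lipR f \<in> borel_measurable (borel_of_top MR)"
proof -
  have "continuous_map MR euclidean (extU (lip_apply f))"
    unfolding MR_def by (intro continuous_map_from_subtopology extU_continuous[OF lip_apply_lipschitz])
  then have "extU (lip_apply f) \<in> borel_measurable (borel_of_top MR)"
    by (rule continuous_map_measurable) simp
  then show ?thesis unfolding extR_def[abs_def] by simp
qed

lemma emeasure_pushforward_off_base:
  assumes sets: "sets \<mu> = sets (borel_of_top betaM)"
    and p: "p \<in> measurable (restrict_space \<mu> Rplus) (borel_of_top (MR :: 'a::{metric_space, zero} cpt topology))"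
    and A: "A \<in> sets (borel_of_top MR)" "A \<subseteq> MR_set - {iotaU 0}"
  shows "emeasure (pushforward_off_base p \<mu>) A = emeasure \<mu> {\<zeta> \<in> Rplus. p \<zeta> \<in> A}"
proof -
  let ?D = "distr (restrict_space \<mu> Rplus) (borel_of_top MR) p"
  have Rsub: "Rplus \<subseteq> space \<mu>"
    using sets_eq_imp_space_eq[OF sets] openin_subset[OF openin_Rplus] by auto
  have R: "Rplus \<inter> space \<mu> \<in> sets \<mu>" using Rplus_sets[OF sets] by auto
  have topMR: "topspace MR = (MR_set :: 'a cpt set)"
    using MR_setD(1) by (auto simp: MR_def)
  have off: "MR_set - {iotaU (0::'a)} \<in> sets (borel_of_top MR)"
  proof -
    have "MR_set - {iotaU (0::'a)} = {\<xi> \<in> space (borel_of_top MR). lipR rho \<xi> \<noteq> 0}"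
      using MR_base_unique extR_iotaU[of rho "0 :: 'a"] by (auto simp: topMR)
    also have "\<dots> \<in> sets (borel_of_top MR)" using extR_measurable_MR[of rho] by measurable
    finally show ?thesis .
  qed
  have "emeasure (pushforward_off_base p \<mu>) A = emeasure ?D A"
    unfolding pushforward_off_base_def
    using A(2) off by (intro emeasure_restrict_space) (auto simp: topMR Int_absorb2)
  also have "\<dots> = emeasure (restrict_space \<mu> Rplus) (p -` A \<inter> space (restrict_space \<mu> Rplus))"
    by (rule emeasure_distr[OF p A(1)])
  also have "p -` A \<inter> space (restrict_space \<mu> Rplus) = {\<zeta> \<in> Rplus. p \<zeta> \<in> A}"
    using Rsub by (auto simp: space_restrict_space)
  also have "emeasure (restrict_space \<mu> Rplus) {\<zeta> \<in> Rplus. p \<zeta> \<in> A} = emeasure \<mu> {\<zeta> \<in> Rplus. p \<zeta> \<in> A}"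
    using R by (intro emeasure_restrict_space) auto
  finally show ?thesis .
qed

section \<open>Properties of the constructed measure\<close>

context Jordan_pair
begin

context
  fixes \<mu> :: "('a \<times> 'a) cpt measure"
  assumes radon: "pos_radon betaM \<mu>"
    and integral_le: "\<And>u c f g. u \<in> bdd_cont \<Longrightarrow>
      (\<And>x y. x \<noteq> y \<Longrightarrow> u (x, y) \<le> c + (lip_apply f x - lip_apply g y) / dist x y) \<Longrightarrow>
      (\<integral>\<zeta>. \<zeta> u \<partial>\<mu>) \<le> c * norm \<phi> + P f - N g"
    and vanish_infinity: "\<And>e. 0 < e \<Longrightarrow> \<exists>n. P (rho - weight_op (cutoff n) rho) + N (rho - weight_op (cutoff n) rho) \<le> e"
    and vanish_zero: "\<And>e. 0 < e \<Longrightarrow> \<exists>n. P (weight_op (cutoff n) rho) + N (weight_op (cutoff n) rho) \<le> e"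
begin

lemma sets_eq: "sets \<mu> = sets (borel_of_top betaM)"
  and finite: "finite_measure \<mu>" and space_eq: "space \<mu> = topspace betaM"
  using radon by (auto simp: pos_radon_def)

lemma coordinate_measurable: "u \<in> bdd_cont \<Longrightarrow> (\<lambda>\<zeta>. \<zeta> u) \<in> borel_measurable \<mu>"
  using continuous_map_measurable[OF continuous_map_coordinate[of u bdd_cont Mtilde]] sets_eq
  by (simp add: betaM_def)

lemma coordinate_integrable:
  assumes u: "u \<in> bdd_cont"
  shows "integrable \<mu> (\<lambda>\<zeta>. \<zeta> u)"
proof -
  interpret finite_measure \<mu> by (rule finite)
  have "compact ((\<lambda>\<zeta>. \<zeta> u) ` topspace betaM)"
    using image_compactin[OF compact_betaM[unfolded compact_space_def], of euclideanreal "\<lambda>\<zeta>. \<zeta> u"]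
      continuous_map_coordinate[OF u, of Mtilde] by (simp add: betaM_def)
  then obtain B where "\<And>\<zeta>. \<zeta> \<in> topspace betaM \<Longrightarrow> norm (\<zeta> u) \<le> B"
    using compact_imp_bounded bounded_iff by (metis image_eqI)
  then show ?thesis
    by (intro integrable_const_bound[where B = B] coordinate_measurable u) (auto simp: space_eq)
qed

text \<open>Equal functions in both slots and \<open>c = 0\<close> bound the integral of the
  quotient by \<open>\<phi> f\<close>; the same inequality for \<open>- f\<close> is the reverse
  bound.\<close>

lemma representation: "de_Leeuw_adj \<mu> = \<phi>"
proof (rule blinfun_eqI)
  fix f :: "'a lip0"
  let ?u = "\<lambda>(x, y). (lip_apply f x - lip_apply f y) / dist x y"
  have "(\<integral>\<zeta>. \<zeta> ?u \<partial>\<mu>) \<le> 0 * norm \<phi> + P f - N f"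
    by (rule integral_le[OF quotient_bdd_cont]) simp
  moreover have "- (\<integral>\<zeta>. \<zeta> ?u \<partial>\<mu>) \<le> 0 * norm \<phi> + P (- f) - N (- f)"
  proof -
    let ?v = "\<lambda>(x, y). (lip_apply (- f) x - lip_apply (- f) y) / dist x y"
    have "(\<integral>\<zeta>. \<zeta> ?v \<partial>\<mu>) \<le> 0 * norm \<phi> + P (- f) - N (- f)"
      by (rule integral_le[OF quotient_bdd_cont]) simp
    moreover have "(\<integral>\<zeta>. \<zeta> ?v \<partial>\<mu>) = (\<integral>\<zeta>. - \<zeta> ?u \<partial>\<mu>)"
    proof (rule Bochner_Integration.integral_cong)
      fix \<zeta> assume "\<zeta> \<in> space \<mu>"
      then have z: "\<zeta> \<in> topspace betaM" by (simp add: space_eq)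
      have "de_Leeuw (- f) \<zeta> = - de_Leeuw f \<zeta>" using de_Leeuw_linear(2)[OF z, of "- 1" f] by simp
      then show "\<zeta> ?v = - \<zeta> ?u" by (simp only: de_Leeuw_eq[OF z])
    qed simp
    ultimately show ?thesis by simp
  qed
  moreover have "(\<integral>\<zeta>. de_Leeuw f \<zeta> \<partial>\<mu>) = (\<integral>\<zeta>. \<zeta> ?u \<partial>\<mu>)"
    by (rule Bochner_Integration.integral_cong) (auto simp: space_eq de_Leeuw_eq)
  ultimately show "blinfun_apply (de_Leeuw_adj \<mu>) f = blinfun_apply \<phi> f"
    using de_Leeuw_adj_apply[OF sets_eq finite, of f] by (simp add: \<phi>_eq P_simps N_simps)
qed

text \<open>A constant is its own majorant with \<open>f = g = 0\<close>; \<open>c = 1\<close> and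
  \<open>c = - 1\<close> give the two inequalities.\<close>

lemma total_mass: "measure \<mu> (space \<mu>) = norm \<phi>"
proof -
  have const: "(\<integral>\<zeta>. \<zeta> (\<lambda>_. c) \<partial>\<mu>) = c * measure \<mu> (space \<mu>)" for c :: real
  proof -
    have c: "(\<lambda>_. c) \<in> (bdd_cont :: ('a \<times> 'a \<Rightarrow> real) set)" by (rule bdd_contI) auto
    have "\<zeta> (\<lambda>_. c) = c" if z: "\<zeta> \<in> topspace betaM" for \<zeta> :: "('a \<times> 'a) cpt"
      using tendsto_unique[OF filterB_nontrivial[OF z] filterB_coordinate[OF z c] tendsto_const] .
    then have "(\<integral>\<zeta>. \<zeta> (\<lambda>_. c) \<partial>\<mu>) = (\<integral>\<zeta>. c \<partial>\<mu>)"
      by (intro Bochner_Integration.integral_cong) (auto simp: space_eq)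
    then show ?thesis by (simp add: mult.commute)
  qed
  have "(\<integral>\<zeta>. \<zeta> (\<lambda>_. c) \<partial>\<mu>) \<le> c * norm \<phi> + P 0 - N 0" for c :: real
    by (rule integral_le) (auto intro: bdd_contI)
  then have "c * measure \<mu> (space \<mu>) \<le> c * norm \<phi>" for c :: real
    by (simp add: const P_simps N_simps)
  from this[of 1] this[of "- 1"] show ?thesis by simp
qed

text \<open>Near \<open>\<zeta>\<close> the quotient \<open>(f(x) + f(y)) / d(x, y)\<close> is at
  least 1/2, a bound that survives truncation at 1 and passage to the limit.\<close>

abbreviation half_dominates :: "'a lip0 \<Rightarrow> ('a \<times> 'a) cpt \<Rightarrow> bool"
  where "half_dominates f \<zeta> \<equiv> eventually (\<lambda>z. dist (fst z) (snd z)
    \<le> 2 * (lip_apply f (fst z) + lip_apply f (snd z))) (filterB \<zeta>)"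

text \<open>Markov's inequality for the test function
  \<open>min 1 ((f(x) + f(y)) / d(x, y))\<close>: its integral is at most \<open>P f + N f\<close>,
  by the majorant with slots \<open>f\<close> and \<open>- f\<close>, and it is at least 1/2 on
  \<open>B\<close>.\<close>

lemma null_set_criterion:
  assumes B: "B \<in> sets \<mu>"
    and test: "\<And>e. 0 < e \<Longrightarrow> \<exists>f. lip_nonneg f \<and> P f + N f \<le> e \<and>
      (\<forall>\<zeta>\<in>B. half_dominates f \<zeta>)"
  shows "emeasure \<mu> B = 0"
proof -
  interpret finite_measure \<mu> by (rule finite)
  have "measure \<mu> B \<le> 0 + e" if e: "0 < e" for e
  proof -
    obtain f where f: "lip_nonneg f" "P f + N f \<le> e / 2"
      "\<And>\<zeta>. \<zeta> \<in> B \<Longrightarrow> half_dominates f \<zeta>"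
      using test[OF half_gt_zero[OF e]] by blast
    define u where "u z = min 1 ((lip_apply f (fst z) + lip_apply f (snd z)) / dist (fst z) (snd z))" for z
    have c: "continuous_on UNIV (lip_apply f)"
      by (rule lipschitz_on_continuous_on[OF lip_apply_lipschitz])
    have u0: "0 \<le> u z" for z using f(1) by (simp add: u_def)
    have u: "u \<in> bdd_cont"
    proof (rule bdd_contI[where B = 1])
      show "continuous_on Mtilde u"
        unfolding u_def[abs_def]
        by (intro continuous_intros continuous_on_compose2[OF c]) (auto simp: Mtilde_def)
      show "\<bar>u z\<bar> \<le> 1" for z using u0[of z] by (simp add: u_def)
    qed
    have "(\<integral>\<zeta>. \<zeta> u \<partial>\<mu>) \<le> 0 * norm \<phi> + P f - N (- f)"
      by (rule integral_le[OF u]) (simp add: u_def)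
    then have int: "(\<integral>\<zeta>. \<zeta> u \<partial>\<mu>) \<le> e / 2" using f(2) by (simp add: N_simps)
    have z0: "0 \<le> \<zeta> u" if z: "\<zeta> \<in> topspace betaM" for \<zeta>
      by (rule tendsto_lowerbound[OF filterB_coordinate[OF z u] _ filterB_nontrivial[OF z]]) (simp add: u0)
    have zB: "1 / 2 \<le> \<zeta> u" if zB: "\<zeta> \<in> B" for \<zeta>
    proof -
      have z: "\<zeta> \<in> topspace betaM" using zB sets.sets_into_space[OF B] by (auto simp: space_eq)
      have "eventually (\<lambda>z. 1 / 2 \<le> u z) (filterB \<zeta>)"
        using f(3)[OF zB] filterB_distinct[OF z]
        by eventually_elim (simp add: u_def le_divide_eq)
      then show ?thesis
        by (rule tendsto_lowerbound[OF filterB_coordinate[OF z u] _ filterB_nontrivial[OF z]])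
    qed
    have "(\<integral>\<zeta>. indicator B \<zeta> * (1 / 2) \<partial>\<mu>) \<le> (\<integral>\<zeta>. \<zeta> u \<partial>\<mu>)"
    proof (rule integral_mono)
      show "integrable \<mu> (\<lambda>\<zeta>. indicator B \<zeta> * (1 / 2 :: real))"
        using B by (auto simp: emeasure_eq_measure)
      show "indicator B \<zeta> * (1 / 2) \<le> \<zeta> u" if "\<zeta> \<in> space \<mu>" for \<zeta>
        using z0[of \<zeta>] zB[of \<zeta>] that by (auto simp: space_eq indicator_def)
    qed (rule coordinate_integrable[OF u])
    moreover have "(\<integral>\<zeta>. indicator B \<zeta> * (1 / 2) \<partial>\<mu>) = measure \<mu> B * (1 / 2)"
      using sets.Int_space_eq2[OF B] by simp
    ultimately show ?thesis using int by simp
  qed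
  then have "measure \<mu> B \<le> 0" by (rule field_le_epsilon)
  then have "measure \<mu> B = 0" using measure_nonneg[of \<mu> B] by linarith
  then show ?thesis by (simp add: emeasure_eq_measure)
qed

lemma extU_rho_coord_measurable:
  "(\<lambda>\<zeta>. extU (lip_apply rho) (coord1 \<zeta>)) \<in> borel_measurable \<mu>"
  "(\<lambda>\<zeta>. extU (lip_apply rho) (coord2 \<zeta>)) \<in> borel_measurable \<mu>"
  using continuous_map_measurable[OF continuous_map_compose[OF coord1_continuous extU_continuous[OF lip_apply_lipschitz[of rho]]] sets_eq]
    continuous_map_measurable[OF continuous_map_compose[OF coord2_continuous extU_continuous[OF lip_apply_lipschitz[of rho]]] sets_eq]
  by (simp_all add: comp_def)

text \<open>The part of \<open>rho\<close> left over by a wide cutoff has small cost and coincides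
  with \<open>rho\<close> far out. If one point of a pair is far out, this function sees the larger
  of the two radii, and the distance is at most twice that radius; the factor 2 pays for a point
  that the function does not see.\<close>

lemma AE_MR: "AE \<zeta> in \<mu>. coord1 \<zeta> \<in> MR_set \<and> coord2 \<zeta> \<in> MR_set"
proof -
  define B where "B = {\<zeta> \<in> space \<mu>. extU (lip_apply rho) (coord1 \<zeta>) = \<infinity> \<or> extU (lip_apply rho) (coord2 \<zeta>) = \<infinity>}"
  have B: "B \<in> sets \<mu>"
    unfolding B_def using extU_rho_coord_measurable by measurable
  have "emeasure \<mu> B = 0"
  proof (rule null_set_criterion[OF B])
    fix e :: real assume "0 < e"
    then obtain n where n: "P (rho - weight_op (cutoff n) rho) + N (rho - weight_op (cutoff n) rho) \<le> e"
      using vanish_infinity by blast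
    let ?f = "rho - weight_op (cutoff n) rho :: 'a lip0"
    have f: "lip_apply ?f x = dist x 0 * (1 - cutoff_profile n (dist x 0))" for x
      by (simp add: cutoff_eq_profile[symmetric] algebra_simps)
    have f0: "0 \<le> lip_apply ?f x" for x
      unfolding f using cutoff_profile_bounds(2)[of n] by simp
    have key: "dist x y \<le> 2 * (lip_apply ?f x + lip_apply ?f y)" if big: "2 powi (n + 1) \<le> dist x 0" for x y
    proof -
      have x: "lip_apply ?f x = dist x 0" unfolding f cutoff_profile_eq_0[OF big] by simp
      show ?thesis
      proof (cases "dist y 0 \<le> dist x 0")
        case True
        then have "dist x y \<le> 2 * dist x 0" using dist_le_base_sum[of x y] by linarith
        also have "2 * dist x 0 \<le> 2 * (dist x 0 + lip_apply ?f y)"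
          using f0[of y] by (intro mult_left_mono add_increasing2) auto
        finally show ?thesis unfolding x .
      next
        case False
        then have "2 powi (n + 1) \<le> dist y 0" using big by simp
        from cutoff_profile_eq_0[OF this] have "lip_apply ?f y = dist y 0" unfolding f by simp
        then show ?thesis unfolding x by (simp only: dist_le_twice_base_sum)
      qed
    qed
    have "half_dominates ?f \<zeta>"
      if \<zeta>B: "\<zeta> \<in> B" for \<zeta>
    proof -
      have z: "\<zeta> \<in> topspace betaM" using \<zeta>B by (simp add: B_def space_eq)
      note t = extU_coord_tendsto[OF lip_apply_lipschitz z, of rho]
      consider "extU (lip_apply rho) (coord1 \<zeta>) = \<infinity>" | "extU (lip_apply rho) (coord2 \<zeta>) = \<infinity>"
        using \<zeta>B unfolding B_def by blast
      then show ?thesis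
      proof cases
        case 1
        have "eventually (\<lambda>z. ereal (2 powi (n + 1)) < ereal (lip_apply rho (fst z))) (filterB \<zeta>)"
          by (rule order_tendstoD(1)[OF t(1)]) (simp add: 1)
        then show ?thesis by eventually_elim (rule key, simp)
      next
        case 2
        have "eventually (\<lambda>z. ereal (2 powi (n + 1)) < ereal (lip_apply rho (snd z))) (filterB \<zeta>)"
          by (rule order_tendstoD(1)[OF t(2)]) (simp add: 2)
        then show ?thesis
        proof eventually_elim
          case (elim z)
          then show ?case using key[of "snd z" "fst z"] by (simp add: dist_commute)
        qed
      qed
    qed
    then show "\<exists>f. lip_nonneg f \<and> P f + N f \<le> e \<and>
      (\<forall>\<zeta>\<in>B. half_dominates f \<zeta>)"
      using n f0 by blast
  qed
  then have "AE \<zeta> in \<mu>. \<zeta> \<notin> B" using B by (intro AE_not_in) auto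
  then show ?thesis
    using AE_space
  proof eventually_elim
    case (elim \<zeta>)
    then show ?case
      using coord_topspace[of \<zeta>] by (auto simp: B_def space_eq MR_set_def lip_apply_rho_fun less_top)
  qed
qed

text \<open>Near the base point \<open>rho\<close> times a narrow cutoff equals \<open>rho\<close>,
  and the sum of the two radii dominates the distance, while the cost of this function is
  small.\<close>

lemma AE_not_base: "AE \<zeta> in \<mu>. extU (lip_apply rho) (coord1 \<zeta>) \<noteq> 0 \<or> extU (lip_apply rho) (coord2 \<zeta>) \<noteq> 0"
proof -
  define B where "B = {\<zeta> \<in> space \<mu>. extU (lip_apply rho) (coord1 \<zeta>) = 0 \<and> extU (lip_apply rho) (coord2 \<zeta>) = 0}"
  have B: "B \<in> sets \<mu>"
    unfolding B_def using extU_rho_coord_measurable by measurable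
  have "emeasure \<mu> B = 0"
  proof (rule null_set_criterion[OF B])
    fix e :: real assume "0 < e"
    then obtain n where n: "P (weight_op (cutoff n) rho) + N (weight_op (cutoff n) rho) \<le> e"
      using vanish_zero by blast
    let ?f = "weight_op (cutoff n) rho :: 'a lip0"
    have f: "lip_apply ?f x = dist x 0 * cutoff_profile n (dist x 0)" for x
      by (simp add: cutoff_eq_profile[symmetric])
    have f0: "0 \<le> lip_apply ?f x" for x
      unfolding f using cutoff_profile_bounds(1)[of n] by simp
    have "half_dominates ?f \<zeta>"
      if "\<zeta> \<in> B" for \<zeta>
    proof -
      have z: "\<zeta> \<in> topspace betaM" using that by (simp add: B_def space_eq)
      note t = extU_coord_tendsto[OF lip_apply_lipschitz z, of rho]
      have "eventually (\<lambda>z. ereal (lip_apply rho (fst z)) < ereal (2 powi n)) (filterB \<zeta>)"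
        by (rule order_tendstoD(2)[OF t(1)]) (use that in \<open>simp add: B_def\<close>)
      moreover have "eventually (\<lambda>z. ereal (lip_apply rho (snd z)) < ereal (2 powi n)) (filterB \<zeta>)"
        by (rule order_tendstoD(2)[OF t(2)]) (use that in \<open>simp add: B_def\<close>)
      ultimately show ?thesis
      proof eventually_elim
        case (elim z)
        then have eq: "lip_apply ?f (fst z) = dist (fst z) 0" "lip_apply ?f (snd z) = dist (snd z) 0"
          unfolding f by (simp_all add: cutoff_profile_eq_1)
        show ?case unfolding eq by (rule dist_le_twice_base_sum)
      qed
    qed
    then show "\<exists>f. lip_nonneg f \<and> P f + N f \<le> e \<and>
      (\<forall>\<zeta>\<in>B. half_dominates f \<zeta>)"
      using n f0 by blast
  qed
  then have "AE \<zeta> in \<mu>. \<zeta> \<notin> B" using B by (intro AE_not_in) auto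
  then show ?thesis using AE_space by eventually_elim (simp add: B_def)
qed

text \<open>With the denominator \<open>rho(x) + rho(y)\<close> the test function is bounded by 1
  and its limit is explicit even where the distance tends to 0; this matters because concentration
  on \<open>Rplus\<close> is deduced from this lemma. By \<open>AE_MR\<close> and
  \<open>AE_not_base\<close> the limiting denominator is finite and positive almost
  everywhere.\<close>

lemma separating_sequence:
  "\<exists>g :: nat \<Rightarrow> 'a lip0.
    (AE \<zeta> in \<mu>. (\<lambda>k. val1 (g k) \<zeta>) \<longlonglongrightarrow> val1 rho \<zeta>) \<and>
    (AE \<zeta> in \<mu>. (\<lambda>k. val2 (g k) \<zeta>) \<longlonglongrightarrow> 0)"
proof -
  have "\<exists>g. lip_nonneg g \<and> lip_nonneg (rho - g) \<and> P (rho - g) + N g \<le> (1/2) ^ k" for k :: nat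
    by (rule orthogonal) auto
  then obtain g where g: "\<And>k::nat. lip_nonneg (g k)" "\<And>k. lip_nonneg (rho - g k)"
    "\<And>k. P (rho - g k) + N (g k) \<le> (1/2) ^ k"
    by metis
  define w where "w k z = (lip_apply (rho - g k) (fst z) + lip_apply (g k) (snd z)) / (dist (fst z) 0 + dist (snd z) 0)" for k z
  have num_nonneg: "0 \<le> lip_apply (rho - g k) x + lip_apply (g k) y" for k x y
    using g(1,2) by (meson add_nonneg_nonneg)
  have denom: "0 < dist x 0 + dist y 0" if "x \<noteq> y" for x y :: 'a
    using that zero_less_dist_iff[of x y] dist_le_base_sum[of x y] by linarith
  have w0: "0 \<le> w k z" for k z
    unfolding w_def using num_nonneg by (intro divide_nonneg_nonneg) auto
  have w: "w k \<in> bdd_cont" for k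
  proof (rule bdd_contI[where B = 1])
    have c: "continuous_on UNIV (lip_apply f)" for f :: "'a lip0"
      by (rule lipschitz_on_continuous_on[OF lip_apply_lipschitz])
    show "continuous_on Mtilde (w k)"
      unfolding w_def[abs_def]
    proof (intro continuous_intros continuous_on_compose2[OF c])
      show "\<forall>z\<in>Mtilde. dist (fst z) 0 + dist (snd z) (0::'a) \<noteq> 0"
        using denom by (fastforce simp: Mtilde_def)
    qed auto
    fix z :: "'a \<times> 'a" assume "z \<in> Mtilde"
    then have "0 < dist (fst z) 0 + dist (snd z) 0" using denom by (auto simp: Mtilde_def)
    moreover have "0 \<le> lip_apply (g k) (fst z)" "0 \<le> lip_apply (rho - g k) (snd z)" using g(1,2) by blast+
    ultimately have "w k z \<le> 1" by (simp add: w_def divide_le_eq)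
    then show "\<bar>w k z\<bar> \<le> 1" using w0[of k z] by simp
  qed
  have int: "(\<integral>\<zeta>. \<zeta> (w k) \<partial>\<mu>) \<le> (1/2) ^ k" for k
  proof -
    \<comment> \<open>The majorant has slots \<open>rho - g k\<close> and \<open>- g k\<close>, so
      its cost is \<open>P (rho - g k) + N (g k)\<close>.\<close>
    have "(\<integral>\<zeta>. \<zeta> (w k) \<partial>\<mu>) \<le> 0 * norm \<phi> + P (rho - g k) - N (- g k)"
    proof (rule integral_le[OF w])
      fix x y :: 'a assume "x \<noteq> y"
      then have "w k (x, y) \<le> (lip_apply (rho - g k) x + lip_apply (g k) y) / dist x y"
        unfolding w_def fst_conv snd_conv
        by (intro divide_left_mono dist_le_base_sum num_nonneg mult_pos_pos denom
            zero_less_dist_iff[THEN iffD2])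
      then show "w k (x, y) \<le> 0 + (lip_apply (rho - g k) x - lip_apply (- g k) y) / dist x y" by simp
    qed
    then show ?thesis using g(3)[of k] by (simp add: N_simps)
  qed
  have "AE \<zeta> in \<mu>. (\<lambda>k. \<zeta> (w k)) \<longlonglongrightarrow> 0"
  proof (rule AE_tendsto_0_if_integral_le_geometric[OF coordinate_integrable[OF w] _ int])
    fix \<zeta> k assume "\<zeta> \<in> space \<mu>"
    then have z: "\<zeta> \<in> topspace betaM" by (simp add: space_eq)
    show "0 \<le> \<zeta> (w k)"
      by (rule tendsto_lowerbound[OF filterB_coordinate[OF z w] _ filterB_nontrivial[OF z]]) (simp add: w0)
  qed
  then have both: "AE \<zeta> in \<mu>. (\<lambda>k. val1 (g k) \<zeta>) \<longlonglongrightarrow> val1 rho \<zeta> \<and>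
    (\<lambda>k. val2 (g k) \<zeta>) \<longlonglongrightarrow> 0"
    using AE_MR AE_not_base AE_space
  proof eventually_elim
    case (elim \<zeta>)
    have z: "\<zeta> \<in> topspace betaM" using elim(4) by (simp add: space_eq)
    have p: "coord1 \<zeta> \<in> MR_set" "coord2 \<zeta> \<in> MR_set" using elim(2) by auto
    let ?r1 = "val1 rho \<zeta>" and ?r2 = "val2 rho \<zeta>"
    let ?a = "\<lambda>k. val1 (rho - g k) \<zeta>" and ?b = "\<lambda>k. val2 (g k) \<zeta>"
    have "0 \<le> ?r1" "0 \<le> ?r2" by (intro extR_nonneg p; simp)+
    moreover have "?r1 \<noteq> 0 \<or> ?r2 \<noteq> 0" using elim(3) by (simp add: extU_lip0_real p)
    ultimately have r: "0 < ?r1 + ?r2" by linarith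
    have ab0: "0 \<le> ?a k" "0 \<le> ?b k" for k
      using extR_nonneg[OF p(1) g(2)] extR_nonneg[OF p(2) g(1)] by auto
    have zw: "\<zeta> (w k) = (?a k + ?b k) / (?r1 + ?r2)" for k
    proof (rule tendsto_unique[OF filterB_nontrivial[OF z] filterB_coordinate[OF z w]])
      have "((\<lambda>z. (lip_apply (rho - g k) (fst z) + lip_apply (g k) (snd z)) / (lip_apply rho (fst z) + lip_apply rho (snd z)))
        \<longlongrightarrow> (?a k + ?b k) / (?r1 + ?r2)) (filterB \<zeta>)"
        using r by (intro tendsto_intros extR_coord_tendsto z p) auto
      then show "(w k \<longlongrightarrow> (?a k + ?b k) / (?r1 + ?r2)) (filterB \<zeta>)"
        by (simp add: w_def[abs_def])
    qed
    have ab: "(\<lambda>k. ?a k + ?b k) \<longlonglongrightarrow> 0"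
      using tendsto_mult_right[OF elim(1), of "?r1 + ?r2"] r by (simp add: zw)
    have "?a \<longlonglongrightarrow> 0" "?b \<longlonglongrightarrow> 0"
      by (rule Lim_null_comparison[OF _ ab]; use ab0 in simp)+
    moreover have "val1 (g k) \<zeta> = ?r1 - ?a k" for k
      using extR_add[OF p(1), of "rho - g k" "g k"] by simp
    ultimately show ?case using tendsto_diff[OF tendsto_const[of ?r1], of ?a 0] by simp
  qed
  show ?thesis
  proof (intro exI conjI)
    show "AE \<zeta> in \<mu>. (\<lambda>k. val1 (g k) \<zeta>) \<longlonglongrightarrow> val1 rho \<zeta>"
      using both by eventually_elim simp
    show "AE \<zeta> in \<mu>. (\<lambda>k. val2 (g k) \<zeta>) \<longlonglongrightarrow> 0"
      using both by eventually_elim simp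
  qed
qed

text \<open>Where the coordinates agree, one sequence tends both to \<open>rho\<close> and to 0, so
  \<open>rho\<close> vanishes at both of them, which \<open>AE_not_base\<close> excludes.\<close>

lemma AE_Rplus: "AE \<zeta> in \<mu>. \<zeta> \<in> Rplus"
proof -
  obtain g :: "nat \<Rightarrow> 'a lip0" where
    "AE \<zeta> in \<mu>. (\<lambda>k. val1 (g k) \<zeta>) \<longlonglongrightarrow> val1 rho \<zeta>"
    "AE \<zeta> in \<mu>. (\<lambda>k. val2 (g k) \<zeta>) \<longlonglongrightarrow> 0"
    using separating_sequence by blast
  from this AE_MR AE_not_base AE_space show ?thesis
  proof eventually_elim
    case (elim \<zeta>)
    have "coord1 \<zeta> \<noteq> coord2 \<zeta>"
    proof
      assume eq: "coord1 \<zeta> = coord2 \<zeta>"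
      have "val1 rho \<zeta> = 0"
        using LIMSEQ_unique[OF elim(1)] elim(2) eq by simp
      then show False using elim(3,4) eq by (simp add: extU_lip0_real)
    qed
    then show ?case using elim by (simp add: Rplus_def space_eq)
  qed
qed

text \<open>The truncations \<open>min n (rho(x) / d(x, y))\<close> have the majorant
  \<open>f = rho\<close>, \<open>g = 0\<close>, \<open>c = 0\<close>, so their integrals are at most
  \<open>P rho\<close>; Fatou's lemma transfers this bound to the moment.\<close>

lemma finite_moment: "(\<integral>\<^sup>+\<zeta>\<in>Rplus. (ennreal (dbar (coord1 \<zeta>) (iotaU 0)) / dist_ext \<zeta>) \<partial>\<mu>) < \<infinity>"
proof -
  define u where "u n z = min (real n) (dist (fst z) 0 / dist (fst z) (snd z))" for n and z :: "'a \<times> 'a"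
  have u0: "0 \<le> u n z" for n z by (simp add: u_def)
  have u: "u n \<in> bdd_cont" for n
  proof (rule bdd_contI[where B = "real n"])
    show "continuous_on Mtilde (u n)"
      unfolding u_def[abs_def] by (intro continuous_intros) (auto simp: Mtilde_def)
    show "\<bar>u n z\<bar> \<le> real n" for z using u0[of n z] by (simp add: u_def)
  qed
  have z0: "0 \<le> \<zeta> (u n)" if z: "\<zeta> \<in> topspace betaM" for \<zeta> n
    by (rule tendsto_lowerbound[OF filterB_coordinate[OF z u] _ filterB_nontrivial[OF z]]) (simp add: u0)
  have [measurable]: "(\<lambda>\<zeta>. \<zeta> (u n)) \<in> borel_measurable \<mu>" for n by (rule coordinate_measurable[OF u])
  have int: "(\<integral>\<^sup>+\<zeta>. ennreal (\<zeta> (u n)) \<partial>\<mu>) \<le> ennreal (P rho)" for n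
  proof -
    have "(\<integral>\<zeta>. \<zeta> (u n) \<partial>\<mu>) \<le> 0 * norm \<phi> + P rho - N 0"
      by (rule integral_le[OF u]) (simp add: u_def)
    then have "(\<integral>\<zeta>. \<zeta> (u n) \<partial>\<mu>) \<le> P rho" by (simp add: N_simps)
    moreover have "AE \<zeta> in \<mu>. 0 \<le> \<zeta> (u n)"
      using AE_space by eventually_elim (simp add: z0 space_eq)
    ultimately show ?thesis
      using nn_integral_eq_integral[OF coordinate_integrable[OF u[of n]]] by (simp add: ennreal_leI)
  qed
  let ?t = "\<lambda>\<zeta>. val1 rho \<zeta> / pair_dist \<zeta>"
  have val: "\<zeta> (u n) = min (real n) (?t \<zeta>)" if R: "\<zeta> \<in> Rplus" for \<zeta> n
  proof (rule tendsto_unique[OF filterB_nontrivial filterB_coordinate[OF _ u]])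
    show z: "\<zeta> \<in> topspace betaM" "\<zeta> \<in> topspace betaM" using RplusD[OF R] by auto
    have "((\<lambda>z. min (real n) (lip_apply rho (fst z) / dist (fst z) (snd z))) \<longlongrightarrow> min (real n) (?t \<zeta>)) (filterB \<zeta>)"
      using RplusD[OF R] pair_dist_pos[OF R]
      by (intro tendsto_min tendsto_divide tendsto_const extR_coord_tendsto pair_dist_finite) auto
    then show "(u n \<longlongrightarrow> min (real n) (?t \<zeta>)) (filterB \<zeta>)" by (simp add: u_def[abs_def])
  qed
  have "(\<integral>\<^sup>+\<zeta>\<in>Rplus. (ennreal (dbar (coord1 \<zeta>) (iotaU 0)) / dist_ext \<zeta>) \<partial>\<mu>)
      \<le> (\<integral>\<^sup>+\<zeta>. liminf (\<lambda>n. ennreal (\<zeta> (u n))) \<partial>\<mu>)"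
  proof (rule nn_integral_mono_AE)
    show "AE \<zeta> in \<mu>. ennreal (dbar (coord1 \<zeta>) (iotaU 0)) / dist_ext \<zeta> * indicator Rplus \<zeta>
        \<le> liminf (\<lambda>n. ennreal (\<zeta> (u n)))"
      using AE_Rplus
    proof eventually_elim
      case (elim \<zeta>)
      note R = RplusD[OF elim] and d = pair_dist_pos[OF elim]
      have r0: "0 \<le> val1 rho \<zeta>" by (rule extR_nonneg[OF R(2)]) simp
      obtain m :: nat where m: "?t \<zeta> \<le> real m" using real_arch_simple by blast
      have "\<zeta> (u n) = ?t \<zeta>" if "m \<le> n" for n
        using that m unfolding val[OF elim] by (simp add: min_def)
      then have "eventually (\<lambda>n. ennreal (\<zeta> (u n)) = ennreal (?t \<zeta>)) sequentially"
        by (intro eventually_mono[OF eventually_ge_at_top[of m]]) simp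
      then have "(\<lambda>n. ennreal (\<zeta> (u n))) \<longlonglongrightarrow> ennreal (?t \<zeta>)" by (rule tendsto_eventually)
      then have "liminf (\<lambda>n. ennreal (\<zeta> (u n))) = ennreal (?t \<zeta>)"
        by (intro lim_imp_Liminf) auto
      moreover have "ennreal (dbar (coord1 \<zeta>) (iotaU 0)) / dist_ext \<zeta> = ennreal (?t \<zeta>)"
        using d r0 by (simp add: dbar_base[OF R(2)] pair_dist_finite(1)[OF R(1-3)] divide_ennreal)
      ultimately show ?case by (simp add: indicator_def)
    qed
  qed
  also have "\<dots> \<le> liminf (\<lambda>n. \<integral>\<^sup>+\<zeta>. ennreal (\<zeta> (u n)) \<partial>\<mu>)"
    by (rule nn_integral_liminf) simp
  also have "\<dots> \<le> liminf (\<lambda>n::nat. ennreal (P rho))"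
    by (rule Liminf_mono) (simp add: int)
  also have "\<dots> = ennreal (P rho)" by (simp add: Liminf_const)
  also have "\<dots> < \<infinity>" by simp
  finally show ?thesis .
qed

lemma admissible_\<mu>: "admissible_representation \<mu> \<phi>"
proof -
  have R: "Rplus \<in> sets \<mu>" unfolding sets_eq by (rule borel_of_top_open[OF openin_Rplus])
  then have D: "space \<mu> - Rplus \<in> sets \<mu>" by auto
  have "emeasure \<mu> (space \<mu> - Rplus) = 0"
    using AE_Rplus AE_iff_measurable[OF D, of "\<lambda>\<zeta>. \<zeta> \<in> Rplus"] by auto
  then have "concentrated_on \<mu> Rplus"
    using R D by (simp add: concentrated_on_def emeasure_completion main_part_sets)
  then show ?thesis
    using radon representation total_mass finite_moment
    by (simp add: admissible_representation_def optimal_representation_def M_op_def)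
qed

text \<open>The separating set consists of the points off the base where the lower limit of
  \<open>g k\<close> is 0. It carries the second marginal and is null for the first, whose limit
  \<open>rho\<close> is nonzero off the base. A lower limit in the extended reals is measurable even
  where the sequence diverges.\<close>

lemma singular_pushforwards:
  "mutually_singular (pushforward_off_base coord1 \<mu>) (pushforward_off_base coord2 \<mu>)"
proof -
  obtain g :: "nat \<Rightarrow> 'a lip0" where g: "AE \<zeta> in \<mu>. (\<lambda>k. val1 (g k) \<zeta>) \<longlonglongrightarrow> val1 rho \<zeta>"
    "AE \<zeta> in \<mu>. (\<lambda>k. val2 (g k) \<zeta>) \<longlonglongrightarrow> 0"
    using separating_sequence by blast
  let ?B = "borel_of_top MR :: 'a cpt measure"
  let ?O = "MR_set - {iotaU (0::'a)}"
  have topMR: "topspace MR = (MR_set :: 'a cpt set)" using MR_setD(1) by (auto simp: MR_def)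
  have r0: "lipR rho \<xi> \<noteq> 0" if "\<xi> \<in> ?O" for \<xi>
    using that MR_base_unique by auto
  have O: "?O = {\<xi> \<in> space ?B. lipR rho \<xi> \<noteq> 0}"
    using MR_base_unique extR_iotaU[of rho "0 :: 'a"] by (auto simp: topMR)
  have Os: "?O \<in> sets ?B"
    unfolding O using extR_measurable_MR[of rho] by measurable
  define A where "A = {\<xi> \<in> ?O. liminf (\<lambda>k. ereal (lipR (g k) \<xi>)) = 0}"
  have limit: "liminf (\<lambda>k. ereal (lipR (g k) \<xi>)) = ereal l"
    if "(\<lambda>k. lipR (g k) \<xi>) \<longlonglongrightarrow> l" for \<xi> l
    using that by (intro lim_imp_Liminf) auto
  have As: "A \<in> sets ?B"
  proof -
    note [measurable] = extR_measurable_MR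
    show ?thesis unfolding A_def O by measurable
  qed
  have Asub: "A \<subseteq> ?O" by (auto simp: A_def)
  have setsP: "sets (pushforward_off_base p \<mu>) = sets (restrict_space ?B ?O)" for p
    unfolding pushforward_off_base_def by (rule sets_restrict_space_cong) simp
  have spaceP: "space (pushforward_off_base p \<mu>) = ?O" for p
    using sets_eq_imp_space_eq[OF setsP[of p]] topMR by (auto simp: space_restrict_space)
  have AsP: "A \<in> sets (pushforward_off_base p \<mu>)" for p
    unfolding setsP using As Asub Os by (subst sets_restrict_space_iff) (auto simp: topMR Int_absorb2)
  have null: "emeasure \<mu> {\<zeta> \<in> Rplus. p \<zeta> \<in> S} = 0" if "AE \<zeta> in \<mu>. p \<zeta> \<notin> S" for p S
  proof -
    have "{\<zeta> \<in> Rplus. p \<zeta> \<in> S} = {\<zeta> \<in> space \<mu>. \<zeta> \<in> Rplus \<and> p \<zeta> \<in> S}"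
      using RplusD(1) by (auto simp: space_eq)
    moreover have "AE \<zeta> in \<mu>. \<not> (\<zeta> \<in> Rplus \<and> p \<zeta> \<in> S)" using that by eventually_elim simp
    ultimately show ?thesis by (simp add: emeasure_eq_0_AE)
  qed
  note m1 = coord_measurable_MR(1)[OF sets_eq] and m2 = coord_measurable_MR(2)[OF sets_eq]
  have "emeasure (pushforward_off_base coord1 \<mu>) A = 0"
    unfolding emeasure_pushforward_off_base[OF sets_eq m1 As Asub]
  proof (rule null)
    show "AE \<zeta> in \<mu>. coord1 \<zeta> \<notin> A"
      using g(1)
    proof eventually_elim
      case (elim \<zeta>)
      then show ?case using limit r0 by (auto simp: A_def)
    qed
  qed
  moreover have "emeasure (pushforward_off_base coord2 \<mu>) (?O - A) = 0"
  proof -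
    have S: "?O - A \<in> sets ?B" using Os As by auto
    show ?thesis
      unfolding emeasure_pushforward_off_base[OF sets_eq m2 S Diff_subset]
    proof (rule null)
      show "AE \<zeta> in \<mu>. coord2 \<zeta> \<notin> ?O - A"
        using g(2)
      proof eventually_elim
        case (elim \<zeta>)
        from limit[OF elim] show ?case by (simp add: A_def)
      qed
    qed
  qed
  ultimately show ?thesis
    unfolding mutually_singular_def using AsP by (auto simp: setsP spaceP)
qed

end

end

section \<open>Existence of a representation with singular marginals\<close>

theorem ex_admissible_singular:
  fixes \<phi> :: "'a::{metric_space, zero} lip0 \<Rightarrow>\<^sub>L real"
  assumes maj: "majorisable \<phi>" and zero: "avoids_zero \<phi>" and inf: "avoids_infinity \<phi>"
  shows "\<exists>\<mu>. admissible_representation \<mu> \<phi> \<and>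
    mutually_singular (pushforward_off_base coord1 \<mu>) (pushforward_off_base coord2 \<mu>)"
proof -
  obtain P N where "Jordan_pair \<phi> P N" using Jordan_decomposition[OF maj] by blast
  then interpret Jordan_pair \<phi> P N .
  have pointwise: "((\<lambda>n. blinfun_apply \<phi> (weight_op (h n) f)) \<longlongrightarrow> blinfun_apply \<phi> f) at_top"
    if "((\<lambda>n. weight_op_adj (h n) \<phi>) \<longlongrightarrow> \<phi>) at_top" for h :: "int \<Rightarrow> 'a \<Rightarrow> real" and f
    using blinfun.tendsto[OF that tendsto_const[of f]] by (simp add: weight_op_adj_def)
  have v1: "((\<lambda>n. P (rho - weight_op (cutoff n) rho) + N (rho - weight_op (cutoff n) rho)) \<longlongrightarrow> 0) (at_top :: int filter)"
  proof (rule parts_vanish[where W = "\<lambda>n. blinfun_apply (weight_op (cutoff n))" and h = cutoff])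
    show "0 \<le> cutoff n x \<and> cutoff n x \<le> 1" for n and x :: 'a
      by (simp add: cutoff_eq_profile cutoff_profile_bounds)
    show "((\<lambda>n. blinfun_apply \<phi> (weight_op (cutoff n) f)) \<longlongrightarrow> blinfun_apply \<phi> f) at_top" for f
      using inf unfolding avoids_infinity_def by (rule pointwise)
  qed simp_all
  have v2: "((\<lambda>n. P (rho - weight_op (\<lambda>x. 1 - cutoff (- n) x) rho) + N (rho - weight_op (\<lambda>x. 1 - cutoff (- n) x) rho)) \<longlongrightarrow> 0) (at_top :: int filter)"
  proof (rule parts_vanish[where W = "\<lambda>n. blinfun_apply (weight_op (\<lambda>x. 1 - cutoff (- n) x))" and h = "\<lambda>n x. 1 - cutoff (- n) x"])
    show "0 \<le> 1 - cutoff (- n) x \<and> 1 - cutoff (- n) x \<le> 1" for n and x :: 'a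
      by (simp add: cutoff_eq_profile cutoff_profile_bounds)
    show "((\<lambda>n. blinfun_apply \<phi> (weight_op (\<lambda>x. 1 - cutoff (- n) x) f)) \<longlongrightarrow> blinfun_apply \<phi> f) at_top" for f
      using zero unfolding avoids_zero_def by (rule pointwise)
  qed simp_all
  \<comment> \<open>Complementing the weight twice returns the cutoff itself, so smallness near the
    base point takes the form required of the measure.\<close>
  have compl: "rho - weight_op (\<lambda>x. 1 - cutoff n x) rho = (weight_op (cutoff n) rho :: 'a lip0)" for n
    by (rule lip0_eqI) (simp add: algebra_simps)
  have small: "\<exists>n. F n \<le> e" if "(F \<longlongrightarrow> 0) at_top" "0 < e" for F :: "int \<Rightarrow> real" and e
  proof -
    have "eventually (\<lambda>n. F n < e) at_top" by (rule order_tendstoD(2)[OF that])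
    then obtain n where "F n < e" unfolding eventually_at_top_linorder by blast
    then show ?thesis by (intro exI[of _ n]) simp
  qed
  obtain \<mu> where rad: "pos_radon betaM \<mu>" and test: "\<forall>u\<in>bdd_cont. \<forall>c f g.
      majorant u c f g \<longrightarrow> (\<integral>\<zeta>. \<zeta> u \<partial>\<mu>) \<le> c * norm \<phi> + P f - N g"
    using representing_measure by (elim exE conjE)
  note \<mu> = rad test[rule_format]
  have vi: "\<exists>n. P (rho - weight_op (cutoff n) rho) + N (rho - weight_op (cutoff n) rho) \<le> e" if "0 < e" for e
    using small[OF v1 that] .
  have vz: "\<exists>n. P (weight_op (cutoff n) rho) + N (weight_op (cutoff n) rho) \<le> e" if "0 < e" for e
    using small[OF v2 that] unfolding compl by blast
  show ?thesis
    by (intro exI[of _ \<mu>] conjI admissible_\<mu>[OF \<mu> vi vz] singular_pushforwards[OF \<mu> vi vz])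
qed

theorem theorem4p22:
  fixes \<phi> :: "'a::{complete_space, zero} lip0 \<Rightarrow>\<^sub>L real"
  shows "((\<exists>\<mu>. admissible_representation \<mu> \<phi>) \<longleftrightarrow>
            majorisable \<phi> \<and> avoids_zero \<phi> \<and> avoids_infinity \<phi>) \<and>
         ((\<exists>\<mu>. admissible_representation \<mu> \<phi>) \<longrightarrow>
            (\<exists>\<mu>. admissible_representation \<mu> \<phi> \<and>
                 mutually_singular (pushforward_off_base coord1 \<mu>)
                                   (pushforward_off_base coord2 \<mu>)))"
proof -
  have "majorisable \<phi> \<and> avoids_zero \<phi> \<and> avoids_infinity \<phi>" if "admissible_representation \<mu> \<phi>" for \<mu>
  proof -
    interpret admissible \<mu> \<phi> by (rule admissible.intro[OF that])
    show ?thesis using majorisable_\<phi> avoids_zero_\<phi> avoids_infinity_\<phi> by blast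
  qed
  then show ?thesis using ex_admissible_singular by blast
qed

end
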